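(* Let $\mathfrak{A}$ be a unital $\mathrm{C}^*$-algebra, $\mathfrak{S}\subset\mathfrak{A}$ an operator system, and $s\in\mathfrak{S}$ a self-adjoint element with $\|s\|=1$. Then a pure state $\omega$ on $\mathfrak{A}$ is $\mathfrak{S}$-peaking on $s$ if and only if its support projection $\mathfrak{s}_\omega\in\mathfrak{A}^{**}$ is an $\mathfrak{S}$-peaking projection peaking on $s$.
   Context: A state $\psi$ on $\mathfrak{A}$ is $\mathfrak{S}$-peaking on $s$ (for self-adjoint $s\in\mathfrak{S}$ with $\|s\|=1$) if $\psi(s)=1>|\phi(s)|$ for every state $\phi\neq\psi$ on $\mathfrak{A}$. $\mathfrak{A}^{**}$ is the universal enveloping von Neumann algebra of $\mathfrak{A}$; for a state $\phi$, $\widehat\phi$ is its unique weak-$*$ continuous extension to $\mathfrak{A}^{**}$, and the support projection $\mathfrak{s}_\phi$ is the unique projection with $\{x\in\mathfrak{A}^{**}:\widehat\phi(x^*x)=0\}=\mathfrak{A}^{**}(I-\mathfrak{s}_\phi)$. A projection $p\in\mathfrak{A}^{**}$ is $\mathfrak{S}$-peaking on $s$ if $sp=p$ and $|\phi(s)|<1$ for every state $\phi$ on $\mathfrak{A}$ with $\mathfrak{s}_\phi p=0$. *)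

theory Defs
  imports "HOL-Analysis.Analysis"
begin

class unital_cstar_algebra = real_normed_algebra_1 + banach +
  fixes scaleC :: "complex \<Rightarrow> 'a \<Rightarrow> 'a"
    and cstar :: "'a \<Rightarrow> 'a"
  assumes scaleC_add_right: "scaleC c (x + y) = scaleC c x + scaleC c y"
    and scaleC_add_left: "scaleC (b + c) x = scaleC b x + scaleC c x"
    and scaleC_scaleC: "scaleC b (scaleC c x) = scaleC (b * c) x"
    and scaleC_of_real: "scaleC (of_real r) x = scaleR r x"
    and norm_scaleC: "norm (scaleC c x) = cmod c * norm x"
    and mult_scaleC_left: "scaleC c x * y = scaleC c (x * y)"
    and mult_scaleC_right: "x * scaleC c y = scaleC c (x * y)"
    and cstar_cstar: "cstar (cstar x) = x"
    and cstar_add: "cstar (x + y) = cstar x + cstar y"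
    and cstar_mult: "cstar (x * y) = cstar y * cstar x"
    and cstar_scaleC: "cstar (scaleC c x) = scaleC (cnj c) (cstar x)"
    and cstar_identity: "norm (cstar x * x) = (norm x)\<^sup>2"

definition self_adjoint :: "'a::unital_cstar_algebra \<Rightarrow> bool" where
  "self_adjoint a \<longleftrightarrow> cstar a = a"

definition operator_system :: "'a::unital_cstar_algebra set \<Rightarrow> bool" where
  "operator_system S \<longleftrightarrow> 1 \<in> S \<and> 0 \<in> S \<and>
     (\<forall>x\<in>S. \<forall>y\<in>S. x + y \<in> S) \<and> (\<forall>c. \<forall>x\<in>S. scaleC c x \<in> S) \<and>
     (\<forall>x\<in>S. cstar x \<in> S)"

definition clinear_functional :: "('a::unital_cstar_algebra \<Rightarrow> complex) \<Rightarrow> bool" where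
  "clinear_functional f \<longleftrightarrow> (\<forall>x y. f (x + y) = f x + f y) \<and> (\<forall>c x. f (scaleC c x) = c * f x)"

definition dual_space :: "('a::unital_cstar_algebra \<Rightarrow> complex) set" where
  "dual_space = {f. clinear_functional f \<and> (\<exists>K. \<forall>x. cmod (f x) \<le> K * norm x)}"

definition dual_norm :: "('a::unital_cstar_algebra \<Rightarrow> complex) \<Rightarrow> real" where
  "dual_norm f = (SUP x\<in>{x. norm x \<le> 1}. cmod (f x))"

definition state :: "('a::unital_cstar_algebra \<Rightarrow> complex) \<Rightarrow> bool" where
  "state f \<longleftrightarrow> clinear_functional f \<and>
     (\<forall>a. f (cstar a * a) \<in> \<real> \<and> 0 \<le> Re (f (cstar a * a))) \<and> f 1 = 1"

definition pure_state :: "('a::unital_cstar_algebra \<Rightarrow> complex) \<Rightarrow> bool" where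
  "pure_state w \<longleftrightarrow> state w \<and>
     (\<forall>f g (t::real). state f \<longrightarrow> state g \<longrightarrow> 0 < t \<longrightarrow> t < 1 \<longrightarrow>
        w = (\<lambda>a. of_real t * f a + of_real (1 - t) * g a) \<longrightarrow> f = w \<and> g = w)"

text \<open>Elements of A** are bounded complex linear functionals on A*,
  normalised to vanish outside A*.\<close>
type_synonym 'a bidual = "('a \<Rightarrow> complex) \<Rightarrow> complex"

definition bidual_space :: "'a::unital_cstar_algebra bidual set" where
  "bidual_space = {F.
     (\<forall>f\<in>dual_space. \<forall>g\<in>dual_space. F (\<lambda>a. f a + g a) = F f + F g) \<and>
     (\<forall>c. \<forall>f\<in>dual_space. F (\<lambda>a. c * f a) = c * F f) \<and>
     (\<exists>K. \<forall>f\<in>dual_space. cmod (F f) \<le> K * dual_norm f) \<and>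
     (\<forall>f. f \<notin> dual_space \<longrightarrow> F f = 0)}"

definition bd_embed :: "'a::unital_cstar_algebra \<Rightarrow> 'a bidual" where
  "bd_embed a = (\<lambda>f. if f \<in> dual_space then f a else 0)"

definition dual_act :: "('a::unital_cstar_algebra \<Rightarrow> complex) \<Rightarrow> 'a \<Rightarrow> ('a \<Rightarrow> complex)" where
  "dual_act f a = (\<lambda>b. f (a * b))"

definition bidual_act :: "'a::unital_cstar_algebra bidual \<Rightarrow> ('a \<Rightarrow> complex) \<Rightarrow> ('a \<Rightarrow> complex)" where
  "bidual_act F f = (\<lambda>a. F (dual_act f a))"

text \<open>Arens product on A**: (G F)(f) = G(F.f).\<close>
definition bd_mult :: "'a::unital_cstar_algebra bidual \<Rightarrow> 'a bidual \<Rightarrow> 'a bidual" (infixl "\<star>" 70) where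
  "G \<star> F = (\<lambda>f. if f \<in> dual_space then G (bidual_act F f) else 0)"

definition dual_star :: "('a::unital_cstar_algebra \<Rightarrow> complex) \<Rightarrow> ('a \<Rightarrow> complex)" where
  "dual_star f = (\<lambda>a. cnj (f (cstar a)))"

definition bd_star :: "'a::unital_cstar_algebra bidual \<Rightarrow> 'a bidual" where
  "bd_star F = (\<lambda>f. if f \<in> dual_space then cnj (F (dual_star f)) else 0)"

definition bd_projection :: "'a::unital_cstar_algebra bidual \<Rightarrow> bool" where
  "bd_projection p \<longleftrightarrow> p \<in> bidual_space \<and> bd_star p = p \<and> p \<star> p = p"

text \<open>Weak-* continuous extension of a state phi to A**: evaluation at phi.\<close>
definition state_ext :: "('a::unital_cstar_algebra \<Rightarrow> complex) \<Rightarrow> 'a bidual \<Rightarrow> complex" where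
  "state_ext \<phi> x = x \<phi>"

definition support_proj :: "('a::unital_cstar_algebra \<Rightarrow> complex) \<Rightarrow> 'a bidual" where
  "support_proj \<phi> = (THE p. bd_projection p \<and>
     {x\<in>bidual_space. state_ext \<phi> (bd_star x \<star> x) = 0} =
     {y \<star> (\<lambda>f. bd_embed 1 f - p f) | y. y \<in> bidual_space})"

definition S_peaking_state ::
  "'a::unital_cstar_algebra set \<Rightarrow> 'a \<Rightarrow> ('a \<Rightarrow> complex) \<Rightarrow> bool" where
  "S_peaking_state S s \<psi> \<longleftrightarrow> s \<in> S \<and> self_adjoint s \<and> norm s = 1 \<and>
     state \<psi> \<and> \<psi> s = 1 \<and> (\<forall>\<phi>. state \<phi> \<and> \<phi> \<noteq> \<psi> \<longrightarrow> cmod (\<phi> s) < 1)"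

definition S_peaking_proj ::
  "'a::unital_cstar_algebra set \<Rightarrow> 'a \<Rightarrow> 'a bidual \<Rightarrow> bool" where
  "S_peaking_proj S s p \<longleftrightarrow> s \<in> S \<and> self_adjoint s \<and> norm s = 1 \<and>
     bd_projection p \<and> bd_embed s \<star> p = p \<and>
     (\<forall>\<phi>. state \<phi> \<and> support_proj \<phi> \<star> p = (\<lambda>_. 0) \<longrightarrow> cmod (\<phi> s) < 1)"

end

theory Submission
  imports Defs
begin

text \<open>
  The bidual is a C*-algebra: every bounded functional \<open>f\<close> satisfies \<open>|f a|\<^sup>2 \<le> g (a* a)\<close> for a
  positive functional \<open>g\<close>, so it is represented in the GNS space of \<open>g\<close>; this gives Arens
  regularity and the C*-identity. A weak-* cluster point of an approximate right unit of the left
  kernel of a state \<open>\<phi>\<close> in the bidual is a projection \<open>q\<close>, and \<open>1 - q\<close> is the support of \<open>\<phi>\<close>.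

  Let \<open>p\<close> be the support of \<open>\<omega>\<close> and \<open>q = 1 - p\<close>. If \<open>\<omega> s = 1\<close> then \<open>1 - s\<close> lies in the left
  kernel of \<open>\<omega>\<close>, that is, \<open>s p = p\<close>. Conversely, let \<open>p\<close> peak on \<open>s\<close> and let \<open>\<phi> \<noteq> \<omega>\<close> be a state
  with \<open>|\<phi> s| = 1\<close>. If \<open>\<phi> s = -1\<close> then the support of \<open>\<phi>\<close> is orthogonal to \<open>p\<close>. If \<open>\<phi> s = 1\<close>
  then so is the support of the normalised compression \<open>\<phi> (q \<cdot> q)\<close>, which also takes the value 1
  at \<open>s\<close>. The compression is nonzero because \<open>\<omega>\<close> is the only state supported by \<open>p\<close>: purity and
  Hahn--Banach duality give, for self-adjoint \<open>x\<close> with \<open>\<omega> x = 0\<close>, elements \<open>y \<ge> 0\<close>, \<open>y \<ge> x\<close> with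
  \<open>\<omega> y\<close> arbitrarily small, and cutting off by \<open>(1 + n y)\<^sup>-\<^sup>1\<close> yields \<open>\<phi> x \<le> 0\<close>.
\<close>

subsection \<open>The involution\<close>

text \<open>No Hilbert space is built and no spectral theory is used. Positivity is a norm
  condition, square roots come from an iteration, and a vector of a GNS space is replaced by a
  near-minimiser taken from the algebra itself. Identities in the bidual are therefore proved up to
  \<open>\<epsilon>\<close> times a fixed constant.

  Much of what is shown for an abstract algebra is used twice. Once the bidual is an instance of the
  class, positivity, Cauchy--Schwarz, left kernels and approximate units also hold there for the
  extensions of positive functionals, and the support projection comes out of this second use.

  The two signs of \<open>\<phi> s\<close> behave differently because \<open>s p = p\<close>. At the
  value -1 the state cannot see \<open>p\<close> at all. At the value 1 it may live partly on
  \<open>p\<close>, where \<open>s\<close> acts as 1, so the hypothesis on states orthogonal to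
  \<open>p\<close> says nothing about \<open>\<phi>\<close>; it does apply to the part of
  \<open>\<phi>\<close> on \<open>q\<close>.\<close>

lemma cstar_one [simp]: "cstar (1::'a::unital_cstar_algebra) = 1"
  by (metis cstar_cstar cstar_mult mult.right_neutral)

lemma cstar_scaleR: "cstar (r *\<^sub>R x) = r *\<^sub>R cstar (x::'a::unital_cstar_algebra)"
  by (metis scaleC_of_real cstar_scaleC complex_cnj_complex_of_real)

lemma norm_cstar [simp]: "norm (cstar x) = norm (x::'a::unital_cstar_algebra)"
proof -
  have le: "norm y \<le> norm (cstar y)" for y :: 'a
  proof (cases "y = 0")
    case False
    have "norm y * norm y \<le> norm (cstar y) * norm y"
      by (metis cstar_identity norm_mult_ineq power2_eq_square)
    then show ?thesis using False by simp
  qed simp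
  from le[of x] le[of "cstar x"] show ?thesis by (simp add: cstar_cstar)
qed

lemma bounded_linear_cstar: "bounded_linear (cstar :: 'a::unital_cstar_algebra \<Rightarrow> 'a)"
  by (rule bounded_linear_intro[where K = 1]) (simp_all add: cstar_add cstar_scaleR)

lemma cstar_zero [simp]: "cstar (0::'a::unital_cstar_algebra) = 0"
  using bounded_linear.linear[OF bounded_linear_cstar] by (rule linear_0)

lemma cstar_minus [simp]: "cstar (- x) = - cstar (x::'a::unital_cstar_algebra)"
  using bounded_linear.linear[OF bounded_linear_cstar] by (rule linear_neg)

lemma cstar_diff: "cstar (x - y) = cstar x - cstar (y::'a::unital_cstar_algebra)"
  using bounded_linear.linear[OF bounded_linear_cstar] by (rule linear_diff)

lemma cstar_of_real [simp]: "cstar (of_real r) = (of_real r :: 'a::unital_cstar_algebra)"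
  by (simp add: of_real_def cstar_scaleR)

lemmas tendsto_cstar = bounded_linear.tendsto[OF bounded_linear_cstar]

lemmas cstar_simps = cstar_add cstar_diff cstar_scaleR cstar_mult cstar_cstar cstar_scaleC

lemma scaleC_one [simp]: "scaleC 1 x = (x::'a::unital_cstar_algebra)"
  using scaleC_of_real[of 1 x] by simp

lemma scaleC_minus_one [simp]: "scaleC (-1) x = - (x::'a::unital_cstar_algebra)"
  using scaleC_of_real[of "-1" x] by simp

lemma scaleC_zero_right [simp]: "scaleC c (0::'a::unital_cstar_algebra) = 0"
  using scaleC_add_right[of c 0 0] by simp

lemma scaleC_minus_right: "scaleC c (- x) = - scaleC c (x::'a::unital_cstar_algebra)"
  using scaleC_add_right[of c x "-x"] by (simp add: add_eq_0_iff)

lemma scaleC_minus_left: "scaleC (- c) x = - scaleC c (x::'a::unital_cstar_algebra)"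
  using scaleC_scaleC[of "-1" c x] by simp

lemma scaleC_diff_right: "scaleC c (x - y) = scaleC c x - scaleC c (y::'a::unital_cstar_algebra)"
  using scaleC_add_right[of c x "-y"] by (simp add: scaleC_minus_right)

lemma scaleC_scaleR: "scaleC c (r *\<^sub>R x) = r *\<^sub>R scaleC c (x::'a::unital_cstar_algebra)"
  by (simp flip: scaleC_of_real add: scaleC_scaleC mult.commute)

lemma scaleC_ii_ii [simp]: "scaleC \<i> (scaleC \<i> x) = - (x::'a::unital_cstar_algebra)"
  by (simp add: scaleC_scaleC)

lemma norm_self_adjoint_square: "self_adjoint x \<Longrightarrow> norm (x * x) = (norm x)\<^sup>2"
  by (metis cstar_identity self_adjoint_def)

lemma cstar_mult_eq_0: "cstar x * x = 0 \<Longrightarrow> x = (0::'a::unital_cstar_algebra)"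
  using cstar_identity[of x] by simp

subsection \<open>Square roots and positive elements\<close>

text \<open>Writing the root as \<open>1 - s\<close>, the equation
  \<open>(1 - s)(1 - s) = 1 - k\<close> says that \<open>s\<close> is a fixed point of
  \<open>z \<mapsto> (k + z z)/2\<close>. Iterating from 0 produces polynomials in \<open>k\<close>,
  which explains self-adjointness and the commutation property. The bound on \<open>1 - w\<close> is
  what later makes the root positive.\<close>

lemma sqrt_one_minus_exists:
  fixes k :: "'a::unital_cstar_algebra"
  assumes "self_adjoint k" and k1: "norm k \<le> 1"
  obtains w where "self_adjoint w" "w * w = 1 - k" "\<And>c. c * k = k * c \<Longrightarrow> c * w = w * c"
    "norm (1 - w) \<le> 1"
proof -
  have sk: "cstar k = k" using assms by (simp add: self_adjoint_def)
  define y where "y = rec_nat (0::'a) (\<lambda>_ z. (1/2) *\<^sub>R (k + z * z))"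
  \<comment> \<open>The same recursion with \<open>k\<close> replaced by the number 1. It increases,
    stays below 1 and majorises the increments of \<open>y\<close>, so the iteration converges even
    if \<open>k\<close> has norm exactly 1, where a geometric estimate fails.\<close>
  define e where "e = rec_nat (0::real) (\<lambda>_ z. (1/2) * (1 + z * z))"
  have y0: "y 0 = 0" and yS: "y (Suc n) = (1/2) *\<^sub>R (k + y n * y n)" for n
    by (simp_all add: y_def)
  have e0: "e 0 = 0" and eS: "e (Suc n) = (1/2) * (1 + e n * e n)" for n
    by (simp_all add: e_def)
  have ebd: "0 \<le> e n \<and> e n \<le> 1" for n
  proof (induction n)
    case (Suc n)
    then have "e n * e n \<le> 1" by (simp add: mult_le_one)
    then show ?case by (simp add: eS)
  qed (simp add: e0)
  have yn: "norm (y n) \<le> e n" for n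
  proof (induction n)
    case (Suc n)
    have "norm (k + y n * y n) \<le> norm k + norm (y n) * norm (y n)"
      by (rule order_trans[OF norm_triangle_ineq]) (simp add: norm_mult_ineq)
    also have "\<dots> \<le> 1 + e n * e n"
      using k1 Suc ebd by (intro add_mono mult_mono) auto
    finally show ?case by (simp add: yS eS)
  qed (simp add: y0 e0)
  have yd: "norm (y (Suc n) - y n) \<le> e (Suc n) - e n" for n
  proof (induction n)
    case 0 then show ?case using k1 by (simp add: y0 e0 yS eS)
  next
    case (Suc n)
    \<comment> \<open>The difference of two squares is written as
      \<open>a (a - b) + (a - b) b\<close>, an identity that does not require the iterates to
      commute.\<close>
    have eq: "y (Suc (Suc n)) - y (Suc n)
        = (1/2) *\<^sub>R (y (Suc n) * (y (Suc n) - y n) + (y (Suc n) - y n) * y n)"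
      unfolding yS[of "Suc n"] yS[of n, symmetric]
      by (subst (2) yS) (simp add: algebra_simps)
    have "norm (y (Suc n) * (y (Suc n) - y n) + (y (Suc n) - y n) * y n)
        \<le> norm (y (Suc n)) * norm (y (Suc n) - y n) + norm (y (Suc n) - y n) * norm (y n)"
      by (rule order_trans[OF norm_triangle_ineq]) (simp add: norm_mult_ineq add_mono)
    also have "\<dots> \<le> e (Suc n) * (e (Suc n) - e n) + (e (Suc n) - e n) * e n"
      using Suc yn[of n] yn[of "Suc n"] ebd
      by (intro add_mono mult_mono) (auto dest: order_trans[OF norm_ge_zero])
    also have "\<dots> = 2 * (e (Suc (Suc n)) - e (Suc n))"
      by (subst (3) eS, subst eS[of "Suc n"]) (simp add: algebra_simps)
    finally show ?case by (simp add: eq)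
  qed
  have emono: "incseq e"
    using order_trans[OF norm_ge_zero yd] by (intro incseq_SucI) simp
  obtain l where l: "e \<longlonglongrightarrow> l"
    using incseq_convergent[OF emono] ebd by blast
  have "summable (\<lambda>n. e (Suc n) - e n)"
    using telescope_summable[OF l] .
  then have "summable (\<lambda>n. y (Suc n) - y n)"
    by (rule summable_comparison_test[rotated]) (use yd in auto)
  then obtain s where s: "(\<lambda>n. \<Sum>i<n. y (Suc i) - y i) \<longlonglongrightarrow> s"
    unfolding summable_def sums_def by blast
  have "(\<Sum>i<n. y (Suc i) - y i) = y n" for n by (simp add: sum_lessThan_telescope y0)
  with s have s: "y \<longlonglongrightarrow> s" by simp
  have lim: "(\<lambda>n. y (Suc n)) \<longlonglongrightarrow> (1/2) *\<^sub>R (k + s * s)"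
    unfolding yS by (intro tendsto_intros s)
  have fix_eq: "s = (1/2) *\<^sub>R (k + s * s)"
    using LIMSEQ_unique[OF LIMSEQ_Suc[OF s] lim] .
  have "cstar (y n) = y n" for n
    by (induction n) (simp_all add: y0 yS cstar_simps sk)
  with tendsto_cstar[OF s] s have sas: "cstar s = s" by (simp add: LIMSEQ_unique)
  have comm: "c * s = s * c" if "c * k = k * c" for c
  proof -
    have "c * y n = y n * c" for n
    proof (induction n)
      case (Suc n)
      then have "c * (y n * y n) = (y n * y n) * c" by (metis mult.assoc)
      with that show ?case by (simp add: yS distrib_left distrib_right)
    qed (simp add: y0)
    moreover have "(\<lambda>n. c * y n) \<longlonglongrightarrow> c * s" "(\<lambda>n. y n * c) \<longlonglongrightarrow> s * c"
      by (intro tendsto_intros s)+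
    ultimately show ?thesis using LIMSEQ_unique by auto
  qed
  show thesis
  proof (rule that[of "1 - s"])
    show "self_adjoint (1 - s)" by (simp add: self_adjoint_def cstar_simps sas)
    have "2 *\<^sub>R s = k + s * s" by (subst fix_eq) simp
    then have "s + s = k + s * s" by (simp add: scaleR_2)
    then show "(1 - s) * (1 - s) = 1 - k" by (simp add: algebra_simps)
    show "c * (1 - s) = (1 - s) * c" if "c * k = k * c" for c
      using comm[OF that] by (simp add: algebra_simps)
    have "norm (y n) \<le> 1" for n using yn[of n] ebd[of n] by linarith
    then have "norm s \<le> 1" by (intro Lim_norm_ubound[OF _ s]) auto
    then show "norm (1 - (1 - s)) \<le> 1" by simp
  qed
qed

text \<open>For self-adjoint \<open>h\<close> the norm condition says that the spectrum lies in
  \<open>[0, 2 t]\<close>. In this form the triangle inequality alone shows that sums of positive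
  elements are positive.\<close>

definition positive_elem :: "'a::unital_cstar_algebra \<Rightarrow> bool" where
  "positive_elem h \<longleftrightarrow> self_adjoint h \<and> (\<exists>t\<ge>0. norm (of_real t - h) \<le> t)"

lemma positive_elem_self_adjoint: "positive_elem h \<Longrightarrow> self_adjoint h"
  by (simp add: positive_elem_def)

lemma positive_elem_zero [simp]: "positive_elem 0"
  by (auto simp: positive_elem_def self_adjoint_def intro: exI[of _ 0])

lemma positive_elem_add:
  assumes "positive_elem h" "positive_elem k" shows "positive_elem (h + k)"
proof -
  obtain s t where "0 \<le> s" "norm (of_real s - h) \<le> s" "0 \<le> t" "norm (of_real t - k) \<le> t"
    using assms by (auto simp: positive_elem_def)
  moreover have "norm (of_real (s + t) - (h + k)) \<le> norm (of_real s - h) + norm (of_real t - k)"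
    using norm_triangle_ineq[of "of_real s - h" "of_real t - k"] by (simp add: algebra_simps)
  ultimately have "0 \<le> s + t \<and> norm (of_real (s + t) - (h + k)) \<le> s + t" by simp
  moreover have "self_adjoint (h + k)"
    using assms by (simp add: positive_elem_def self_adjoint_def cstar_add)
  ultimately show ?thesis unfolding positive_elem_def by blast
qed

lemma positive_elem_scaleR:
  assumes "positive_elem h" "0 \<le> r" shows "positive_elem (r *\<^sub>R h)"
proof -
  obtain t where t: "0 \<le> t" "norm (of_real t - h) \<le> t"
    using assms by (auto simp: positive_elem_def)
  have "of_real (r * t) - r *\<^sub>R h = r *\<^sub>R (of_real t - h)"
    by (simp add: of_real_def scaleR_right_diff_distrib)
  then have "norm (of_real (r * t) - r *\<^sub>R h) = r * norm (of_real t - h)"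
    using assms(2) by simp
  also have "\<dots> \<le> r * t" using t assms(2) by (simp add: mult_left_mono)
  finally have "0 \<le> r * t \<and> norm (of_real (r * t) - r *\<^sub>R h) \<le> r * t"
    using t assms(2) by simp
  moreover have "self_adjoint (r *\<^sub>R h)"
    using assms by (simp add: positive_elem_def self_adjoint_def cstar_scaleR)
  ultimately show ?thesis unfolding positive_elem_def by blast
qed

lemma positive_elem_sum: "(\<And>x. x \<in> X \<Longrightarrow> positive_elem (f x)) \<Longrightarrow> positive_elem (sum f X)"
  by (induction X rule: infinite_finite_induct) (simp_all add: positive_elem_add)

lemma positive_elem_norm_minus:
  assumes "self_adjoint h" "norm h \<le> t" shows "positive_elem (of_real t - h)"
proof -
  have "norm (of_real t - (of_real t - h)) \<le> t" "0 \<le> t"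
    using assms(2) order_trans[OF norm_ge_zero] by auto
  moreover have "self_adjoint (of_real t - h)"
    using assms(1) by (simp add: self_adjoint_def cstar_diff)
  ultimately show ?thesis unfolding positive_elem_def by blast
qed

lemma positive_elem_of_real: "0 \<le> t \<Longrightarrow> positive_elem (of_real t)"
  using positive_elem_norm_minus[of 0 t] by (simp add: self_adjoint_def)

text \<open>After division by \<open>t\<close> the element is \<open>1 - k\<close> with
  \<open>k\<close> in the unit ball, so the iteration applies; the factor \<open>sqrt t\<close>
  undoes the scaling.\<close>

lemma positive_elem_sqrt:
  assumes "positive_elem h"
  obtains w where "self_adjoint w" "w * w = h" "\<And>c. c * h = h * c \<Longrightarrow> c * w = w * c"
    "positive_elem w"
proof -
  obtain t0 where t0: "0 \<le> t0" "norm (of_real t0 - h) \<le> t0"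
    using assms by (auto simp: positive_elem_def)
  \<comment> \<open>The radius in the definition may be 0; enlarging it by 1 keeps the norm
    condition and allows division.\<close>
  define t where "t = t0 + 1"
  have t: "0 < t" "norm (of_real t - h) \<le> t"
    using t0 norm_triangle_ineq[of "of_real t0 - h" 1] by (auto simp: t_def algebra_simps)
  define k where "k = 1 - (1/t) *\<^sub>R h"
  have "k = (1/t) *\<^sub>R (of_real t - h)"
    using t by (simp add: k_def of_real_def scaleR_right_diff_distrib)
  then have "norm k = (1/t) * norm (of_real t - h)" using t by simp
  then have "norm k \<le> 1" using t by simp
  moreover have "self_adjoint k"
    using assms by (simp add: k_def positive_elem_def self_adjoint_def cstar_simps)
  ultimately obtain w where w: "self_adjoint w" "w * w = 1 - k" "\<And>c. c * k = k * c \<Longrightarrow> c * w = w * c"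
    "norm (1 - w) \<le> 1"
    using sqrt_one_minus_exists by metis
  show thesis
  proof (rule that[of "sqrt t *\<^sub>R w"])
    show "self_adjoint (sqrt t *\<^sub>R w)" using w(1) by (simp add: self_adjoint_def cstar_scaleR)
    show "(sqrt t *\<^sub>R w) * (sqrt t *\<^sub>R w) = h" using t w(2) by (simp add: k_def)
    show "c * (sqrt t *\<^sub>R w) = (sqrt t *\<^sub>R w) * c" if "c * h = h * c" for c
      using that w(3)[of c] by (simp add: k_def algebra_simps)
    have "positive_elem w"
      using w(1,4) unfolding positive_elem_def by (auto intro!: exI[of _ 1])
    then show "positive_elem (sqrt t *\<^sub>R w)"
      using t by (intro positive_elem_scaleR) auto
  qed
qed

text \<open>If \<open>k\<close> has norm at most 1 and \<open>w\<close> is the root of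
  \<open>1 - k k\<close>, then \<open>u = k + i w\<close> satisfies \<open>u* u = 1\<close> and
  plays the part of \<open>cos + i sin\<close>. The double angle formula expresses
  \<open>1 - k k\<close> through \<open>u u\<close> and \<open>u* u*\<close>, whose norms are at
  most 1. General elements are scaled into this case.\<close>

lemma positive_elem_square:
  fixes h :: "'a::unital_cstar_algebra"
  assumes "self_adjoint h" shows "positive_elem (h * h)"
proof -
  have hs: "cstar h = h" using assms by (simp add: self_adjoint_def)
  have small: "positive_elem (k * k)" if sk: "self_adjoint k" and k1: "norm k \<le> 1" for k :: 'a
  proof -
    have ck: "cstar k = k" using sk by (simp add: self_adjoint_def)
    have "norm (k * k) \<le> 1"
      using norm_self_adjoint_square[OF sk] k1 by (simp add: power_le_one)
    moreover have "self_adjoint (k * k)" by (simp add: self_adjoint_def cstar_mult ck)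
    ultimately obtain w where w: "self_adjoint w" "w * w = 1 - k * k"
      "\<And>c. c * (k * k) = (k * k) * c \<Longrightarrow> c * w = w * c"
      using sqrt_one_minus_exists by metis
    have cw: "cstar w = w" using w(1) by (simp add: self_adjoint_def)
    have kw: "k * w = w * k" using w(3)[of k] by (simp add: mult.assoc)
    define u where "u = k + scaleC \<i> w"
    have cu: "cstar u = k - scaleC \<i> w"
      by (simp add: u_def cstar_simps ck cw scaleC_minus_left)
    have uu: "cstar u * u = 1"
      unfolding cu by (simp add: u_def algebra_simps mult_scaleC_left mult_scaleC_right scaleC_diff_right scaleC_add_right kw w(2))
    then have nu: "norm u = 1" using cstar_identity[of u] by (simp add: power2_eq_1_iff)
      (metis norm_ge_zero neg_0_le_iff_le not_one_le_zero)
    have four: "4 *\<^sub>R x = 2 *\<^sub>R x + 2 *\<^sub>R x" for x :: 'a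
      by (simp flip: scaleR_add_left)
    have sq: "u * u + cstar u * cstar u = 4 *\<^sub>R (k * k) - 2 *\<^sub>R 1"
    proof -
      have "u * u + cstar u * cstar u = 2 *\<^sub>R (k * k) - 2 *\<^sub>R (w * w)"
        unfolding cu by (simp add: u_def algebra_simps mult_scaleC_left mult_scaleC_right scaleC_diff_right scaleC_add_right scaleR_2)
      then show ?thesis by (simp add: w(2) scaleR_right_diff_distrib four)
    qed
    have "4 *\<^sub>R (1 - k * k) = 2 *\<^sub>R 1 - (u * u + cstar u * cstar u)"
      unfolding sq by (simp add: scaleR_right_diff_distrib four)
    then have "norm (4 *\<^sub>R (1 - k * k)) \<le> norm (2 *\<^sub>R (1::'a)) + norm (u * u + cstar u * cstar u)"
      using norm_triangle_ineq4 by metis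
    also have "norm (u * u + cstar u * cstar u) \<le> norm u * norm u + norm (cstar u) * norm (cstar u)"
      by (rule order_trans[OF norm_triangle_ineq]) (intro add_mono norm_mult_ineq)
    finally have "norm (1 - k * k) \<le> 1" by (simp add: nu)
    then show ?thesis
      using \<open>self_adjoint (k * k)\<close> unfolding positive_elem_def by (auto intro!: exI[of _ 1])
  qed
  define r where "r = norm h + 1"
  have r: "r > 0" by (simp add: r_def add_nonneg_pos)
  have "positive_elem (((1/r) *\<^sub>R h) * ((1/r) *\<^sub>R h))"
    using r by (intro small) (simp_all add: self_adjoint_def cstar_scaleR hs r_def)
  from positive_elem_scaleR[OF this, of "r * r"] r show ?thesis by simp
qed

text \<open>For commuting \<open>w\<close> and \<open>v\<close> the element
  \<open>z = w + i v\<close> satisfies \<open>z* z = w w + v v\<close>, and \<open>w\<close> is the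
  real part of \<open>z\<close>. This is the source of antisymmetry and of the monotonicity of the
  norm.\<close>

lemma positive_elem_sum_squares_commute:
  assumes "self_adjoint w" "self_adjoint v" "w * v = v * w"
  shows "(norm w)\<^sup>2 \<le> norm (w * w + v * v)"
proof -
  define z where "z = w + scaleC \<i> v"
  have cz: "cstar z = w - scaleC \<i> v"
    using assms by (simp add: z_def cstar_simps scaleC_minus_left self_adjoint_def)
  have "cstar z * z = w * w + v * v"
    unfolding cz using assms(3) by (simp add: z_def algebra_simps mult_scaleC_left mult_scaleC_right scaleC_diff_right scaleC_add_right)
  then have nz: "(norm z)\<^sup>2 = norm (w * w + v * v)" using cstar_identity[of z] by simp
  have "2 *\<^sub>R w = z + cstar z" unfolding cz by (simp add: z_def scaleR_2)
  then have "2 * norm w \<le> norm z + norm (cstar z)"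
    by (metis norm_scaleR norm_triangle_ineq abs_numeral)
  then have "norm w \<le> norm z" by simp
  then show ?thesis by (simp add: power_mono flip: nz)
qed

text \<open>The roots of \<open>c\<close> and of \<open>- c\<close> commute and their squares add up
  to 0.\<close>

lemma positive_elem_antisym:
  assumes "positive_elem c" "positive_elem (- c)" shows "c = 0"
proof -
  obtain w where w: "self_adjoint w" "w * w = c" "\<And>d. d * c = c * d \<Longrightarrow> d * w = w * d"
    using positive_elem_sqrt[OF assms(1)] by metis
  obtain v where v: "self_adjoint v" "v * v = - c" "\<And>d. d * (- c) = (- c) * d \<Longrightarrow> d * v = v * d"
    using positive_elem_sqrt[OF assms(2)] by metis
  have "w * v = v * w" using v(3)[of w] w(2) by (metis minus_mult_left minus_mult_right mult.assoc)
  from positive_elem_sum_squares_commute[OF w(1) v(1) this] w(2) v(2) show ?thesis by simp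
qed

text \<open>The roots \<open>w\<close> of \<open>x\<close> and \<open>v\<close> of
  \<open>t - x\<close> commute, and their squares add up to \<open>t\<close>, so the square of the
  norm of \<open>w\<close> is at most \<open>|t|\<close>.\<close>

lemma norm_le_of_positive_elem:
  assumes "positive_elem x" "positive_elem (of_real t - x)" shows "norm x \<le> t"
proof -
  obtain w where w: "self_adjoint w" "w * w = x" "\<And>d. d * x = x * d \<Longrightarrow> d * w = w * d"
    using positive_elem_sqrt[OF assms(1)] by metis
  obtain v where v: "self_adjoint v" "v * v = of_real t - x"
    "\<And>d. d * (of_real t - x) = (of_real t - x) * d \<Longrightarrow> d * v = v * d"
    using positive_elem_sqrt[OF assms(2)] by metis
  have "w * x = x * w" using w(2) by (metis mult.assoc)
  then have "w * v = v * w" by (intro v(3)) (simp add: algebra_simps of_real_def)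
  from positive_elem_sum_squares_commute[OF w(1) v(1) this]
  have le: "norm x \<le> \<bar>t\<bar>" using w(2) v(2) norm_self_adjoint_square[OF w(1)] by simp
  show ?thesis
  proof (cases "0 \<le> t")
    \<comment> \<open>A negative \<open>t\<close> is contradictory: \<open>- x\<close> would be
      positive as well, hence \<open>x = 0\<close>, and then both \<open>t\<close> and
      \<open>- t\<close> would be positive elements.\<close>
    case False
    have "positive_elem (of_real (- t))" using False by (intro positive_elem_of_real) simp
    from positive_elem_add[OF assms(2) this] have "positive_elem (- x)" by simp
    then have "x = 0" using assms(1) positive_elem_antisym by blast
    then have "positive_elem (of_real t :: 'a)" using assms(2) by simp
    moreover have "positive_elem (- of_real t :: 'a)"
      using positive_elem_of_real[of "- t"] False by simp
    ultimately have "(of_real t :: 'a) = 0" using positive_elem_antisym by blast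
    with False show ?thesis by simp
  qed (use le in simp)
qed

lemma norm_mono_positive_elem:
  assumes "positive_elem x" "positive_elem (y - x)" shows "norm x \<le> norm y"
proof (rule norm_le_of_positive_elem[OF assms(1)])
  have "self_adjoint y"
    using positive_elem_add[OF assms] by (simp add: positive_elem_def)
  then have "positive_elem (of_real (norm y) - y)" by (intro positive_elem_norm_minus) auto
  from positive_elem_add[OF this assms(2)] show "positive_elem (of_real (norm y) - x)" by simp
qed

section \<open>Inverses, resolvents and positivity through invertible shifts\<close>

lemma geometric_inverse_exists:
  fixes x :: "'a::unital_cstar_algebra"
  assumes "norm (1 - x) < 1" obtains y where "x * y = 1" "y * x = 1"
proof -
  define k where "k = 1 - x"
  have s: "summable (\<lambda>n. k ^ n)"
    by (rule summable_comparison_test'[OF summable_geometric[of "norm k"]])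
      (use assms in \<open>auto simp: k_def norm_power_ineq\<close>)
  have split: "suminf (\<lambda>n. k ^ Suc n) = suminf (\<lambda>n. k ^ n) - 1"
    using suminf_split_head[OF s] by simp
  have 1: "k * suminf (\<lambda>n. k ^ n) = suminf (\<lambda>n. k ^ n) - 1"
    using suminf_mult[OF s, of k] split by simp
  have 2: "suminf (\<lambda>n. k ^ n) * k = suminf (\<lambda>n. k ^ n) - 1"
    using suminf_mult2[OF s, of k] split by (simp add: power_Suc2 del: power_Suc)
  show thesis
    by (rule that[of "suminf (\<lambda>n. k ^ n)"]) (use 1 2 in \<open>simp_all add: k_def algebra_simps\<close>)
qed

lemma shifted_positive_elem_inverse:
  fixes h :: "'a::unital_cstar_algebra"
  assumes "positive_elem h" "0 < t"
  obtains y where "(of_real t + h) * y = 1" "y * (of_real t + h) = 1"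
proof -
  obtain T where T: "0 \<le> T" "norm (of_real T - h) \<le> T"
    using assms by (auto simp: positive_elem_def)
  \<comment> \<open>With this scaling \<open>1 - x\<close> has norm at most
    \<open>T / (T + t)\<close>, which is below 1 because \<open>t\<close> is positive.\<close>
  define x where "x = (1 / (T + t)) *\<^sub>R (of_real t + h)"
  have "1 - x = (1 / (T + t)) *\<^sub>R ((T + t) *\<^sub>R 1 - (of_real t + h))"
    using T assms by (simp add: x_def scaleR_right_diff_distrib)
  also have "\<dots> = (1 / (T + t)) *\<^sub>R (of_real T - h)"
    by (simp add: of_real_def scaleR_add_left)
  finally have "norm (1 - x) < 1" using T assms by simp
  then obtain y where y: "x * y = 1" "y * x = 1" by (rule geometric_inverse_exists)
  show thesis
    by (rule that[of "(1 / (T + t)) *\<^sub>R y"]) (use y in \<open>simp_all add: x_def\<close>)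
qed

lemma inverse_commute:
  fixes k :: "'a::monoid_mult"
  assumes "k * y = 1" "y * k = 1" "c * k = k * c" shows "c * y = y * c"
proof -
  have "c * y = y * k * c * y" by (simp add: assms)
  also have "\<dots> = y * (c * k) * y" by (metis assms(3) mult.assoc)
  also have "\<dots> = y * c" by (simp add: assms(1) mult.assoc)
  finally show ?thesis .
qed

lemma self_adjoint_inverse:
  assumes "self_adjoint k" "k * y = 1" "y * k = 1" shows "self_adjoint y"
proof -
  have "cstar y * k = 1" using assms by (metis cstar_mult cstar_one self_adjoint_def)
  then have "cstar y = y" using assms(2) by (metis mult.assoc mult.left_neutral mult.right_neutral)
  then show ?thesis by (simp add: self_adjoint_def)
qed

lemma self_adjoint_mult_commute:
  "self_adjoint a \<Longrightarrow> self_adjoint b \<Longrightarrow> a * b = b * a \<Longrightarrow> self_adjoint (a * b)"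
  by (simp add: self_adjoint_def cstar_mult)

lemma positive_elem_norm_bound:
  assumes "positive_elem h" "norm h \<le> t" shows "norm (of_real t - h) \<le> t"
  by (rule norm_le_of_positive_elem)
    (use assms in \<open>auto intro: positive_elem_norm_minus positive_elem_self_adjoint\<close>)

text \<open>The radius in the definition of positivity could grow as \<open>\<epsilon>\<close> tends
  to 0. By \<open>positive_elem_norm_bound\<close> any bound of the norm may serve as radius, so
  \<open>norm c + 1\<close> works for every \<open>\<epsilon>\<close> up to 1 and the inequality
  passes to the limit.\<close>

lemma positive_elem_limit:
  fixes c :: "'a::unital_cstar_algebra"
  assumes "self_adjoint c" "\<And>\<epsilon>. 0 < \<epsilon> \<Longrightarrow> positive_elem (of_real \<epsilon> + c)"
  shows "positive_elem c"
proof -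
  define T where "T = norm c + 1"
  have "norm (of_real T - c) \<le> T + e" if "0 < e" for e
  proof -
    define d where "d = min e 1"
    have d: "0 < d" "d \<le> e" "d \<le> 1" using that by (auto simp: d_def)
    have "norm (of_real d + c) \<le> T"
      using norm_triangle_ineq[of "of_real d" c] d by (simp add: T_def)
    from positive_elem_norm_bound[OF assms(2)[OF d(1)] this]
    have "norm (of_real T - (of_real d + c)) \<le> T" .
    moreover have "of_real T - c = (of_real T - (of_real d + c)) + of_real d" by simp
    then have "norm (of_real T - c) \<le> norm (of_real T - (of_real d + c)) + norm (of_real d :: 'a)"
      by (metis norm_triangle_ineq)
    ultimately show ?thesis using d by simp
  qed
  then have "norm (of_real T - c) \<le> T" by (rule field_le_epsilon)
  moreover have "0 \<le> T" by (simp add: T_def)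
  ultimately show ?thesis using assms(1) unfolding positive_elem_def by blast
qed

text \<open>If \<open>M\<close> exceeds the norm of the inverse \<open>y\<close>, then
  \<open>M - y\<close> has a root \<open>z\<close> that commutes with the root \<open>w\<close> of
  \<open>k\<close>. The square of \<open>w z\<close> is \<open>M k - 1\<close>, so
  \<open>k - 1/M\<close> is positive.\<close>

lemma invertible_positive_elem_lower_bound:
  fixes k :: "'a::unital_cstar_algebra"
  assumes "positive_elem k" "k * y = 1" "y * k = 1"
  obtains \<delta> where "\<delta> > 0" "positive_elem (k - of_real \<delta>)"
proof -
  obtain w where w: "self_adjoint w" "w * w = k"
    using positive_elem_sqrt[OF assms(1)] by metis
  have sy: "self_adjoint y" using assms self_adjoint_inverse positive_elem_self_adjoint by blast
  define M where "M = norm y + 1"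
  have M: "M > 0" by (simp add: M_def add_nonneg_pos)
  have "positive_elem (of_real M - y)" by (rule positive_elem_norm_minus[OF sy]) (simp add: M_def)
  then obtain z where z: "self_adjoint z" "z * z = of_real M - y"
    "\<And>d. d * (of_real M - y) = (of_real M - y) * d \<Longrightarrow> d * z = z * d"
    using positive_elem_sqrt by metis
  have wk: "w * k = k * w" using w(2) by (metis mult.assoc)
  have "w * y = y * w" using inverse_commute[OF assms(2,3) wk] .
  then have wz: "w * z = z * w" by (intro z(3)) (simp add: algebra_simps of_real_def)
  have "(w * z) * (w * z) = (w * w) * (z * z)" by (metis mult.assoc wz)
  also have "\<dots> = M *\<^sub>R k - 1"
    by (simp add: w(2) z(2) algebra_simps assms of_real_def)
  finally have "positive_elem (M *\<^sub>R k - 1)"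
    using positive_elem_square[OF self_adjoint_mult_commute[OF w(1) z(1) wz]] by simp
  from positive_elem_scaleR[OF this, of "1 / M"] M
  have "positive_elem (k - of_real (1 / M))"
    by (simp add: scaleR_right_diff_distrib of_real_def)
  with M show thesis by (intro that[of "1 / M"]) auto
qed

text \<open>The shifts that are positive form an interval that is closed and, by invertibility, open.\<close>

lemma positive_elem_if_shifts_invertible:
  fixes c :: "'a::unital_cstar_algebra"
  assumes sa: "self_adjoint c"
    and inv: "\<And>t. 0 < t \<Longrightarrow> \<exists>y. (of_real t + c) * y = 1 \<and> y * (of_real t + c) = 1"
  shows "positive_elem c"
proof -
  define S where "S = {t. 0 < t \<and> positive_elem (of_real t + c)}"
  have up: "s \<in> S" if "t \<in> S" "t \<le> s" for s t
  proof -
    have "positive_elem (of_real (s - t) + (of_real t + c))"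
      using that by (intro positive_elem_add[OF positive_elem_of_real, of _ "of_real t + c"]) (auto simp: S_def)
    then show ?thesis using that by (auto simp: S_def)
  qed
  have "positive_elem (of_real (norm c + 1) - (- c))"
    using sa by (intro positive_elem_norm_minus) (auto simp: self_adjoint_def)
  then have ne: "norm c + 1 \<in> S" by (simp add: S_def add_nonneg_pos)
  have bb: "bdd_below S" by (auto simp: S_def intro!: bdd_belowI[of _ 0])
  define m where "m = Inf S"
  have m0: "0 \<le> m" unfolding m_def using ne by (intro cInf_greatest) (auto simp: S_def)
  have above: "t \<in> S" if mt: "m < t" for t
  proof -
    obtain s where "s \<in> S" "s < t"
      using mt ne unfolding m_def by (metis cInf_lessD empty_iff)
    then show ?thesis using up by auto
  qed
  have pm: "positive_elem (of_real m + c)"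
  proof (rule positive_elem_limit)
    show "self_adjoint (of_real m + c)" using sa by (simp add: self_adjoint_def cstar_add)
    show "positive_elem (of_real e + (of_real m + c))" if "0 < e" for e
      using above[of "m + e"] that by (simp add: S_def algebra_simps)
  qed
  have "m = 0"
  proof (rule ccontr)
    assume "m \<noteq> 0"
    then have "0 < m" using m0 by simp
    then obtain y where "(of_real m + c) * y = 1" "y * (of_real m + c) = 1" using inv by blast
    then obtain d where d: "d > 0" "positive_elem (of_real m + c - of_real d)"
      using invertible_positive_elem_lower_bound[OF pm] by metis
    \<comment> \<open>The set \<open>S\<close> contains only positive shifts, so the step below
      \<open>m\<close> must be smaller than \<open>m\<close> itself.\<close>
    define d' where "d' = min d (m / 2)"
    have d': "0 < d'" "d' \<le> d" "d' < m" using d \<open>0 < m\<close> by (auto simp: d'_def)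
    have "positive_elem (of_real (d - d') + (of_real m + c - of_real d))"
      using d d' by (intro positive_elem_add positive_elem_of_real) auto
    then have "m - d' \<in> S" using d' by (simp add: S_def algebra_simps)
    then have "m \<le> m - d'" unfolding m_def using bb by (intro cInf_lower) auto
    with d' show False by simp
  qed
  with pm show ?thesis by simp
qed

text \<open>With \<open>b = x + i y\<close> one has \<open>b* b + b b* = 2 (x x + y y)\<close>, so
  \<open>b b*\<close> is positive if \<open>- b* b\<close> is. Nonzero spectra of
  \<open>b* b\<close> and \<open>b b*\<close> agree, here in the form that an inverse of
  \<open>t + b b*\<close> yields one of \<open>t + b* b\<close>. Hence \<open>b* b\<close> is
  positive too, and antisymmetry makes it 0.\<close>

lemma cstar_mult_neg_eq_0:
  fixes b :: "'a::unital_cstar_algebra"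
  assumes neg: "positive_elem (- (cstar b * b))" shows "b = 0"
proof -
  define c where "c = cstar b * b"
  define d where "d = b * cstar b"
  define x where "x = (1/2) *\<^sub>R (b + cstar b)"
  define y where "y = (1/2) *\<^sub>R scaleC \<i> (cstar b - b)"
  have sx: "self_adjoint x" by (simp add: x_def self_adjoint_def cstar_simps add.commute)
  have sy: "self_adjoint y"
    by (simp add: y_def self_adjoint_def cstar_simps scaleC_minus_left flip: scaleC_minus_right)
  have x2: "x * x = (1/4) *\<^sub>R (b * b + cstar b * cstar b + (c + d))"
    by (simp add: x_def c_def d_def algebra_simps)
  have y2: "y * y = (1/4) *\<^sub>R ((c + d) - (b * b + cstar b * cstar b))"
    by (simp add: y_def c_def d_def mult_scaleC_left mult_scaleC_right scaleC_diff_right scaleC_scaleR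
        algebra_simps)
  have "2 *\<^sub>R (x * x + y * y) = c + d"
  proof -
    have "x * x + y * y = (1/4) *\<^sub>R ((c + d) + (c + d))"
      unfolding x2 y2 scaleR_add_right[symmetric] by (rule arg_cong[where f = "scaleR (1/4)"]) simp
    also have "\<dots> = (1/2) *\<^sub>R (c + d)"
      unfolding scaleR_2[symmetric] by simp
    finally show ?thesis by simp
  qed
  moreover have "positive_elem (2 *\<^sub>R (x * x + y * y))"
    using sx sy by (intro positive_elem_scaleR positive_elem_add positive_elem_square) auto
  ultimately have "positive_elem (c + d)" by simp
  from positive_elem_add[OF this] neg have pd: "positive_elem d" by (fastforce simp: c_def)
  have "positive_elem c"
  proof (rule positive_elem_if_shifts_invertible)
    show "self_adjoint c" by (simp add: c_def self_adjoint_def cstar_simps)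
    fix t :: real assume t: "0 < t"
    obtain r where r: "(of_real t + d) * r = 1" "r * (of_real t + d) = 1"
      using shifted_positive_elem_inverse[OF pd t] .
    \<comment> \<open>The usual formula that turns the inverse \<open>r\<close> of
      \<open>t + b b*\<close> into the inverse of \<open>t + b* b\<close>.\<close>
    define z where "z = (1/t) *\<^sub>R (1 - cstar b * r * b)"
    have 1: "(of_real t + c) * cstar b = cstar b * (of_real t + d)"
      and 2: "b * (of_real t + c) = (of_real t + d) * b"
      by (simp_all add: c_def d_def algebra_simps of_real_def)
    have "(of_real t + c) * (cstar b * r * b) = ((of_real t + c) * cstar b) * r * b"
      by (simp add: mult.assoc)
    also have "\<dots> = cstar b * ((of_real t + d) * r) * b" unfolding 1 by (simp add: mult.assoc)
    finally have 3: "(of_real t + c) * (cstar b * r * b) = c" using r by (simp add: c_def)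
    have "(cstar b * r * b) * (of_real t + c) = cstar b * r * (b * (of_real t + c))"
      by (simp add: mult.assoc)
    also have "\<dots> = cstar b * (r * (of_real t + d)) * b" unfolding 2 by (simp add: mult.assoc)
    finally have 4: "(cstar b * r * b) * (of_real t + c) = c" using r by (simp add: c_def)
    have "(of_real t + c) * z = 1" "z * (of_real t + c) = 1"
      using t 3 4 by (simp_all add: z_def left_diff_distrib right_diff_distrib of_real_def)
    then show "\<exists>y. (of_real t + c) * y = 1 \<and> y * (of_real t + c) = 1" by blast
  qed
  with neg have "c = 0" using positive_elem_antisym by (simp add: c_def)
  then show ?thesis using cstar_mult_eq_0 by (simp add: c_def)
qed

text \<open>Here \<open>w\<close> stands for the absolute value of \<open>h\<close>. The product of
  \<open>t + w - h\<close> and \<open>t + w + h\<close> is \<open>t t + 2 t w\<close>, which is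
  invertible; since the factors commute, each of them is invertible, and the criterion by shifts
  applies.\<close>

lemma abs_minus_self_positive:
  fixes h :: "'a::unital_cstar_algebra"
  assumes sh: "self_adjoint h" and pw: "positive_elem w" and w2: "w * w = h * h" and comm: "h * w = w * h"
  shows "positive_elem (w - h)"
proof (rule positive_elem_if_shifts_invertible)
  show "self_adjoint (w - h)"
    using sh pw by (simp add: positive_elem_def self_adjoint_def cstar_diff)
  fix t :: real assume t: "0 < t"
  define A where "A = of_real t + (w - h)"
  define B where "B = of_real t + (w + h)"
  have AB: "A * B = B * A" by (simp add: A_def B_def algebra_simps comm w2 of_real_def)
  have "A * B = of_real (t * t) + (t *\<^sub>R w + t *\<^sub>R w)"
    by (simp add: A_def B_def algebra_simps comm w2 of_real_def)
  then have AB': "A * B = of_real (t * t) + (2 * t) *\<^sub>R w" by (simp flip: scaleR_add_left)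
  have "positive_elem ((2 * t) *\<^sub>R w)" using pw t by (intro positive_elem_scaleR) auto
  then obtain z where z: "A * B * z = 1" "z * (A * B) = 1"
    using shifted_positive_elem_inverse[of "(2 * t) *\<^sub>R w" "t * t"] t AB' by auto
  have 1: "A * (B * z) = 1" using z by (simp add: mult.assoc)
  have 2: "(z * B) * A = 1" using z AB by (simp add: mult.assoc)
  have "z * B = B * z" by (metis 1 2 mult.assoc mult.left_neutral mult.right_neutral)
  then show "\<exists>y. (of_real t + (w - h)) * y = 1 \<and> y * (of_real t + (w - h)) = 1"
    using 1 2 by (auto simp flip: A_def)
qed

text \<open>With \<open>v\<close> the negative part of \<open>a* a\<close>, the element \<open>b = a v\<close> satisfies \<open>b* b = - v\<^sup>3 \<le> 0\<close>.\<close>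

theorem positive_elem_cstar_mult: "positive_elem (cstar a * (a::'a::unital_cstar_algebra))"
proof -
  define h where "h = cstar a * a"
  have sh: "self_adjoint h" by (simp add: h_def self_adjoint_def cstar_simps)
  obtain w where w: "self_adjoint w" "w * w = h * h"
    "\<And>c. c * (h * h) = (h * h) * c \<Longrightarrow> c * w = w * c" "positive_elem w"
    using positive_elem_sqrt[OF positive_elem_square[OF sh]] by metis
  have hw: "h * w = w * h" using w(3)[of h] by (simp add: mult.assoc)
  \<comment> \<open>This is \<open>|h| - h\<close>, twice the negative part of \<open>h\<close>;
    with this normalisation \<open>(a v)* (a v)\<close> equals \<open>- v v v / 2\<close>.\<close>
  define v where "v = w - h"
  have pv: "positive_elem v" unfolding v_def
    by (rule abs_minus_self_positive[OF sh w(4,2) hw])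
  have vh: "h * v = v * h" by (simp add: v_def algebra_simps hw)
  have "v * v = w * w - w * h - h * w + h * h" by (simp add: v_def algebra_simps)
  also have "\<dots> = - 2 *\<^sub>R (h * v)" by (simp add: v_def w(2) algebra_simps hw scaleR_2)
  finally have vv: "v * v = - 2 *\<^sub>R (h * v)" .
  have sv: "cstar v = v" using pv by (simp add: positive_elem_def self_adjoint_def)
  obtain r where r: "self_adjoint r" "r * r = v" using positive_elem_sqrt[OF pv] by metis
  have v3: "v * v * v = (r * v) * (r * v)"
    using r(2) by (metis mult.assoc)
  have srv: "self_adjoint (r * v)"
    using r by (metis mult.assoc self_adjoint_mult_commute pv positive_elem_self_adjoint)
  have pv3: "positive_elem (v * v * v)" unfolding v3 by (rule positive_elem_square[OF srv])
  have "v * v * v = - 2 *\<^sub>R (v * h * v)" by (simp add: vv vh mult.assoc)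
  then have "- (cstar (a * v) * (a * v)) = (1/2) *\<^sub>R (v * v * v)"
    by (simp add: cstar_mult sv h_def mult.assoc)
  then have "positive_elem (- (cstar (a * v) * (a * v)))"
    using positive_elem_scaleR[OF pv3, of "1/2"] by simp
  then have "a * v = 0" by (rule cstar_mult_neg_eq_0)
  then have "h * v = 0" by (simp add: h_def mult.assoc)
  with vv have "v * v = 0" by simp
  then have "v = 0" using cstar_mult_eq_0[of v] sv by simp
  then have "h = w" by (simp add: v_def)
  with w(4) show ?thesis by (simp add: h_def)
qed

lemma positive_elem_conjugate:
  assumes "positive_elem h" shows "positive_elem (cstar y * h * y)"
proof -
  obtain w where w: "self_adjoint w" "w * w = h" using positive_elem_sqrt[OF assms] by metis
  have "cstar y * h * y = cstar (w * y) * (w * y)"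
    using w by (simp add: cstar_mult self_adjoint_def mult.assoc flip: w(2))
  then show ?thesis by (simp add: positive_elem_cstar_mult)
qed

lemma cstar_mult_le_norm: "positive_elem (of_real ((norm a)\<^sup>2) - cstar a * a)"
  by (rule positive_elem_norm_minus)
    (simp_all add: self_adjoint_def cstar_simps cstar_identity)

text \<open>The element is \<open>e = (1 + h)^-1\<close>, and \<open>1 - e = h e\<close> is a
  cut-off that nearly equals 1 where \<open>h\<close> is large. With the root \<open>w\<close> of
  \<open>h\<close>, every inequality is an identity exhibiting squares:
  \<open>e = e e + (w e)(w e)\<close>, \<open>1 - e = (w e)(w e) + (h e)(h e)\<close>,
  \<open>h - (1 - e) = h e h\<close>, \<open>(1 - e) - (1 - e)(1 - e) = (w e)(w e)\<close> and
  \<open>1 - e h e = (1 - e) + e e\<close>. It serves both the approximate units of left kernels and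
  the cut-off for pure states.\<close>

lemma resolvent_exists:
  fixes h :: "'a::unital_cstar_algebra"
  assumes "positive_elem h"
  obtains e where "self_adjoint e" "e * h = 1 - e" "norm e \<le> 1" "norm (1 - e) \<le> 1"
    "positive_elem (h - (1 - e))" "positive_elem ((1 - e) - (1 - e) * (1 - e))" "positive_elem (1 - e * h * e)"
proof -
  obtain w where w: "self_adjoint w" "w * w = h" using positive_elem_sqrt[OF assms] by metis
  obtain e where e: "(1 + h) * e = 1" "e * (1 + h) = 1"
    using shifted_positive_elem_inverse[OF assms, of 1] by auto
  have sh: "self_adjoint h" using assms by (rule positive_elem_self_adjoint)
  have se: "self_adjoint e"
    by (rule self_adjoint_inverse[OF _ e]) (use sh in \<open>simp add: self_adjoint_def cstar_add\<close>)
  have "w * h = h * w" using w(2) by (metis mult.assoc)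
  then have we: "w * e = e * w"
    by (intro inverse_commute[OF e]) (simp add: algebra_simps)
  have he: "h * e = 1 - e" and eh: "e * h = 1 - e" using e by (simp_all add: algebra_simps)
  have swe: "self_adjoint (w * e)" by (rule self_adjoint_mult_commute[OF w(1) se we])
  have she: "self_adjoint (h * e)" using se he by (simp add: self_adjoint_def cstar_diff)
  have whe: "(w * e) * (w * e) = h * e * e" using we w(2) by (metis mult.assoc)
  have pe: "positive_elem e"
  proof -
    have "e = e * e + (w * e) * (w * e)" unfolding whe by (simp add: he left_diff_distrib)
    then show ?thesis using positive_elem_add positive_elem_square se swe by metis
  qed
  have p1e: "positive_elem (1 - e)"
  proof -
    have "1 - e = (w * e) * (w * e) + (h * e) * (h * e)" unfolding whe by (simp add: he algebra_simps)
    then show ?thesis using positive_elem_add positive_elem_square she swe by metis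
  qed
  have 1: "positive_elem (h - (1 - e))"
  proof -
    have "h - (1 - e) = h - h * e" by (simp add: he)
    also have "\<dots> = h * (1 - e)" by (simp add: algebra_simps)
    also have "\<dots> = w * w * (e * w * w)" using eh w(2) by (simp add: mult.assoc)
    also have "\<dots> = cstar h * e * h" using sh w(2) we by (metis self_adjoint_def mult.assoc)
    finally show ?thesis using positive_elem_conjugate[OF pe, of h] by simp
  qed
  have 2: "positive_elem ((1 - e) - (1 - e) * (1 - e))"
  proof -
    have "(1 - e) - (1 - e) * (1 - e) = h * e * e" by (simp add: he algebra_simps)
    then show ?thesis using positive_elem_square[OF swe] whe by simp
  qed
  have 3: "positive_elem (1 - e * h * e)"
  proof -
    have "1 - e * h * e = (1 - e) + e * e" by (simp add: eh algebra_simps)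
    with positive_elem_add[OF p1e positive_elem_square[OF se]] show ?thesis by metis
  qed
  have 4: "norm e \<le> 1" "norm (1 - e) \<le> 1"
    using norm_le_of_positive_elem[of e 1] norm_le_of_positive_elem[of "1 - e" 1] pe p1e by simp_all
  show thesis by (rule that[OF se eh 4 1 2 3])
qed

subsection \<open>The Hahn--Banach theorem for sublinear functionals\<close>

definition sublinear :: "('v::real_vector \<Rightarrow> real) \<Rightarrow> bool" where
  "sublinear q \<longleftrightarrow> (\<forall>x y. q (x + y) \<le> q x + q y) \<and> (\<forall>r x. 0 < r \<longrightarrow> q (r *\<^sub>R x) = r * q x)"

lemma sublinearI:
  assumes "\<And>x y. q (x + y) \<le> q x + q y" "\<And>r x. 0 < r \<Longrightarrow> q (r *\<^sub>R x) \<le> r * q x"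
  shows "sublinear q"
proof -
  have "q (r *\<^sub>R x) = r * q x" if r: "0 < r" for r x
  proof (rule antisym)
    have "q ((1/r) *\<^sub>R (r *\<^sub>R x)) \<le> (1/r) * q (r *\<^sub>R x)" using r by (intro assms(2)) simp
    then show "r * q x \<le> q (r *\<^sub>R x)" using r by (simp add: field_simps)
  qed (rule assms(2)[OF r])
  with assms(1) show ?thesis by (simp add: sublinear_def)
qed

lemma sublinear_add: "sublinear q \<Longrightarrow> q (x + y) \<le> q x + q y"
  by (simp add: sublinear_def)

lemma sublinear_scaleR: "sublinear q \<Longrightarrow> 0 < r \<Longrightarrow> q (r *\<^sub>R x) = r * q x"
  by (simp add: sublinear_def)

lemma sublinear_zero: "sublinear q \<Longrightarrow> q 0 = 0"
  using sublinear_scaleR[of q 2 0] by simp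

lemma sublinear_minus: "sublinear q \<Longrightarrow> - q (- x) \<le> q x"
  using sublinear_add[of q x "- x"] sublinear_zero[of q] by simp

text \<open>Tilting \<open>q\<close> in direction \<open>z\<close> makes it additive along \<open>z\<close>; a functional that no tilt
  decreases is therefore linear.\<close>

definition sublinear_tilt :: "('v::real_vector \<Rightarrow> real) \<Rightarrow> 'v \<Rightarrow> 'v \<Rightarrow> real" where
  "sublinear_tilt q z x = (INF t\<in>{0..}. q (x + t *\<^sub>R z) - t * q z)"

lemma sublinear_tilt_bdd:
  assumes q: "sublinear q" shows "bdd_below ((\<lambda>t. q (x + t *\<^sub>R z) - t * q z) ` {0..})"
proof (rule bdd_belowI2)
  fix t :: real assume "t \<in> {0..}"
  then have t: "0 \<le> t" by simp
  have "t * q z = q (t *\<^sub>R z)"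
    using t sublinear_scaleR[OF q, of t z] sublinear_zero[OF q] by (cases "t = 0") auto
  also have "\<dots> \<le> q (x + t *\<^sub>R z) + q (- x)"
    using sublinear_add[OF q, of "x + t *\<^sub>R z" "- x"] by simp
  finally show "- q (- x) \<le> q (x + t *\<^sub>R z) - t * q z" by simp
qed

lemma sublinear_tilt_le:
  assumes "sublinear q" "0 \<le> t" shows "sublinear_tilt q z x \<le> q (x + t *\<^sub>R z) - t * q z"
  unfolding sublinear_tilt_def
  using sublinear_tilt_bdd[OF assms(1)] assms(2) by (intro cINF_lower) auto

lemma le_sublinear_tilt:
  assumes "\<And>t. 0 \<le> t \<Longrightarrow> c \<le> q (x + t *\<^sub>R z) - t * q z" shows "c \<le> sublinear_tilt q z x"
  unfolding sublinear_tilt_def using assms by (intro cINF_greatest) auto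

lemma sublinear_tilt: assumes q: "sublinear q" shows "sublinear (sublinear_tilt q z)"
proof (rule sublinearI)
  fix x y
  have "sublinear_tilt q z (x + y) - (q (x + s *\<^sub>R z) - s * q z) \<le> q (y + t *\<^sub>R z) - t * q z"
    if "0 \<le> s" "0 \<le> t" for s t
  proof -
    have "sublinear_tilt q z (x + y) \<le> q ((x + y) + (s + t) *\<^sub>R z) - (s + t) * q z"
      using that by (intro sublinear_tilt_le[OF q]) auto
    also have "q ((x + y) + (s + t) *\<^sub>R z) \<le> q (x + s *\<^sub>R z) + q (y + t *\<^sub>R z)"
      using sublinear_add[OF q, of "x + s *\<^sub>R z" "y + t *\<^sub>R z"] by (simp add: algebra_simps)
    finally show ?thesis by (simp add: algebra_simps)
  qed
  then have "sublinear_tilt q z (x + y) - (q (x + s *\<^sub>R z) - s * q z) \<le> sublinear_tilt q z y"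
    if "0 \<le> s" for s using that by (intro le_sublinear_tilt) auto
  then have "sublinear_tilt q z (x + y) - sublinear_tilt q z y \<le> sublinear_tilt q z x"
    by (intro le_sublinear_tilt) (simp add: algebra_simps)
  then show "sublinear_tilt q z (x + y) \<le> sublinear_tilt q z x + sublinear_tilt q z y" by simp
next
  fix r :: real and x assume r: "0 < r"
  have "(1/r) * sublinear_tilt q z (r *\<^sub>R x) \<le> sublinear_tilt q z x"
  proof (rule le_sublinear_tilt)
    fix t :: real assume t: "0 \<le> t"
    have "sublinear_tilt q z (r *\<^sub>R x) \<le> q (r *\<^sub>R x + (r * t) *\<^sub>R z) - (r * t) * q z"
      using r t by (intro sublinear_tilt_le[OF q]) auto
    also have "q (r *\<^sub>R x + (r * t) *\<^sub>R z) = r * q (x + t *\<^sub>R z)"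
      using sublinear_scaleR[OF q r, of "x + t *\<^sub>R z"] by (simp add: scaleR_add_right)
    finally show "(1/r) * sublinear_tilt q z (r *\<^sub>R x) \<le> q (x + t *\<^sub>R z) - t * q z"
      using r by (simp add: field_simps)
  qed
  then show "sublinear_tilt q z (r *\<^sub>R x) \<le> r * sublinear_tilt q z x"
    using r by (simp add: field_simps)
qed

text \<open>Zorn's lemma with pointwise infima as bounds of chains. The value
  \<open>- q (- x)\<close> keeps the infimum finite, and subadditivity survives because two members
  of a chain can be replaced by the smaller one.\<close>

lemma sublinear_minimal_exists:
  assumes q: "sublinear (q :: 'v::real_vector \<Rightarrow> real)"
  obtains p where "sublinear p" "p \<le> q" "\<And>p'. sublinear p' \<Longrightarrow> p' \<le> p \<Longrightarrow> p' = p"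
proof -
  define A where "A = {p. sublinear p \<and> p \<le> q}"
  \<comment> \<open>The order is reversed, so that a maximal element of \<open>r\<close> is a
    minimal functional.\<close>
  define r where "r = {(a, b). a \<in> A \<and> b \<in> A \<and> b \<le> a}"
  have Fr: "Field r = A" by (auto simp: r_def Field_def)
  have po: "Partial_order r"
    unfolding partial_order_on_def preorder_on_def Fr
    by (auto simp: r_def refl_on_def trans_def antisym_def)
  have ub: "\<exists>u\<in>Field r. \<forall>a\<in>C. (a, u) \<in> r" if C: "C \<in> Chains r" for C
  proof (cases "C = {}")
    case True then show ?thesis using q by (auto simp: Fr A_def)
  next
    case False
    have CA: "c \<in> A" if "c \<in> C" for c using C that by (force simp: Chains_def r_def)
    have lin: "c \<le> d \<or> d \<le> c" if "c \<in> C" "d \<in> C" for c d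
      using C that by (auto simp: Chains_def r_def)
    define u where "u x = (INF c\<in>C. c x)" for x
    have bd: "bdd_below ((\<lambda>c. c x) ` C)" for x
    proof (rule bdd_belowI2)
      fix c assume "c \<in> C"
      then have "sublinear c" "c (- x) \<le> q (- x)" using CA by (auto simp: A_def le_fun_def)
      then show "- q (- x) \<le> c x" using sublinear_minus[of c x] by linarith
    qed
    have ul: "u x \<le> c x" if "c \<in> C" for c x unfolding u_def using bd that by (rule cINF_lower)
    have lu: "k \<le> u x" if "\<And>c. c \<in> C \<Longrightarrow> k \<le> c x" for k x
      unfolding u_def using False that by (rule cINF_greatest)
    have "sublinear u"
    proof (rule sublinearI)
      fix x y
      have "u (x + y) - c x \<le> d y" if cd: "c \<in> C" "d \<in> C" for c d
      proof -
        obtain e where e: "e \<in> C" "e \<le> c" "e \<le> d" using lin[OF cd] cd by auto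
        have "u (x + y) \<le> e (x + y)" using ul e by blast
        also have "\<dots> \<le> e x + e y" using CA[OF e(1)] by (simp add: A_def sublinear_add)
        also have "\<dots> \<le> c x + d y" using e by (simp add: le_fun_def add_mono)
        finally show ?thesis by simp
      qed
      then have "u (x + y) - c x \<le> u y" if "c \<in> C" for c using that lu by blast
      then have "u (x + y) - u y \<le> u x" by (intro lu) (simp add: algebra_simps)
      then show "u (x + y) \<le> u x + u y" by simp
    next
      fix k :: real and x assume k: "0 < k"
      have "(1/k) * u (k *\<^sub>R x) \<le> u x"
      proof (rule lu)
        fix c assume c: "c \<in> C"
        have "u (k *\<^sub>R x) \<le> c (k *\<^sub>R x)" using ul c .
        also have "\<dots> = k * c x" using CA[OF c] k by (simp add: A_def sublinear_scaleR)
        finally show "(1/k) * u (k *\<^sub>R x) \<le> c x" using k by (simp add: field_simps)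
      qed
      then show "u (k *\<^sub>R x) \<le> k * u x" using k by (simp add: field_simps)
    qed
    moreover have "u \<le> c" if "c \<in> C" for c using ul that by (simp add: le_fun_def)
    moreover obtain c where "c \<in> C" using False by blast
    ultimately have "u \<in> A" using CA by (auto simp: A_def intro: order_trans)
    with \<open>\<And>c. c \<in> C \<Longrightarrow> u \<le> c\<close> show ?thesis
      unfolding Fr using CA by (intro bexI[of _ u]) (auto simp: r_def)
  qed
  from Zorns_po_lemma[OF po] ub obtain m where "m \<in> Field r" "\<forall>a\<in>Field r. (m, a) \<in> r \<longrightarrow> a = m" by blast
  then have m: "m \<in> A" "\<And>a. a \<in> A \<Longrightarrow> a \<le> m \<Longrightarrow> a = m" unfolding Fr by (auto simp: r_def)
  show thesis
  proof (rule that[of m])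
    fix p' assume "sublinear p'" "p' \<le> m"
    then show "p' = m" using m by (intro m(2)) (auto simp: A_def intro: order_trans)
  qed (use m in \<open>auto simp: A_def\<close>)
qed

text \<open>The minimal functional is sought below the tilt of \<open>q\<close> along
  \<open>x0\<close> instead of below \<open>q\<close>. Already the tilt is at most
  \<open>- q x0\<close> at \<open>- x0\<close>, which forces equality at \<open>x0\<close> without
  extending anything from a subspace.\<close>

theorem hahn_banach_sublinear:
  fixes q :: "'v::real_vector \<Rightarrow> real"
  assumes q: "sublinear q"
  obtains g where "linear g" "\<And>x. g x \<le> q x" "g x0 = q x0"
proof -
  obtain p where p: "sublinear p" "p \<le> sublinear_tilt q x0"
    and min: "\<And>p'. sublinear p' \<Longrightarrow> p' \<le> p \<Longrightarrow> p' = p"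
    using sublinear_minimal_exists[OF sublinear_tilt[OF q]] by metis
  have pq: "p x \<le> q (x + t *\<^sub>R x0) - t * q x0" if "0 \<le> t" for x t
    using p(2) sublinear_tilt_le[OF q that] by (auto simp: le_fun_def intro: order_trans)
  have eq: "sublinear_tilt p z = p" for z
  proof (rule min[OF sublinear_tilt[OF p(1)]])
    show "sublinear_tilt p z \<le> p"
      using sublinear_tilt_le[OF p(1), of 0 z] by (simp add: le_fun_def)
  qed
  have add: "p (x + z) = p x + p z" for x z
    using sublinear_tilt_le[OF p(1), of 1 z x] sublinear_add[OF p(1), of x z] by (simp add: eq)
  have neg: "p (- x) = - p x" for x
    using add[of x "- x"] sublinear_zero[OF p(1)] by simp
  have "linear p"
  proof (rule linearI)
    fix r :: real and x
    show "p (r *\<^sub>R x) = r *\<^sub>R p x"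
    proof (cases r "0::real" rule: linorder_cases)
      case less
      then have "p ((- r) *\<^sub>R x) = (- r) * p x" by (intro sublinear_scaleR[OF p(1)]) simp
      then show ?thesis using neg[of "r *\<^sub>R x"] by simp
    qed (simp_all add: sublinear_scaleR[OF p(1)] sublinear_zero[OF p(1)])
  qed (rule add)
  moreover have "p x \<le> q x" for x using pq[of 0 x] by simp
  moreover have "p x0 = q x0"
    using pq[of 1 "- x0"] sublinear_zero[OF q] neg[of x0] pq[of 0 x0] by simp
  ultimately show thesis by (rule that)
qed

subsection \<open>Bounded and positive functionals\<close>

lemma clf_add: "clinear_functional f \<Longrightarrow> f (x + y) = f x + f y"
  and clf_scaleC: "clinear_functional f \<Longrightarrow> f (scaleC c x) = c * f x"
  by (auto simp: clinear_functional_def)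

lemma clf_scaleR: "clinear_functional f \<Longrightarrow> f (r *\<^sub>R x) = of_real r * f x"
  by (metis clf_scaleC scaleC_of_real)

lemma clf_zero: "clinear_functional f \<Longrightarrow> f 0 = 0"
  using clf_scaleR[of f 0 0] by simp

lemma clf_minus: "clinear_functional f \<Longrightarrow> f (- x) = - f x"
  using clf_scaleR[of f "-1" x] by simp

lemma clf_diff: "clinear_functional f \<Longrightarrow> f (x - y) = f x - f y"
  using clf_add[of f x "- y"] by (simp add: clf_minus)

lemmas clf_simps = clf_add clf_scaleC clf_scaleR clf_zero clf_minus clf_diff

lemma clf_mult_left: "clinear_functional f \<Longrightarrow> clinear_functional (\<lambda>b. f (a * b))"
  by (simp add: clinear_functional_def distrib_left mult_scaleC_right)

lemma clf_mult_right: "clinear_functional f \<Longrightarrow> clinear_functional (\<lambda>b. f (b * a))"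
  by (simp add: clinear_functional_def distrib_right mult_scaleC_left)

lemma clf_lincomb:
  assumes "clinear_functional f" "clinear_functional g"
  shows "clinear_functional (\<lambda>a. c * f a + d * g a)"
  using assms by (simp add: clinear_functional_def algebra_simps)

lemma dual_spaceD: "f \<in> dual_space \<Longrightarrow> clinear_functional f"
  by (simp add: dual_space_def)

lemma dual_spaceI: "clinear_functional f \<Longrightarrow> (\<And>x. cmod (f x) \<le> K * norm x) \<Longrightarrow> f \<in> dual_space"
  by (auto simp: dual_space_def)

lemma dual_norm_bound:
  fixes x :: "'a::unital_cstar_algebra"
  assumes "f \<in> dual_space" shows "cmod (f x) \<le> dual_norm f * norm x"
proof -
  obtain K where K: "\<And>x. cmod (f x) \<le> K * norm x" using assms by (auto simp: dual_space_def)
  have f: "clinear_functional f" using assms by (rule dual_spaceD)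
  have bdd: "bdd_above ((\<lambda>x. cmod (f x)) ` {x. norm x \<le> 1})"
  proof (rule bdd_aboveI2)
    fix x :: 'a assume "x \<in> {x. norm x \<le> 1}"
    then have "\<bar>K\<bar> * norm x \<le> \<bar>K\<bar> * 1" by (intro mult_left_mono) auto
    then show "cmod (f x) \<le> \<bar>K\<bar>"
      using K[of x] abs_ge_self[of "K * norm x"] by (simp add: abs_mult)
  qed
  show ?thesis
  proof (cases "x = 0")
    case False
    have "cmod (f ((1 / norm x) *\<^sub>R x)) \<le> dual_norm f"
      unfolding dual_norm_def using False by (intro cSUP_upper[OF _ bdd]) simp
    then show ?thesis using False by (simp add: clf_scaleR[OF f] norm_mult norm_divide field_simps)
  qed (simp add: clf_zero[OF f])
qed

lemma dual_norm_le:
  fixes f :: "'a::unital_cstar_algebra \<Rightarrow> complex"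
  assumes "\<And>x. cmod (f x) \<le> K * norm x" shows "dual_norm f \<le> K"
proof -
  have "0 \<le> K" using order_trans[OF norm_ge_zero assms[of 1]] by simp
  then have "cmod (f x) \<le> K" if "norm x \<le> 1" for x
    using assms[of x] mult_left_mono[OF that, of K] by simp
  then show ?thesis unfolding dual_norm_def by (intro cSUP_least) (auto intro: exI[of _ 0])
qed

lemma dual_norm_nonneg: "f \<in> dual_space \<Longrightarrow> 0 \<le> dual_norm f"
  using order_trans[OF norm_ge_zero dual_norm_bound[of f 1]] by simp

lemma dual_space_lincomb:
  assumes "f \<in> dual_space" "g \<in> dual_space"
  shows "(\<lambda>a. c * f a + d * g a) \<in> dual_space"
    and "dual_norm (\<lambda>a. c * f a + d * g a) \<le> cmod c * dual_norm f + cmod d * dual_norm g"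
proof -
  have *: "cmod (c * f a + d * g a) \<le> (cmod c * dual_norm f + cmod d * dual_norm g) * norm a" for a
  proof -
    have "cmod (c * f a + d * g a) \<le> cmod c * cmod (f a) + cmod d * cmod (g a)"
      using norm_triangle_ineq[of "c * f a" "d * g a"] by (simp add: norm_mult)
    also have "\<dots> \<le> cmod c * (dual_norm f * norm a) + cmod d * (dual_norm g * norm a)"
      using assms by (intro add_mono mult_left_mono dual_norm_bound) auto
    finally show ?thesis by (simp add: algebra_simps)
  qed
  show "(\<lambda>a. c * f a + d * g a) \<in> dual_space"
    using * assms by (intro dual_spaceI[OF clf_lincomb]) (auto intro: dual_spaceD)
  show "dual_norm (\<lambda>a. c * f a + d * g a) \<le> cmod c * dual_norm f + cmod d * dual_norm g"
    by (rule dual_norm_le[OF *])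
qed

lemma dual_space_add: "f \<in> dual_space \<Longrightarrow> g \<in> dual_space \<Longrightarrow> (\<lambda>a. f a + g a) \<in> dual_space"
  using dual_space_lincomb(1)[of f g 1 1] by simp

lemma dual_space_scale: "f \<in> dual_space \<Longrightarrow> (\<lambda>a. c * f a) \<in> dual_space"
  using dual_space_lincomb(1)[of f f c 0] by simp

lemma dual_space_diff: "f \<in> dual_space \<Longrightarrow> g \<in> dual_space \<Longrightarrow> (\<lambda>a. f a - g a) \<in> dual_space"
  using dual_space_lincomb(1)[of f g 1 "-1"] by simp

section \<open>Positive functionals and their GNS seminorms\<close>

definition positive_functional :: "('a::unital_cstar_algebra \<Rightarrow> complex) \<Rightarrow> bool" where
  "positive_functional f \<longleftrightarrow> clinear_functional f \<and>
     (\<forall>a. f (cstar a * a) \<in> \<real> \<and> 0 \<le> Re (f (cstar a * a)))"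

lemma state_iff: "state f \<longleftrightarrow> positive_functional f \<and> f 1 = 1"
  by (auto simp: state_def positive_functional_def)

text \<open>The length of the vector \<open>a \<xi>\<close> in the GNS space of \<open>g\<close>,
  where \<open>\<xi>\<close> is the cyclic vector. The space is neither divided by null vectors nor
  completed.\<close>

definition gns_norm :: "('a::unital_cstar_algebra \<Rightarrow> complex) \<Rightarrow> 'a \<Rightarrow> real" where
  "gns_norm g a = sqrt (Re (g (cstar a * a)))"

lemma pf_clf: "positive_functional g \<Longrightarrow> clinear_functional g"
  by (simp add: positive_functional_def)

lemma gns_norm_nonneg: "positive_functional g \<Longrightarrow> 0 \<le> gns_norm g a"
  by (simp add: gns_norm_def positive_functional_def)

lemma pf_square: "positive_functional g \<Longrightarrow> g (cstar a * a) = of_real ((gns_norm g a)\<^sup>2)"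
  by (simp add: gns_norm_def positive_functional_def of_real_Re)

lemma gns_norm_square: "positive_functional g \<Longrightarrow> (gns_norm g a)\<^sup>2 = Re (g (cstar a * a))"
  by (simp add: pf_square)

text \<open>Polarisation: the values of \<open>g\<close> at the squares of \<open>a + b\<close> and
  \<open>a + i b\<close> are real, and their imaginary parts give the two real equations.\<close>

lemma pf_cstar_swap:
  assumes "positive_functional g" shows "g (cstar a * b) = cnj (g (cstar b * a))"
proof -
  note lin = clf_simps[OF pf_clf[OF assms]]
  have real: "Im (g (cstar x * x)) = 0" for x
    using assms by (simp add: positive_functional_def complex_is_Real_iff)
  have "Im (g (cstar a * b) + g (cstar b * a)) = 0"
    using real[of "a + b"] real[of a] real[of b] by (simp add: cstar_simps algebra_simps lin)
  moreover have "Im (\<i> * g (cstar a * b) - \<i> * g (cstar b * a)) = 0"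
    using real[of "a + scaleC \<i> b"] real[of a] real[of b]
    by (simp add: cstar_simps algebra_simps mult_scaleC_left mult_scaleC_right lin scaleC_scaleC)
  ultimately show ?thesis by (simp add: complex_eq_iff)
qed

lemma pf_cstar: "positive_functional g \<Longrightarrow> g (cstar a) = cnj (g a)"
  using pf_cstar_swap[of g a 1] by simp

lemma pf_self_adjoint: "positive_functional g \<Longrightarrow> self_adjoint a \<Longrightarrow> g a = of_real (Re (g a))"
  using pf_cstar[of g a] by (simp add: self_adjoint_def complex_eq_iff)

lemma pf_positive_elem:
  assumes "positive_functional g" "positive_elem a" shows "0 \<le> Re (g a)"
proof -
  obtain w where "self_adjoint w" "w * w = a" using positive_elem_sqrt[OF assms(2)] by metis
  then have "a = cstar w * w" by (simp add: self_adjoint_def)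
  with assms(1) show ?thesis by (simp add: positive_functional_def)
qed

text \<open>The discriminant criterion for a complex variable: the minimum is at
  \<open>z = cnj d / G\<close>. It yields Cauchy--Schwarz, the estimate at near-minimisers and the
  domination theorem.\<close>

lemma complex_quadratic_nonneg:
  fixes d :: complex
  assumes nn: "\<And>z. 0 \<le> C - 2 * Re (z * d) + (cmod z)\<^sup>2 * G" and G: "0 \<le> G"
  shows "(cmod d)\<^sup>2 \<le> C * G"
proof (cases "G = 0")
  case True
  have "d = 0"
  proof (rule ccontr)
    assume d: "d \<noteq> 0"
    \<comment> \<open>If \<open>G = 0\<close> the form is affine along \<open>cnj d\<close>; this
      multiple makes it equal to -1.\<close>
    define t where "t = (C + 1) / (2 * (cmod d)\<^sup>2)"
    have "Re (of_real t * cnj d * d) = t * (cmod d)\<^sup>2"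
      unfolding cmod_power2 by (simp add: power2_eq_square algebra_simps)
    then have "0 \<le> C - 2 * (t * (cmod d)\<^sup>2)"
      using nn[of "of_real t * cnj d"] True by simp
    then show False using d by (simp add: t_def)
  qed
  with True show ?thesis by simp
next
  case False
  then have G: "0 < G" using G by simp
  have e1: "Re (cnj d / of_real G * d) = (cmod d)\<^sup>2 / G"
    unfolding cmod_power2 by (simp add: power2_eq_square add_divide_distrib)
  have e2: "(cmod (cnj d / of_real G))\<^sup>2 * G = (cmod d)\<^sup>2 / G"
    using G by (simp add: norm_divide power2_eq_square)
  have "0 \<le> C - (cmod d)\<^sup>2 / G" using nn[of "cnj d / of_real G"] unfolding e1 e2 by simp
  then show ?thesis using G by (simp add: field_simps)
qed

lemma power2_le_mult_imp_le:
  fixes x a b :: real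
  assumes "x\<^sup>2 \<le> a\<^sup>2 * b\<^sup>2" "0 \<le> a" "0 \<le> b" shows "x \<le> a * b"
  using assms by (simp add: power_mult_distrib power2_le_imp_le[of x "a * b"])

lemma gns_norm_expand:
  assumes g: "positive_functional g"
  shows "(gns_norm g (c + scaleC z b))\<^sup>2
    = (gns_norm g c)\<^sup>2 + 2 * Re (z * g (cstar c * b)) + (cmod z)\<^sup>2 * (gns_norm g b)\<^sup>2"
proof -
  note lin = clf_simps[OF pf_clf[OF g]]
  have "Re (cnj z * g (cstar b * c)) = Re (z * g (cstar c * b))"
    by (subst pf_cstar_swap[OF g]) simp
  moreover have "(cmod z)\<^sup>2 * Re w = Re (z * cnj z * w)" for w
    by (simp add: complex_norm_square[symmetric] flip: of_real_power)
  ultimately show ?thesis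
    by (simp add: gns_norm_square[OF g] cstar_simps algebra_simps mult_scaleC_left mult_scaleC_right lin
        scaleC_scaleC)
qed

lemma pf_Cauchy_Schwarz:
  assumes g: "positive_functional g"
  shows "cmod (g (cstar b * a)) \<le> gns_norm g b * gns_norm g a"
proof -
  have "(cmod (- g (cstar b * a)))\<^sup>2 \<le> (gns_norm g b)\<^sup>2 * (gns_norm g a)\<^sup>2"
  proof (rule complex_quadratic_nonneg)
    show "0 \<le> (gns_norm g b)\<^sup>2 - 2 * Re (z * - g (cstar b * a)) + (cmod z)\<^sup>2 * (gns_norm g a)\<^sup>2" for z
      using gns_norm_expand[OF g, of b z a] zero_le_power2[of "gns_norm g (b + scaleC z a)"] by simp
  qed simp
  then have "(cmod (g (cstar b * a)))\<^sup>2 \<le> (gns_norm g b)\<^sup>2 * (gns_norm g a)\<^sup>2" by simp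
  then show ?thesis
    by (rule power2_le_mult_imp_le) (simp_all add: gns_norm_nonneg[OF g])
qed

text \<open>Left multiplication by \<open>y\<close> is a bounded operator on the GNS space, since
  \<open>a* (norm y ^ 2 - y* y) a\<close> is positive.\<close>

lemma gns_norm_mult_le:
  assumes g: "positive_functional g" shows "gns_norm g (y * a) \<le> norm y * gns_norm g a"
proof -
  note lin = clf_simps[OF pf_clf[OF g]]
  have "cstar a * (of_real ((norm y)\<^sup>2) - cstar y * y) * a
      = (norm y)\<^sup>2 *\<^sub>R (cstar a * a) - cstar (y * a) * (y * a)"
    by (simp add: algebra_simps cstar_mult of_real_def)
  with positive_elem_conjugate[OF cstar_mult_le_norm, of a y]
  have "0 \<le> Re (g ((norm y)\<^sup>2 *\<^sub>R (cstar a * a) - cstar (y * a) * (y * a)))"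
    using pf_positive_elem[OF g] by metis
  then have "(gns_norm g (y * a))\<^sup>2 \<le> (norm y)\<^sup>2 * (gns_norm g a)\<^sup>2"
    by (simp add: lin gns_norm_square[OF g])
  then show ?thesis
    by (rule power2_le_mult_imp_le) (simp_all add: gns_norm_nonneg[OF g])
qed

lemma gns_norm_le: "positive_functional g \<Longrightarrow> gns_norm g a \<le> norm a * gns_norm g 1"
  using gns_norm_mult_le[of g a 1] by simp

lemma pf_le_gns_norm: "positive_functional g \<Longrightarrow> cmod (g a) \<le> gns_norm g 1 * gns_norm g a"
  using pf_Cauchy_Schwarz[of g 1 a] by simp

lemma pf_bound:
  assumes g: "positive_functional g" shows "cmod (g a) \<le> Re (g 1) * norm a"
proof -
  have "gns_norm g 1 * gns_norm g a \<le> gns_norm g 1 * (norm a * gns_norm g 1)"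
    using gns_norm_le[OF g] gns_norm_nonneg[OF g] by (rule mult_left_mono)
  also have "\<dots> = Re (g 1) * norm a" using gns_norm_square[OF g, of 1] by (simp add: power2_eq_square)
  finally show ?thesis using pf_le_gns_norm[OF g, of a] by linarith
qed

lemma pf_dual_space: "positive_functional g \<Longrightarrow> g \<in> dual_space"
  by (rule dual_spaceI[OF pf_clf pf_bound])

lemma gns_bounded_dual_space:
  assumes g: "positive_functional g" and k: "clinear_functional k"
    and bound: "\<And>b. cmod (k b) \<le> K * gns_norm g b" and K: "0 \<le> K"
  shows "k \<in> dual_space" and "dual_norm k \<le> K * gns_norm g 1"
proof -
  have *: "cmod (k b) \<le> K * gns_norm g 1 * norm b" for b
    using order_trans[OF bound mult_left_mono[OF gns_norm_le[OF g] K]] by (simp add: mult_ac)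
  show "k \<in> dual_space" by (rule dual_spaceI[OF k *])
  show "dual_norm k \<le> K * gns_norm g 1" by (rule dual_norm_le[OF *])
qed

text \<open>An incomplete form of the Riesz representation theorem: a near-minimiser \<open>c\<close> of
  \<open>g (c* c) - 2 Re (k c)\<close> represents \<open>k\<close> up to \<open>\<epsilon>\<close>.\<close>

lemma gns_approx:
  assumes g: "positive_functional g" and k: "clinear_functional k"
    and bound: "\<And>b. cmod (k b) \<le> K * gns_norm g b" and K: "0 \<le> K" and \<epsilon>: "0 < \<epsilon>"
  obtains c where "\<And>b. cmod (k b - g (cstar c * b)) \<le> \<epsilon> * gns_norm g b" "gns_norm g c \<le> K + \<epsilon>"
proof -
  define J where "J c = (gns_norm g c)\<^sup>2 - 2 * Re (k c)" for c
  have "- K\<^sup>2 \<le> J c" for c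
  proof -
    have "Re (k c) \<le> K * gns_norm g c" using bound[of c] complex_Re_le_cmod[of "k c"] by linarith
    moreover have "0 \<le> (gns_norm g c - K)\<^sup>2" by simp
    ultimately show ?thesis by (simp add: J_def power2_diff algebra_simps)
  qed
  then have bdd: "bdd_below (range J)" by (intro bdd_belowI[of _ "- K\<^sup>2"]) auto
  obtain c where c: "J c < Inf (range J) + \<epsilon>\<^sup>2"
    using cInf_lessD[of "range J" "Inf (range J) + \<epsilon>\<^sup>2"] \<epsilon> by auto
  have min: "J c - \<epsilon>\<^sup>2 \<le> J x" for x
    using c cInf_lower[OF rangeI bdd, of x] by linarith
  have *: "cmod (k b - g (cstar c * b)) \<le> \<epsilon> * gns_norm g b" for b
  proof -
    \<comment> \<open>Moving from \<open>c\<close> by a multiple of \<open>b\<close> lowers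
      \<open>J\<close> by at most the square of \<open>\<epsilon>\<close>. The quadratic criterion
      turns this into a bound on the linear term, which is the error of the representation.\<close>
    have "(cmod (k b - g (cstar c * b)))\<^sup>2 \<le> \<epsilon>\<^sup>2 * (gns_norm g b)\<^sup>2"
    proof (rule complex_quadratic_nonneg)
      show "0 \<le> \<epsilon>\<^sup>2 - 2 * Re (z * (k b - g (cstar c * b))) + (cmod z)\<^sup>2 * (gns_norm g b)\<^sup>2" for z
        using min[of "c + scaleC z b"]
        by (simp add: J_def gns_norm_expand[OF g] clf_simps[OF k] right_diff_distrib)
    qed simp
    then show ?thesis
      by (rule power2_le_mult_imp_le) (use \<epsilon> in \<open>simp_all add: gns_norm_nonneg[OF g]\<close>)
  qed
  have "gns_norm g c \<le> K + \<epsilon>"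
  proof (cases "gns_norm g c = 0")
    case False
    then have pos: "0 < gns_norm g c" using gns_norm_nonneg[OF g, of c] by simp
    have "gns_norm g c * gns_norm g c = cmod (g (cstar c * c))"
      by (simp add: pf_square[OF g] power2_eq_square flip: of_real_mult)
    also have "\<dots> \<le> cmod (k c) + cmod (k c - g (cstar c * c))"
      by (metis norm_minus_commute norm_triangle_sub)
    also have "\<dots> \<le> (K + \<epsilon>) * gns_norm g c"
      using bound[of c] *[of c] by (simp add: distrib_right)
    finally show ?thesis using pos by simp
  qed (use K \<epsilon> in simp)
  with * show thesis by (rule that)
qed

lemma complexify_functional:
  fixes g :: "'a::unital_cstar_algebra \<Rightarrow> real"
  assumes g: "linear g"
  obtains G where "clinear_functional G" "\<And>a. Re (G a) = (g a + g (cstar a)) / 2"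
    "\<And>a. self_adjoint a \<Longrightarrow> G a = of_real (g a)"
proof -
  \<comment> \<open>Symmetrising under the involution before complexifying makes
    \<open>s (i a)\<close> vanish for self-adjoint \<open>a\<close>, so that \<open>G\<close> is
    real there and agrees with \<open>g\<close>.\<close>
  define s where "s a = (g a + g (cstar a)) / 2" for a
  have s_add: "s (a + b) = s a + s b" for a b
    by (simp add: s_def cstar_add linear_add[OF g] field_simps)
  have s_scale: "s (r *\<^sub>R a) = r * s a" for r a
    by (simp add: s_def cstar_scaleR linear_cmul[OF g] field_simps)
  have s_minus: "s (- a) = - s a" for a using s_scale[of "-1" a] by simp
  have s_diff: "s (a - b) = s a - s b" for a b using s_add[of a "- b"] s_minus[of b] by simp
  define G where "G a = Complex (s a) (- s (scaleC \<i> a))" for a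
  have decomp: "scaleC z a = Re z *\<^sub>R a + Im z *\<^sub>R scaleC \<i> a" for z a
  proof -
    have "z = of_real (Re z) + of_real (Im z) * \<i>" by (simp add: complex_eq_iff)
    then have "scaleC z a = scaleC (of_real (Re z) + of_real (Im z) * \<i>) a" by simp
    also have "\<dots> = Re z *\<^sub>R a + Im z *\<^sub>R scaleC \<i> a"
      unfolding scaleC_add_left scaleC_scaleC[symmetric] scaleC_of_real ..
    finally show ?thesis .
  qed
  have "clinear_functional G"
    unfolding clinear_functional_def
  proof (intro conjI allI)
    show "G (x + y) = G x + G y" for x y
      by (simp add: G_def complex_eq_iff s_add scaleC_add_right)
    show "G (scaleC z x) = z * G x" for z x
      by (subst decomp)
        (simp add: G_def complex_eq_iff s_add s_diff s_scale s_minus scaleC_add_right scaleC_scaleR scaleC_minus_right)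
  qed
  moreover have "Re (G a) = (g a + g (cstar a)) / 2" for a by (simp add: G_def s_def)
  moreover have "G a = of_real (g a)" if "self_adjoint a" for a
    using that by (simp add: G_def s_def self_adjoint_def cstar_simps scaleC_minus_left complex_eq_iff
        linear_neg[OF g])
  ultimately show thesis by (rule that)
qed

section \<open>Domination of bounded functionals by positive ones\<close>

lemma clf_bound_from_Re:
  assumes G: "clinear_functional G" and Re: "\<And>a. Re (G a) \<le> norm a"
  shows "cmod (G a) \<le> norm a"
proof (cases "G a = 0")
  case False
  define u where "u = cnj (G a) / of_real (cmod (G a))"
  have u: "cmod u = 1" using False by (simp add: u_def norm_divide)
  have "u * G a = of_real (cmod (G a))"
    using False by (simp add: u_def complex_norm_square[symmetric] mult.commute power2_eq_square)
  then have "cmod (G a) = Re (G (scaleC u a))" by (simp add: clf_simps[OF G])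
  also have "\<dots> \<le> norm a" using Re[of "scaleC u a"] by (simp add: norm_scaleC u)
  finally show ?thesis .
qed simp

text \<open>Guarantees a functional of positive dual norm. Without one, suprema over the dual unit
  ball could not be compared with 0, and the unit of the bidual could not be separated from
  0.\<close>

lemma norming_functional_one:
  obtains f :: "'a::unital_cstar_algebra \<Rightarrow> complex"
  where "clinear_functional f" "\<And>a. cmod (f a) \<le> norm a" "f 1 = 1"
proof -
  have "sublinear (norm :: 'a \<Rightarrow> real)"
    by (rule sublinearI) (simp_all add: norm_triangle_ineq)
  then obtain g :: "'a \<Rightarrow> real" where g: "linear g" "\<And>x. g x \<le> norm x" "g 1 = norm (1::'a)"
    using hahn_banach_sublinear by metis
  obtain G where G: "clinear_functional G" "\<And>a. Re (G a) = (g a + g (cstar a)) / 2"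
    "\<And>a. self_adjoint a \<Longrightarrow> G a = of_real (g a)"
    using complexify_functional[OF g(1)] by metis
  have "Re (G a) \<le> norm a" for a using g(2)[of a] g(2)[of "cstar a"] by (simp add: G(2))
  from that[OF G(1) clf_bound_from_Re[OF G(1) this]] G(3)[of 1] g(3) show thesis
    by (simp add: self_adjoint_def)
qed

text \<open>Joint convexity of \<open>(b, l) \<mapsto> b* b / l\<close> in homogeneous form: the
  remainder is \<open>d* d / (l1 l2 (l1 + l2))\<close> with
  \<open>d = l2 b1 - l1 b2\<close>.\<close>

lemma square_sum_split:
  fixes b1 b2 :: "'a::unital_cstar_algebra"
  assumes "0 < l1" "0 < l2"
  obtains m where "positive_elem m"
    "(1/l1) *\<^sub>R (cstar b1 * b1) + (1/l2) *\<^sub>R (cstar b2 * b2)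
      = (1/(l1+l2)) *\<^sub>R (cstar (b1 + b2) * (b1 + b2)) + m"
proof -
  define d where "d = l2 *\<^sub>R b1 - l1 *\<^sub>R b2"
  define k where "k = 1 / (l1 * l2 * (l1 + l2))"
  have k: "0 < k" using assms by (simp add: k_def)
  have e1: "1/l1 = 1/(l1+l2) + k * (l2 * l2)" and e2: "1/l2 = 1/(l1+l2) + k * (l1 * l1)"
    and e3: "1/(l1+l2) = k * (l1 * l2)"
  proof -
    have nz: "l1 \<noteq> 0" "l2 \<noteq> 0" "l1 + l2 \<noteq> 0" using assms by auto
    then show "1/l1 = 1/(l1+l2) + k * (l2 * l2)" "1/l2 = 1/(l1+l2) + k * (l1 * l1)"
      "1/(l1+l2) = k * (l1 * l2)"
      unfolding k_def by (simp_all add: divide_simps)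
  qed
  have dd: "cstar d * d = (l2 * l2) *\<^sub>R (cstar b1 * b1) - (l1 * l2) *\<^sub>R (cstar b1 * b2)
      - (l1 * l2) *\<^sub>R (cstar b2 * b1) + (l1 * l1) *\<^sub>R (cstar b2 * b2)"
    by (simp add: d_def cstar_simps algebra_simps)
  have "(1/(l1+l2)) *\<^sub>R (cstar (b1 + b2) * (b1 + b2)) + k *\<^sub>R (cstar d * d)
      = (1/(l1+l2) + k * (l2 * l2)) *\<^sub>R (cstar b1 * b1) + (1/(l1+l2) + k * (l1 * l1)) *\<^sub>R (cstar b2 * b2)
       + (1/(l1+l2) - k * (l1 * l2)) *\<^sub>R (cstar b1 * b2) + (1/(l1+l2) - k * (l1 * l2)) *\<^sub>R (cstar b2 * b1)"
    unfolding dd by (simp add: cstar_add algebra_simps)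
  also have "\<dots> = (1/l1) *\<^sub>R (cstar b1 * b1) + (1/l2) *\<^sub>R (cstar b2 * b2)"
    unfolding e1[symmetric] e2[symmetric] using e3 by simp
  finally show thesis
    using k by (intro that[of "k *\<^sub>R (cstar d * d)"] positive_elem_scaleR positive_elem_cstar_mult) auto
qed

text \<open>The bound \<open>|f a|\<^sup>2 \<le> g (a* a)\<close> for all \<open>a\<close> amounts to \<open>g (a* a) \<ge> 2 Re (f a) - 1\<close> for all
  \<open>a\<close>; the sublinear functional below is the largest one that forces it.\<close>

theorem dominating_positive_functional:
  fixes f :: "'a::unital_cstar_algebra \<Rightarrow> complex"
  assumes f: "clinear_functional f" and fb: "\<And>a. cmod (f a) \<le> norm a"
  obtains g where "positive_functional g" "Re (g 1) \<le> 1" "\<And>a. cmod (f a) \<le> gns_norm g a"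
proof -
  \<comment> \<open>Each parameter secures one property of a functional \<open>g\<close> below the
    infimum. Choosing \<open>h = - m\<close> makes \<open>g\<close> nonnegative on positive
    elements, \<open>h = - b* b\<close> with \<open>l = 1\<close> gives
    \<open>g (b* b) \<ge> 2 Re (f b) - 1\<close>, and \<open>h = 1\<close> with \<open>b = 0\<close>
    gives \<open>g 1 \<le> 1\<close>. Letting \<open>l\<close> range over all positive numbers makes
    the family stable under scaling and sums.\<close>
  define V where "V h = {norm (h + (1/l) *\<^sub>R (cstar b * b) + m) - 2 * Re (f b) + l | b m l.
     positive_elem m \<and> 0 < l}" for h :: 'a
  define q where "q h = Inf (V h)" for h
  have VI: "norm (h + (1/l) *\<^sub>R (cstar b * b) + m) - 2 * Re (f b) + l \<in> V h"
    if "positive_elem m" "0 < l" for h b m l using that unfolding V_def by blast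
  have ne: "V h \<noteq> {}" for h using VI[of 0 1 h] by auto
  have lower: "- norm h \<le> v" if v: "v \<in> V h" for v h
  proof -
    obtain b m l where *: "v = norm (h + (1/l) *\<^sub>R (cstar b * b) + m) - 2 * Re (f b) + l"
      "positive_elem m" "0 < l" using v unfolding V_def by blast
    have "norm ((1/l) *\<^sub>R (cstar b * b)) \<le> norm ((1/l) *\<^sub>R (cstar b * b) + m)"
      using * by (intro norm_mono_positive_elem positive_elem_scaleR positive_elem_cstar_mult) auto
    then have 1: "(1/l) * (norm b)\<^sup>2 \<le> norm ((1/l) *\<^sub>R (cstar b * b) + m)"
      using * by (simp add: cstar_identity)
    have "norm ((1/l) *\<^sub>R (cstar b * b) + m) \<le> norm (h + (1/l) *\<^sub>R (cstar b * b) + m) + norm h"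
      using norm_triangle_ineq4[of "h + (1/l) *\<^sub>R (cstar b * b) + m" h] by (simp add: algebra_simps)
    moreover have "Re (f b) \<le> norm b" using fb[of b] complex_Re_le_cmod[of "f b"] by linarith
    \<comment> \<open>The expression is a square divided by \<open>l\<close>. Together with
      \<open>Re (f b) \<le> norm b\<close> it bounds the members of \<open>V h\<close> from below by
      \<open>- norm h\<close>, so the infimum is finite.\<close>
    moreover have "0 \<le> (1/l) * (norm b)\<^sup>2 - 2 * norm b + l"
    proof -
      have "(1/l) * (norm b)\<^sup>2 - 2 * norm b + l = (1/l) * (norm b - l)\<^sup>2"
        using * by (simp add: power2_diff field_simps power2_eq_square)
      then show ?thesis using * by simp
    qed
    ultimately show ?thesis using 1 *(1) by linarith
  qed
  then have bdd: "bdd_below (V h)" for h by (rule bdd_belowI)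
  have ql: "q h \<le> v" if "v \<in> V h" for h v unfolding q_def using that bdd by (rule cInf_lower)
  have lq: "k \<le> q h" if "\<And>v. v \<in> V h \<Longrightarrow> k \<le> v" for h k
    unfolding q_def using ne that by (rule cInf_greatest)
  have "sublinear q"
  proof (rule sublinearI)
    fix x y
    have "q (x + y) - v \<le> u" if vu: "v \<in> V x" "u \<in> V y" for u v
    proof -
      obtain b1 m1 l1 where 1: "v = norm (x + (1/l1) *\<^sub>R (cstar b1 * b1) + m1) - 2 * Re (f b1) + l1"
        "positive_elem m1" "0 < l1" using vu unfolding V_def by blast
      obtain b2 m2 l2 where 2: "u = norm (y + (1/l2) *\<^sub>R (cstar b2 * b2) + m2) - 2 * Re (f b2) + l2"
        "positive_elem m2" "0 < l2" using vu unfolding V_def by blast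
      obtain m where m: "positive_elem m" "(1/l1) *\<^sub>R (cstar b1 * b1) + (1/l2) *\<^sub>R (cstar b2 * b2)
        = (1/(l1+l2)) *\<^sub>R (cstar (b1 + b2) * (b1 + b2)) + m"
        using square_sum_split[OF 1(3) 2(3)] by metis
      have "q (x + y) \<le> norm ((x + y) + (1/(l1+l2)) *\<^sub>R (cstar (b1 + b2) * (b1 + b2)) + (m + m1 + m2))
          - 2 * Re (f (b1 + b2)) + (l1 + l2)"
        using m 1 2 by (intro ql VI positive_elem_add) auto
      also have "(x + y) + (1/(l1+l2)) *\<^sub>R (cstar (b1 + b2) * (b1 + b2)) + (m + m1 + m2)
        = (x + y) + ((1/(l1+l2)) *\<^sub>R (cstar (b1 + b2) * (b1 + b2)) + m) + m1 + m2"
        by (simp only: add.assoc)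
      also have "\<dots> = (x + (1/l1) *\<^sub>R (cstar b1 * b1) + m1) + (y + (1/l2) *\<^sub>R (cstar b2 * b2) + m2)"
        unfolding m(2)[symmetric] by (simp only: ac_simps)
      also have "norm \<dots> \<le> norm (x + (1/l1) *\<^sub>R (cstar b1 * b1) + m1) + norm (y + (1/l2) *\<^sub>R (cstar b2 * b2) + m2)"
        by (rule norm_triangle_ineq)
      finally show ?thesis using 1(1) 2(1) by (simp add: clf_simps[OF f])
    qed
    then have "q (x + y) - v \<le> q y" if "v \<in> V x" for v using that lq by blast
    then have "q (x + y) - q y \<le> q x" by (intro lq) (simp add: algebra_simps)
    then show "q (x + y) \<le> q x + q y" by simp
  next
    fix r :: real and x assume r: "0 < r"
    have "(1/r) * q (r *\<^sub>R x) \<le> q x"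
    proof (rule lq)
      fix v assume "v \<in> V x"
      then obtain b m l where 1: "v = norm (x + (1/l) *\<^sub>R (cstar b * b) + m) - 2 * Re (f b) + l"
        "positive_elem m" "0 < l" unfolding V_def by blast
      have "q (r *\<^sub>R x) \<le> norm (r *\<^sub>R x + (1/(r*l)) *\<^sub>R (cstar (r *\<^sub>R b) * (r *\<^sub>R b)) + r *\<^sub>R m)
          - 2 * Re (f (r *\<^sub>R b)) + r * l"
        using 1 r by (intro ql VI positive_elem_scaleR) auto
      also have "r *\<^sub>R x + (1/(r*l)) *\<^sub>R (cstar (r *\<^sub>R b) * (r *\<^sub>R b)) + r *\<^sub>R m
          = r *\<^sub>R (x + (1/l) *\<^sub>R (cstar b * b) + m)"
        using r by (simp add: cstar_scaleR scaleR_add_right)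
      also have "norm (r *\<^sub>R (x + (1/l) *\<^sub>R (cstar b * b) + m)) - 2 * Re (f (r *\<^sub>R b)) + r * l = r * v"
        using r unfolding 1(1) norm_scaleR clf_scaleR[OF f] by (simp add: algebra_simps)
      finally have "q (r *\<^sub>R x) \<le> r * v" .
      then show "(1/r) * q (r *\<^sub>R x) \<le> v" using r by (simp add: field_simps)
    qed
    then show "q (r *\<^sub>R x) \<le> r * q x" using r by (simp add: field_simps)
  qed
  then obtain g where g: "linear g" "\<And>x. g x \<le> q x"
    using hahn_banach_sublinear by metis
  have g_le: "g h \<le> norm (h + (1/l) *\<^sub>R (cstar b * b) + m) - 2 * Re (f b) + l"
    if "positive_elem m" "0 < l" for h b m l
    using g(2)[of h] ql[OF VI[OF that, of h b]] by linarith
  have g1: "g 1 \<le> 1"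
  proof (rule field_le_epsilon)
    fix e :: real assume "0 < e"
    then show "g 1 \<le> 1 + e" using g_le[of 0 e 1 0] by (simp add: clf_zero[OF f])
  qed
  have gpos: "0 \<le> g m" if m: "positive_elem m" for m
  proof (rule field_le_epsilon)
    fix e :: real assume "0 < e"
    then show "0 \<le> g m + e" using g_le[OF m, of e "- m" 0] by (simp add: clf_zero[OF f] linear_neg[OF g(1)])
  qed
  have gsq: "2 * Re (f b) - 1 \<le> g (cstar b * b)" for b
    using g_le[of 0 1 "- (cstar b * b)" b] by (simp add: linear_neg[OF g(1)])
  obtain G where G: "clinear_functional G" "\<And>a. self_adjoint a \<Longrightarrow> G a = of_real (g a)"
    using complexify_functional[OF g(1)] by metis
  have sq: "G (cstar a * a) = of_real (g (cstar a * a))" for a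
    by (rule G(2)) (simp add: self_adjoint_def cstar_simps)
  have pG: "positive_functional G"
    by (simp add: positive_functional_def G(1) sq gpos positive_elem_cstar_mult)
  have "cmod (f a) \<le> gns_norm G a" for a
  proof -
    have "(cmod (f a))\<^sup>2 \<le> 1 * (gns_norm G a)\<^sup>2"
    proof (rule complex_quadratic_nonneg)
      fix z
      have "(gns_norm G (scaleC z a))\<^sup>2 = (cmod z)\<^sup>2 * (gns_norm G a)\<^sup>2"
        using gns_norm_expand[OF pG, of 0 z a] by (simp add: gns_norm_def clf_zero[OF G(1)])
      moreover have "2 * Re (f (scaleC z a)) - 1 \<le> (gns_norm G (scaleC z a))\<^sup>2"
        using gsq[of "scaleC z a"] by (simp add: gns_norm_square[OF pG] sq)
      ultimately show "0 \<le> 1 - 2 * Re (z * f a) + (cmod z)\<^sup>2 * (gns_norm G a)\<^sup>2"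
        by (simp add: clf_simps[OF f])
    qed simp
    then show ?thesis using power2_le_imp_le[OF _ gns_norm_nonneg[OF pG]] by simp
  qed
  moreover have "Re (G 1) \<le> 1" using G(2)[of 1] g1 by (simp add: self_adjoint_def)
  ultimately show thesis using that[OF pG] by simp
qed

subsection \<open>The bidual and its Arens product\<close>

definition bidual_norm :: "'a::unital_cstar_algebra bidual \<Rightarrow> real" where
  "bidual_norm F = (SUP f\<in>{f \<in> dual_space. dual_norm f \<le> 1}. cmod (F f))"

lemma bidual_add: "F \<in> bidual_space \<Longrightarrow> f \<in> dual_space \<Longrightarrow> g \<in> dual_space \<Longrightarrow> F (\<lambda>a. f a + g a) = F f + F g"
  and bidual_scale: "F \<in> bidual_space \<Longrightarrow> f \<in> dual_space \<Longrightarrow> F (\<lambda>a. c * f a) = c * F f"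
  and bidual_outside: "F \<in> bidual_space \<Longrightarrow> f \<notin> dual_space \<Longrightarrow> F f = 0"
  by (auto simp: bidual_space_def)

lemma bidual_diff:
  assumes "F \<in> bidual_space" "f \<in> dual_space" "g \<in> dual_space"
  shows "F (\<lambda>a. f a - g a) = F f - F g"
  using bidual_add[OF assms(1,2) dual_space_scale[OF assms(3)], of "-1"] bidual_scale[OF assms(1,3), of "-1"]
  by simp

lemma zero_dual_space: "(\<lambda>_. 0) \<in> dual_space"
  by (rule dual_spaceI[where K = 0]) (simp_all add: clinear_functional_def)

lemma dual_norm_zero: "dual_norm (\<lambda>_. 0 :: complex) \<le> 0"
  by (rule dual_norm_le) simp

lemma dual_norm_scale: "f \<in> dual_space \<Longrightarrow> dual_norm (\<lambda>a. c * f a) \<le> cmod c * dual_norm f"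
  using dual_space_lincomb(2)[of f f c 0] by simp

lemma bidual_norm_bound:
  fixes F :: "'a::unital_cstar_algebra bidual"
  assumes F: "F \<in> bidual_space" and f: "f \<in> dual_space"
  shows "cmod (F f) \<le> bidual_norm F * dual_norm f"
proof -
  obtain K where K: "\<And>f. f \<in> dual_space \<Longrightarrow> cmod (F f) \<le> K * dual_norm f"
    using F unfolding bidual_space_def by blast
  have bdd: "bdd_above ((\<lambda>f. cmod (F f)) ` {f \<in> dual_space. dual_norm f \<le> 1})"
  proof (rule bdd_aboveI2)
    fix f :: "'a \<Rightarrow> complex" assume f: "f \<in> {f \<in> dual_space. dual_norm f \<le> 1}"
    then have "\<bar>K\<bar> * dual_norm f \<le> \<bar>K\<bar> * 1" by (intro mult_left_mono) auto
    moreover have "K * dual_norm f \<le> \<bar>K\<bar> * dual_norm f"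
      using f dual_norm_nonneg by (intro mult_right_mono) auto
    ultimately show "cmod (F f) \<le> \<bar>K\<bar>" using K[of f] f by simp
  qed
  show ?thesis
  proof (cases "dual_norm f = 0")
    case True then show ?thesis using K[OF f] by simp
  next
    case False
    then have pos: "0 < dual_norm f" using dual_norm_nonneg[OF f] by simp
    define g where "g a = of_real (1 / dual_norm f) * f a" for a
    have g: "g \<in> dual_space" unfolding g_def by (rule dual_space_scale[OF f])
    have "dual_norm g \<le> cmod (of_real (1 / dual_norm f)) * dual_norm f"
      unfolding g_def by (rule dual_norm_scale[OF f])
    also have "\<dots> = 1" using pos by (simp add: norm_divide)
    finally have "cmod (F g) \<le> bidual_norm F"
      unfolding bidual_norm_def using g by (intro cSUP_upper[OF _ bdd]) simp
    moreover have "F g = of_real (1 / dual_norm f) * F f"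
      unfolding g_def by (rule bidual_scale[OF F f])
    then have "cmod (F g) = cmod (F f) / dual_norm f" using pos by (simp add: norm_mult norm_divide)
    ultimately show ?thesis using pos by (simp add: field_simps)
  qed
qed

lemma bidual_norm_le:
  fixes F :: "'a::unital_cstar_algebra bidual"
  assumes "\<And>f. f \<in> dual_space \<Longrightarrow> dual_norm f \<le> 1 \<Longrightarrow> cmod (F f) \<le> K"
  shows "bidual_norm F \<le> K"
  unfolding bidual_norm_def
proof (rule cSUP_least)
  show "{f \<in> dual_space. dual_norm f \<le> 1} \<noteq> ({} :: ('a \<Rightarrow> complex) set)"
    using zero_dual_space dual_norm_zero by (auto intro!: exI[of _ "\<lambda>_. 0"] order_trans[OF dual_norm_zero])
qed (use assms in auto)

lemma bidual_norm_le':
  assumes "\<And>f. f \<in> dual_space \<Longrightarrow> cmod (F f) \<le> K * dual_norm f" "0 \<le> K"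
  shows "bidual_norm F \<le> K"
  by (rule bidual_norm_le) (use assms mult_left_mono[of _ 1 K] in fastforce)

lemma bidual_norm_nonneg:
  fixes F :: "'a::unital_cstar_algebra bidual"
  assumes F: "F \<in> bidual_space" shows "0 \<le> bidual_norm F"
proof -
  obtain f :: "'a \<Rightarrow> complex" where f: "clinear_functional f" "\<And>a. cmod (f a) \<le> norm a" "f 1 = 1"
    using norming_functional_one by metis
  have fd: "f \<in> dual_space" using f by (intro dual_spaceI[where K = 1]) auto
  have "0 < dual_norm f" using dual_norm_bound[OF fd, of 1] f(3) by simp
  then show ?thesis using order_trans[OF norm_ge_zero bidual_norm_bound[OF F fd]]
    by (simp add: zero_le_mult_iff)
qed

lemma bidual_norm_bound_le:
  assumes "F \<in> bidual_space" "f \<in> dual_space" "dual_norm f \<le> K"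
  shows "cmod (F f) \<le> bidual_norm F * K"
  by (rule order_trans[OF bidual_norm_bound mult_left_mono]) (use assms bidual_norm_nonneg in auto)

lemma bidual_spaceI:
  assumes "\<And>f g. f \<in> dual_space \<Longrightarrow> g \<in> dual_space \<Longrightarrow> F (\<lambda>a. f a + g a) = F f + F g"
    "\<And>c f. f \<in> dual_space \<Longrightarrow> F (\<lambda>a. c * f a) = c * F f"
    "\<And>f. f \<in> dual_space \<Longrightarrow> cmod (F f) \<le> K * dual_norm f"
    "\<And>f. f \<notin> dual_space \<Longrightarrow> F f = 0"
  shows "F \<in> bidual_space"
  using assms unfolding bidual_space_def by blast

lemma dual_mult_left:
  assumes f: "f \<in> dual_space"
  shows "(\<lambda>b. f (a * b)) \<in> dual_space" "dual_norm (\<lambda>b. f (a * b)) \<le> dual_norm f * norm a"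
proof -
  have *: "cmod (f (a * b)) \<le> (dual_norm f * norm a) * norm b" for b
    using dual_norm_bound[OF f, of "a * b"] mult_left_mono[OF norm_mult_ineq[of a b] dual_norm_nonneg[OF f]]
    by (simp add: mult.assoc)
  show "(\<lambda>b. f (a * b)) \<in> dual_space" by (rule dual_spaceI[OF clf_mult_left[OF dual_spaceD[OF f]] *])
  show "dual_norm (\<lambda>b. f (a * b)) \<le> dual_norm f * norm a" by (rule dual_norm_le[OF *])
qed

lemma dual_mult_right:
  assumes f: "f \<in> dual_space"
  shows "(\<lambda>b. f (b * a)) \<in> dual_space" "dual_norm (\<lambda>b. f (b * a)) \<le> dual_norm f * norm a"
proof -
  have *: "cmod (f (b * a)) \<le> (dual_norm f * norm a) * norm b" for b
    using dual_norm_bound[OF f, of "b * a"] mult_left_mono[OF norm_mult_ineq[of b a] dual_norm_nonneg[OF f]]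
    by (simp add: mult_ac)
  show "(\<lambda>b. f (b * a)) \<in> dual_space" by (rule dual_spaceI[OF clf_mult_right[OF dual_spaceD[OF f]] *])
  show "dual_norm (\<lambda>b. f (b * a)) \<le> dual_norm f * norm a" by (rule dual_norm_le[OF *])
qed

lemma bidual_act_dual_space:
  assumes F: "F \<in> bidual_space" and f: "f \<in> dual_space"
  shows "bidual_act F f \<in> dual_space" "dual_norm (bidual_act F f) \<le> bidual_norm F * dual_norm f"
proof -
  note fD = dual_spaceD[OF f]
  have *: "cmod (bidual_act F f a) \<le> (bidual_norm F * dual_norm f) * norm a" for a
    unfolding bidual_act_def dual_act_def
    using bidual_norm_bound[OF F dual_mult_left(1)[OF f, of a]]
      mult_left_mono[OF dual_mult_left(2)[OF f, of a] bidual_norm_nonneg[OF F]]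
    by (simp add: mult.assoc)
  have "clinear_functional (bidual_act F f)"
    unfolding clinear_functional_def bidual_act_def dual_act_def
    by (simp add: distrib_right mult_scaleC_left clf_add[OF fD] clf_scaleC[OF fD]
        bidual_add[OF F] bidual_scale[OF F] dual_mult_left(1)[OF f])
  then show "bidual_act F f \<in> dual_space" using * by (rule dual_spaceI)
  show "dual_norm (bidual_act F f) \<le> bidual_norm F * dual_norm f" by (rule dual_norm_le[OF *])
qed

lemma right_act_dual_space:
  assumes G: "G \<in> bidual_space" and f: "f \<in> dual_space"
  shows "(\<lambda>a. G (\<lambda>b. f (b * a))) \<in> dual_space"
    "dual_norm (\<lambda>a. G (\<lambda>b. f (b * a))) \<le> bidual_norm G * dual_norm f"
proof -
  note fD = dual_spaceD[OF f]
  have *: "cmod (G (\<lambda>b. f (b * a))) \<le> (bidual_norm G * dual_norm f) * norm a" for a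
    using bidual_norm_bound[OF G dual_mult_right(1)[OF f, of a]]
      mult_left_mono[OF dual_mult_right(2)[OF f, of a] bidual_norm_nonneg[OF G]]
    by (simp add: mult.assoc)
  have "clinear_functional (\<lambda>a. G (\<lambda>b. f (b * a)))"
    unfolding clinear_functional_def
    by (simp add: distrib_left mult_scaleC_right clf_add[OF fD] clf_scaleC[OF fD]
        bidual_add[OF G] bidual_scale[OF G] dual_mult_right(1)[OF f])
  then show "(\<lambda>a. G (\<lambda>b. f (b * a))) \<in> dual_space" using * by (rule dual_spaceI)
  show "dual_norm (\<lambda>a. G (\<lambda>b. f (b * a))) \<le> bidual_norm G * dual_norm f" by (rule dual_norm_le[OF *])
qed

lemma bidual_act_add:
  assumes "F \<in> bidual_space" "f \<in> dual_space" "g \<in> dual_space"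
  shows "bidual_act F (\<lambda>a. f a + g a) = (\<lambda>a. bidual_act F f a + bidual_act F g a)"
  unfolding bidual_act_def dual_act_def
  using bidual_add[OF assms(1) dual_mult_left(1)[OF assms(2)] dual_mult_left(1)[OF assms(3)]] by simp

lemma bidual_act_scale:
  assumes "F \<in> bidual_space" "f \<in> dual_space"
  shows "bidual_act F (\<lambda>a. c * f a) = (\<lambda>a. c * bidual_act F f a)"
  unfolding bidual_act_def dual_act_def
  using bidual_scale[OF assms(1) dual_mult_left(1)[OF assms(2)]] by simp

lemma bd_mult_bound:
  assumes G: "G \<in> bidual_space" and F: "F \<in> bidual_space" and f: "f \<in> dual_space"
  shows "cmod ((G \<star> F) f) \<le> (bidual_norm G * bidual_norm F) * dual_norm f"
  using bidual_norm_bound[OF G bidual_act_dual_space(1)[OF F f]]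
    mult_left_mono[OF bidual_act_dual_space(2)[OF F f] bidual_norm_nonneg[OF G]] f
  by (simp add: bd_mult_def mult.assoc)

lemma bd_mult_bidual_space:
  assumes G: "G \<in> bidual_space" and F: "F \<in> bidual_space" shows "G \<star> F \<in> bidual_space"
proof (rule bidual_spaceI)
  show "cmod ((G \<star> F) f) \<le> (bidual_norm G * bidual_norm F) * dual_norm f" if "f \<in> dual_space" for f
    using bd_mult_bound[OF G F that] .
qed (simp_all add: bd_mult_def dual_space_add dual_space_scale bidual_act_add[OF F] bidual_act_scale[OF F]
    bidual_add[OF G] bidual_scale[OF G] bidual_act_dual_space[OF F])

lemma bd_mult_assoc:
  assumes "G \<in> bidual_space" "F \<in> bidual_space" "E \<in> bidual_space"
  shows "(G \<star> F) \<star> E = G \<star> (F \<star> E)"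
proof
  fix f
  show "((G \<star> F) \<star> E) f = (G \<star> (F \<star> E)) f"
  proof (cases "f \<in> dual_space")
    case True
    have "bidual_act (F \<star> E) f = bidual_act F (bidual_act E f)"
      using True by (simp add: bd_mult_def bidual_act_def dual_act_def dual_mult_left mult.assoc)
    then show ?thesis using True assms by (simp add: bd_mult_def bidual_act_dual_space)
  qed (simp add: bd_mult_def)
qed

lemma dual_star_dual_space:
  assumes f: "f \<in> dual_space" shows "dual_star f \<in> dual_space" "dual_norm (dual_star f) \<le> dual_norm f"
proof -
  note fD = dual_spaceD[OF f]
  have *: "cmod (dual_star f a) \<le> dual_norm f * norm a" for a
    using dual_norm_bound[OF f, of "cstar a"] by (simp add: dual_star_def)
  have "clinear_functional (dual_star f)"
    by (simp add: clinear_functional_def dual_star_def cstar_simps clf_add[OF fD] clf_scaleC[OF fD])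
  then show "dual_star f \<in> dual_space" using * by (rule dual_spaceI)
  show "dual_norm (dual_star f) \<le> dual_norm f" by (rule dual_norm_le[OF *])
qed

lemma dual_star_dual_star: "dual_star (dual_star f) = f"
  by (simp add: dual_star_def cstar_cstar)

lemma bd_star_bound:
  assumes F: "F \<in> bidual_space" and f: "f \<in> dual_space"
  shows "cmod (bd_star F f) \<le> bidual_norm F * dual_norm f"
  using bidual_norm_bound[OF F dual_star_dual_space(1)[OF f]]
    mult_left_mono[OF dual_star_dual_space(2)[OF f] bidual_norm_nonneg[OF F]] f
  by (simp add: bd_star_def)

lemma bd_star_bidual_space:
  assumes F: "F \<in> bidual_space" shows "bd_star F \<in> bidual_space"
proof (rule bidual_spaceI)
  show "cmod (bd_star F f) \<le> bidual_norm F * dual_norm f" if "f \<in> dual_space" for f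
    using bd_star_bound[OF F that] .
  show "bd_star F (\<lambda>a. f a + g a) = bd_star F f + bd_star F g" if "f \<in> dual_space" "g \<in> dual_space" for f g
    using bidual_add[OF F dual_star_dual_space(1)[OF that(1)] dual_star_dual_space(1)[OF that(2)]] that
    by (simp add: bd_star_def dual_star_def dual_space_add)
  show "bd_star F (\<lambda>a. c * f a) = c * bd_star F f" if "f \<in> dual_space" for c f
    using bidual_scale[OF F dual_star_dual_space(1)[OF that], of "cnj c"] that
    by (simp add: bd_star_def dual_star_def dual_space_scale)
qed (simp add: bd_star_def)

lemma bd_embed_bidual_space: "bd_embed a \<in> bidual_space"
  by (rule bidual_spaceI[where K = "norm a"])
    (simp_all add: bd_embed_def dual_space_add dual_space_scale dual_norm_bound mult.commute)

text \<open>In the GNS picture \<open>F (\<lambda>x. g (cstar d * x))\<close> is the inner product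
  of \<open>F \<xi>\<close> with \<open>d \<xi>\<close>. The conjugate makes it linear in
  \<open>d\<close>, as the approximate Riesz representation requires.\<close>

lemma bidual_gns_conj:
  fixes g :: "'a::unital_cstar_algebra \<Rightarrow> complex"
  assumes g: "positive_functional g" and F: "F \<in> bidual_space"
  defines "k \<equiv> \<lambda>d. cnj (F (\<lambda>x. g (cstar d * x)))"
  shows "clinear_functional k" "cmod (k d) \<le> (bidual_norm F * gns_norm g 1) * gns_norm g d"
proof -
  note gD = pf_clf[OF g] and gd = pf_dual_space[OF g]
  show "clinear_functional k"
    unfolding clinear_functional_def k_def
    by (simp add: cstar_simps distrib_right mult_scaleC_left clf_add[OF gD] clf_scaleC[OF gD]
        bidual_add[OF F] bidual_scale[OF F] dual_mult_left(1)[OF gd])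
  have "dual_norm (\<lambda>x. g (cstar d * x)) \<le> gns_norm g d * gns_norm g 1"
    by (rule gns_bounded_dual_space(2)[OF g])
      (simp_all add: gD clf_mult_left pf_Cauchy_Schwarz[OF g] gns_norm_nonneg[OF g])
  from bidual_norm_bound_le[OF F dual_mult_left(1)[OF gd] this]
  show "cmod (k d) \<le> (bidual_norm F * gns_norm g 1) * gns_norm g d" by (simp add: k_def mult_ac)
qed

text \<open>In the GNS representation of \<open>g\<close> with cyclic vector \<open>\<xi>\<close>, the vector \<open>b \<xi>\<close> approximates
  \<open>F \<xi>\<close>.\<close>

lemma bidual_gns_approx:
  fixes g :: "'a::unital_cstar_algebra \<Rightarrow> complex"
  assumes g: "positive_functional g" and F: "F \<in> bidual_space" and \<epsilon>: "0 < \<epsilon>"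
  obtains b where "\<And>d. cmod (F (\<lambda>x. g (cstar d * x)) - g (cstar d * b)) \<le> \<epsilon> * gns_norm g d"
    "gns_norm g b \<le> bidual_norm F * gns_norm g 1 + \<epsilon>"
proof -
  define k where "k d = cnj (F (\<lambda>x. g (cstar d * x)))" for d
  have "0 \<le> bidual_norm F * gns_norm g 1" using bidual_norm_nonneg[OF F] gns_norm_nonneg[OF g] by simp
  then obtain b where b: "\<And>d. cmod (k d - g (cstar b * d)) \<le> \<epsilon> * gns_norm g d"
    "gns_norm g b \<le> bidual_norm F * gns_norm g 1 + \<epsilon>"
    using gns_approx[OF g bidual_gns_conj[OF g F] _ \<epsilon>] unfolding k_def by metis
  have "cmod (F (\<lambda>x. g (cstar d * x)) - g (cstar d * b)) = cmod (k d - g (cstar b * d))" for d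
  proof -
    have "k d - g (cstar b * d) = cnj (F (\<lambda>x. g (cstar d * x)) - g (cstar d * b))"
      by (simp add: k_def pf_cstar_swap[OF g, of b d])
    then show ?thesis by (simp only: complex_mod_cnj)
  qed
  with b show thesis by (intro that[of b]) simp_all
qed

lemma le_if_le_add_epsilon_mult:
  fixes x y M :: real
  assumes "\<And>\<epsilon>. 0 < \<epsilon> \<Longrightarrow> x \<le> y + \<epsilon> * M" "0 \<le> M" shows "x \<le> y"
proof (rule field_le_epsilon)
  fix e :: real assume e: "0 < e"
  have "e / (M + 1) * M \<le> e" using assms(2) e by (simp add: field_simps)
  with assms(1)[of "e / (M + 1)"] assms(2) e show "x \<le> y + e" by simp
qed

text \<open>The hypothesis tests \<open>F \<xi>\<close> against vectors \<open>d \<xi>\<close> only,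
  whereas \<open>k\<close> may correspond to a vector of the completion. So \<open>k\<close> is
  itself approximated by \<open>g (c* x)\<close> up to \<open>\<delta>\<close>; \<open>M\<close>
  collects the coefficients of \<open>\<delta>\<close> in the three errors, which then vanish in the
  limit.\<close>

lemma bidual_gns_bounded_approx:
  fixes g :: "'a::unital_cstar_algebra \<Rightarrow> complex"
  assumes g: "positive_functional g" and F: "F \<in> bidual_space"
    and b: "\<And>d. cmod (F (\<lambda>x. g (cstar d * x)) - g (cstar d * b)) \<le> \<epsilon> * gns_norm g d"
    and k: "clinear_functional k" and kb: "\<And>x. cmod (k x) \<le> C * gns_norm g x" and C: "0 \<le> C" and \<epsilon>: "0 \<le> \<epsilon>"
  shows "cmod (F k - k b) \<le> \<epsilon> * C"
proof -
  have kd: "k \<in> dual_space" by (rule gns_bounded_dual_space(1)[OF g k kb C])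
  define M where "M = bidual_norm F * gns_norm g 1 + \<epsilon> + gns_norm g b"
  have M: "0 \<le> M" unfolding M_def
    using \<epsilon> bidual_norm_nonneg[OF F] gns_norm_nonneg[OF g] by (intro add_nonneg_nonneg mult_nonneg_nonneg) auto
  have step: "cmod (F k - k b) \<le> \<epsilon> * C + \<delta> * M" if \<delta>: "0 < \<delta>" for \<delta>
  proof -
    obtain c where c: "\<And>x. cmod (k x - g (cstar c * x)) \<le> \<delta> * gns_norm g x" "gns_norm g c \<le> C + \<delta>"
      using gns_approx[OF g k kb C \<delta>] by metis
    have cd: "(\<lambda>x. g (cstar c * x)) \<in> dual_space" by (rule dual_mult_left[OF pf_dual_space[OF g]])
    have clf: "clinear_functional (\<lambda>x. k x - g (cstar c * x))"
      by (rule dual_spaceD[OF dual_space_diff[OF kd cd]])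
    have "dual_norm (\<lambda>x. k x - g (cstar c * x)) \<le> \<delta> * gns_norm g 1"
      using \<delta> by (intro gns_bounded_dual_space(2)[OF g clf c(1)]) simp
    with bidual_norm_bound[OF F dual_space_diff[OF kd cd]]
    have "cmod (F (\<lambda>x. k x - g (cstar c * x))) \<le> bidual_norm F * (\<delta> * gns_norm g 1)"
      using mult_left_mono[OF _ bidual_norm_nonneg[OF F]] order_trans by blast
    then have 1: "cmod (F k - F (\<lambda>x. g (cstar c * x))) \<le> \<delta> * (bidual_norm F * gns_norm g 1)"
      by (simp add: bidual_diff[OF F kd cd] mult_ac)
    have 2: "cmod (F (\<lambda>x. g (cstar c * x)) - g (cstar c * b)) \<le> \<epsilon> * (C + \<delta>)"
      using order_trans[OF b mult_left_mono[OF c(2) \<epsilon>]] .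
    have 3: "cmod (g (cstar c * b) - k b) \<le> \<delta> * gns_norm g b"
      using c(1)[of b] by (simp add: norm_minus_commute)
    have "cmod (F k - k b) \<le> cmod (F k - F (\<lambda>x. g (cstar c * x)))
        + cmod (F (\<lambda>x. g (cstar c * x)) - g (cstar c * b)) + cmod (g (cstar c * b) - k b)"
      using norm_triangle_ineq[of "F k - F (\<lambda>x. g (cstar c * x))" "F (\<lambda>x. g (cstar c * x)) - g (cstar c * b)"]
        norm_triangle_ineq[of "F k - g (cstar c * b)" "g (cstar c * b) - k b"] by simp
    with 1 2 3 show ?thesis by (simp add: M_def algebra_simps)
  qed
  show ?thesis using step M by (rule le_if_le_add_epsilon_mult)
qed

text \<open>A substitute for the polar decomposition of \<open>f\<close>: the dominating
  \<open>g\<close> plays the absolute value and \<open>c\<close> the partial isometry. It matters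
  that \<open>g\<close> is fixed before \<open>\<epsilon>\<close>.\<close>

lemma dual_approx_by_positive:
  fixes f :: "'a::unital_cstar_algebra \<Rightarrow> complex"
  assumes f: "f \<in> dual_space" and f1: "dual_norm f \<le> 1"
  obtains g where "positive_functional g" "Re (g 1) \<le> 1" "\<And>a. cmod (f a) \<le> gns_norm g a"
    "\<And>\<epsilon>. 0 < \<epsilon> \<Longrightarrow> \<exists>c. dual_norm (\<lambda>a. f a - g (cstar c * a)) \<le> \<epsilon> \<and> gns_norm g c \<le> 1 + \<epsilon>"
proof -
  have "cmod (f a) \<le> norm a" for a
    using dual_norm_bound[OF f, of a] mult_right_mono[OF f1, of "norm a"] by simp
  then obtain g where g: "positive_functional g" "Re (g 1) \<le> 1" "\<And>a. cmod (f a) \<le> gns_norm g a"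
    using dominating_positive_functional[OF dual_spaceD[OF f]] by metis
  have g1: "gns_norm g 1 \<le> 1" using g(2) by (simp add: gns_norm_def)
  have "\<exists>c. dual_norm (\<lambda>a. f a - g (cstar c * a)) \<le> \<epsilon> \<and> gns_norm g c \<le> 1 + \<epsilon>" if \<epsilon>: "0 < \<epsilon>" for \<epsilon>
  proof -
    obtain c where c: "\<And>x. cmod (f x - g (cstar c * x)) \<le> \<epsilon> * gns_norm g x" "gns_norm g c \<le> 1 + \<epsilon>"
      using gns_approx[OF g(1) dual_spaceD[OF f], of 1 \<epsilon>] g(3) \<epsilon> by auto
    have clf: "clinear_functional (\<lambda>x. f x - g (cstar c * x))"
      by (rule dual_spaceD[OF dual_space_diff[OF f dual_mult_left(1)[OF pf_dual_space[OF g(1)]]]])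
    have "dual_norm (\<lambda>x. f x - g (cstar c * x)) \<le> \<epsilon> * gns_norm g 1"
      using \<epsilon> by (intro gns_bounded_dual_space(2)[OF g(1) clf c(1)]) simp
    also have "\<dots> \<le> \<epsilon>" using g1 \<epsilon> by simp
    finally show ?thesis using c(2) by blast
  qed
  with g show thesis by (rule that)
qed

text \<open>Both Arens products agree, since every functional is nearly of the form \<open>g (c* \<cdot>)\<close>
  with \<open>g\<close> positive.\<close>

lemma arens_regular_positive:
  fixes g :: "'a::unital_cstar_algebra \<Rightarrow> complex"
  assumes g: "positive_functional g" and G: "G \<in> bidual_space" and F: "F \<in> bidual_space"
    and h_def: "h = (\<lambda>x. g (cstar c * x))"
  shows "G (bidual_act F h) = F (\<lambda>a. G (\<lambda>b. h (b * a)))"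
proof -
  have h: "h \<in> dual_space" unfolding h_def by (rule dual_mult_left[OF pf_dual_space[OF g]])
  define k where "k a = G (\<lambda>b. h (b * a))" for a
  define C where "C = bidual_norm G * gns_norm g c"
  have C: "0 \<le> C" unfolding C_def using bidual_norm_nonneg[OF G] gns_norm_nonneg[OF g] by simp
  have kD: "clinear_functional k" unfolding k_def by (rule dual_spaceD[OF right_act_dual_space(1)[OF G h]])
  have conj: "cstar (cstar y * c) = cstar c * y" for y by (simp add: cstar_simps)
  have gy: "gns_norm g (cstar y * c) \<le> norm y * gns_norm g c" for y
    using gns_norm_mult_le[OF g, of "cstar y" c] by simp
  have kb: "cmod (k a) \<le> C * gns_norm g a" for a
  proof -
    have "dual_norm (\<lambda>y. h (y * a)) \<le> gns_norm g c * gns_norm g a"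
    proof (rule dual_norm_le)
      fix y
      have "cmod (h (y * a)) = cmod (g (cstar (cstar y * c) * a))" by (simp add: h_def conj mult.assoc)
      also have "\<dots> \<le> gns_norm g (cstar y * c) * gns_norm g a" by (rule pf_Cauchy_Schwarz[OF g])
      also have "\<dots> \<le> norm y * gns_norm g c * gns_norm g a"
        by (rule mult_right_mono[OF gy gns_norm_nonneg[OF g]])
      finally show "cmod (h (y * a)) \<le> gns_norm g c * gns_norm g a * norm y" by (simp add: mult_ac)
    qed
    from bidual_norm_bound_le[OF G dual_mult_right(1)[OF h] this]
    show ?thesis by (simp add: k_def C_def mult.assoc)
  qed
  have main: "cmod (G (bidual_act F h) - F k) \<le> \<epsilon> * (2 * C)" if \<epsilon>: "0 < \<epsilon>" for \<epsilon>
  proof -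
    \<comment> \<open>One element \<open>b\<close> stands in for \<open>F\<close> on both sides,
      which then both become \<open>k b\<close>. For the left side the factor \<open>a\<close> is
      moved onto the test vector, \<open>c* a = (a* c)*\<close>, so the error stays proportional to
      the norm of \<open>a\<close>.\<close>
    obtain b where b: "\<And>d. cmod (F (\<lambda>x. g (cstar d * x)) - g (cstar d * b)) \<le> \<epsilon> * gns_norm g d"
      using bidual_gns_approx[OF g F \<epsilon>] by metis
    have 1: "cmod (F k - k b) \<le> \<epsilon> * C"
      using bidual_gns_bounded_approx[OF g F b kD kb C] \<epsilon> by simp
    have hb: "(\<lambda>a. h (a * b)) \<in> dual_space" by (rule dual_mult_right(1)[OF h])
    note Fh = bidual_act_dual_space(1)[OF F h]
    have "dual_norm (\<lambda>a. bidual_act F h a - h (a * b)) \<le> \<epsilon> * gns_norm g c"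
    proof (rule dual_norm_le)
      fix a
      have "bidual_act F h a - h (a * b) = F (\<lambda>x. g (cstar (cstar a * c) * x)) - g (cstar (cstar a * c) * b)"
        by (simp add: bidual_act_def dual_act_def h_def conj mult.assoc)
      then have "cmod (bidual_act F h a - h (a * b)) \<le> \<epsilon> * gns_norm g (cstar a * c)" using b by metis
      also have "\<dots> \<le> \<epsilon> * (norm a * gns_norm g c)" using gy \<epsilon> by simp
      finally show "cmod (bidual_act F h a - h (a * b)) \<le> \<epsilon> * gns_norm g c * norm a" by (simp add: mult_ac)
    qed
    from bidual_norm_bound_le[OF G dual_space_diff[OF Fh hb] this]
    have 2: "cmod (G (bidual_act F h) - k b) \<le> \<epsilon> * C"
      by (simp add: bidual_diff[OF G Fh hb] k_def C_def mult_ac)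
    show ?thesis
      using norm_triangle_ineq4[of "G (bidual_act F h) - k b" "F k - k b"] 1 2 by simp
  qed
  have "cmod (G (bidual_act F h) - F k) \<le> 0"
    by (rule le_if_le_add_epsilon_mult[of _ _ "2 * C"]) (use main C in auto)
  then show ?thesis unfolding k_def by simp
qed

text \<open>The defect \<open>D\<close> of the two products is linear, bounded in the dual norm and
  zero on functionals \<open>g (c* x)\<close> with \<open>g\<close> positive. After scaling into the
  unit ball, such functionals approximate \<open>h\<close> in norm.\<close>

theorem arens_regular:
  fixes h :: "'a::unital_cstar_algebra \<Rightarrow> complex"
  assumes G: "G \<in> bidual_space" and F: "F \<in> bidual_space" and h: "h \<in> dual_space"
  shows "G (bidual_act F h) = F (\<lambda>a. G (\<lambda>b. h (b * a)))"
proof -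
  define D where "D f = G (bidual_act F f) - F (\<lambda>a. G (\<lambda>b. f (b * a)))" for f
  define M where "M = 2 * (bidual_norm G * bidual_norm F)"
  have M: "0 \<le> M" unfolding M_def using bidual_norm_nonneg[OF G] bidual_norm_nonneg[OF F] by simp
  have D_bound: "cmod (D f) \<le> M * dual_norm f" if f: "f \<in> dual_space" for f
  proof -
    have "cmod (G (bidual_act F f)) \<le> bidual_norm G * (bidual_norm F * dual_norm f)"
      using bidual_norm_bound_le[OF G bidual_act_dual_space(1)[OF F f] bidual_act_dual_space(2)[OF F f]] .
    moreover have "cmod (F (\<lambda>a. G (\<lambda>b. f (b * a)))) \<le> bidual_norm F * (bidual_norm G * dual_norm f)"
      using bidual_norm_bound_le[OF F right_act_dual_space(1)[OF G f] right_act_dual_space(2)[OF G f]] .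
    ultimately show ?thesis
      unfolding D_def M_def using norm_triangle_ineq4[of "G (bidual_act F f)" "F (\<lambda>a. G (\<lambda>b. f (b * a)))"]
      by (simp add: mult_ac)
  qed
  have D_add: "D (\<lambda>a. f a + f' a) = D f + D f'" if f: "f \<in> dual_space" and f': "f' \<in> dual_space" for f f'
    unfolding D_def
    by (simp add: bidual_act_add[OF F f f'] bidual_add[OF G] bidual_add[OF F] bidual_act_dual_space[OF F] f f'
        dual_mult_right right_act_dual_space[OF G])
  have D_scale: "D (\<lambda>a. c * f a) = c * D f" if f: "f \<in> dual_space" for c f
    unfolding D_def
    by (simp add: bidual_act_scale[OF F f] bidual_scale[OF G] bidual_scale[OF F] bidual_act_dual_space[OF F] f
        dual_mult_right right_act_dual_space[OF G] right_diff_distrib)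
  define r where "r = dual_norm h + 1"
  have r: "0 < r" using dual_norm_nonneg[OF h] by (simp add: r_def)
  define f where "f a = of_real (1 / r) * h a" for a
  have f: "f \<in> dual_space" unfolding f_def by (rule dual_space_scale[OF h])
  have "dual_norm f \<le> cmod (of_real (1 / r)) * dual_norm h" unfolding f_def by (rule dual_norm_scale[OF h])
  also have "\<dots> \<le> 1" using r by (simp add: norm_divide r_def)
  finally have f1: "dual_norm f \<le> 1" .
  obtain g where g: "positive_functional g"
    "\<And>\<epsilon>. 0 < \<epsilon> \<Longrightarrow> \<exists>c. dual_norm (\<lambda>a. f a - g (cstar c * a)) \<le> \<epsilon>"
    using dual_approx_by_positive[OF f f1] by metis
  have "cmod (D f) \<le> 0"
  proof (rule le_if_le_add_epsilon_mult[OF _ M])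
    fix e :: real assume e: "0 < e"
    obtain c where c: "dual_norm (\<lambda>a. f a - g (cstar c * a)) \<le> e" using g(2)[OF e] by blast
    define p where "p a = g (cstar c * a)" for a
    have p: "p \<in> dual_space" unfolding p_def by (rule dual_mult_left(1)[OF pf_dual_space[OF g(1)]])
    have "D p = 0" unfolding D_def using arens_regular_positive[OF g(1) G F p_def[abs_def, THEN meta_eq_to_obj_eq]] by simp
    moreover have "D f = D (\<lambda>a. f a - p a) + D p"
      using D_add[OF dual_space_diff[OF f p] p] by simp
    ultimately show "cmod (D f) \<le> 0 + e * M"
      using order_trans[OF D_bound[OF dual_space_diff[OF f p]] mult_left_mono[OF c[folded p_def] M]]
      by (simp add: mult.commute)
  qed
  moreover have "D f = of_real (1 / r) * D h" unfolding f_def by (rule D_scale[OF h])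
  ultimately have "D h = 0" using r by simp
  then show ?thesis by (simp add: D_def)
qed

text \<open>The value \<open>(F* F) g\<close> is the squared length of \<open>F \<xi>\<close>,
  obtained as a limit of squared lengths of vectors \<open>b \<xi>\<close>. The third claim is
  Cauchy--Schwarz for \<open>c \<xi>\<close> and \<open>F \<xi>\<close>.\<close>

lemma bidual_gns_square:
  fixes g :: "'a::unital_cstar_algebra \<Rightarrow> complex"
  assumes g: "positive_functional g" and F: "F \<in> bidual_space"
  shows "(bd_star F \<star> F) g \<in> \<real>" "0 \<le> Re ((bd_star F \<star> F) g)"
    "cmod (F (\<lambda>x. g (cstar c * x))) \<le> gns_norm g c * sqrt (Re ((bd_star F \<star> F) g))"
proof -
  note gd = pf_dual_space[OF g]
  define v where "v = (bd_star F \<star> F) g"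
  define k where "k a = cnj (F (\<lambda>x. g (cstar a * x)))" for a
  define C where "C = bidual_norm F * gns_norm g 1"
  have C: "0 \<le> C" unfolding C_def using bidual_norm_nonneg[OF F] gns_norm_nonneg[OF g] by simp
  have v: "v = cnj (F k)"
    unfolding v_def k_def bd_mult_def bd_star_def dual_star_def bidual_act_def dual_act_def
    using gd bidual_act_dual_space(1)[OF F gd] by (simp add: bidual_act_def dual_act_def)
  have kD: "clinear_functional k" and kb: "cmod (k d) \<le> C * gns_norm g d" for d
    unfolding k_def C_def by (rule bidual_gns_conj[OF g F])+
  \<comment> \<open>The two errors below contribute \<open>C\<close> and \<open>C + 1\<close>; the
    second uses \<open>\<epsilon> \<le> 1\<close>, hence the restriction near 0 in the
    limits.\<close>
  define M where "M = 2 * C + 1"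
  have approx: "\<exists>b. (\<forall>d. cmod (F (\<lambda>x. g (cstar d * x)) - g (cstar d * b)) \<le> \<epsilon> * gns_norm g d)
      \<and> cmod (v - of_real ((gns_norm g b)\<^sup>2)) \<le> \<epsilon> * M" if \<epsilon>: "0 < \<epsilon>" "\<epsilon> \<le> 1" for \<epsilon>
  proof -
    obtain b where b: "\<And>d. cmod (F (\<lambda>x. g (cstar d * x)) - g (cstar d * b)) \<le> \<epsilon> * gns_norm g d"
      "gns_norm g b \<le> C + \<epsilon>" using bidual_gns_approx[OF g F \<epsilon>(1)] unfolding C_def by metis
    have 1: "cmod (F k - k b) \<le> \<epsilon> * C"
      using bidual_gns_bounded_approx[OF g F b(1) kD kb C] \<epsilon> by simp
    have "k b - of_real ((gns_norm g b)\<^sup>2) = cnj (F (\<lambda>x. g (cstar b * x)) - g (cstar b * b))"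
      by (simp add: k_def pf_square[OF g])
    then have "cmod (k b - of_real ((gns_norm g b)\<^sup>2)) \<le> \<epsilon> * gns_norm g b"
      using b(1)[of b] by (simp only: complex_mod_cnj)
    also have "\<dots> \<le> \<epsilon> * (C + 1)" using b(2) \<epsilon> by (intro mult_left_mono) auto
    finally have 2: "cmod (k b - of_real ((gns_norm g b)\<^sup>2)) \<le> \<epsilon> * (C + 1)" .
    have "v - of_real ((gns_norm g b)\<^sup>2) = cnj (F k - of_real ((gns_norm g b)\<^sup>2))" by (simp add: v)
    then have "cmod (v - of_real ((gns_norm g b)\<^sup>2)) = cmod (F k - of_real ((gns_norm g b)\<^sup>2))"
      by (simp only: complex_mod_cnj)
    also have "\<dots> \<le> cmod (F k - k b) + cmod (k b - of_real ((gns_norm g b)\<^sup>2))"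
      using norm_triangle_ineq[of "F k - k b" "k b - of_real ((gns_norm g b)\<^sup>2)"] by simp
    also have "\<dots> \<le> \<epsilon> * M" using 1 2 by (simp add: M_def algebra_simps)
    finally show ?thesis using b(1) by blast
  qed
  have small: "\<forall>\<^sub>F \<epsilon> in at_right 0. 0 < \<epsilon> \<and> \<epsilon> \<le> (1::real)"
    unfolding eventually_at_right_field by (rule exI[of _ 1]) auto
  have lim0: "((\<lambda>\<epsilon>. \<epsilon> * M) \<longlongrightarrow> 0 * M) (at_right 0)" by (intro tendsto_intros)
  have "\<bar>Im v\<bar> \<le> 0 * M"
  proof (rule tendsto_lowerbound[OF lim0])
    show "\<forall>\<^sub>F \<epsilon> in at_right 0. \<bar>Im v\<bar> \<le> \<epsilon> * M"
      using small
    proof eventually_elim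
      case (elim \<epsilon>)
      then obtain b where "cmod (v - of_real ((gns_norm g b)\<^sup>2)) \<le> \<epsilon> * M" using approx by metis
      with abs_Im_le_cmod[of "v - of_real ((gns_norm g b)\<^sup>2)"] show ?case by simp
    qed
  qed simp
  then have Im: "Im v = 0" by simp
  have "- Re v \<le> 0 * M"
  proof (rule tendsto_lowerbound[OF lim0])
    show "\<forall>\<^sub>F \<epsilon> in at_right 0. - Re v \<le> \<epsilon> * M"
      using small
    proof eventually_elim
      case (elim \<epsilon>)
      then obtain b where "cmod (v - of_real ((gns_norm g b)\<^sup>2)) \<le> \<epsilon> * M" using approx by metis
      then have "\<bar>Re v - (gns_norm g b)\<^sup>2\<bar> \<le> \<epsilon> * M"
        using abs_Re_le_cmod[of "v - of_real ((gns_norm g b)\<^sup>2)"] by simp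
      with zero_le_power2[of "gns_norm g b"] show ?case by linarith
    qed
  qed simp
  then have Re: "0 \<le> Re v" by simp
  have "((\<lambda>\<epsilon>. gns_norm g c * (sqrt (Re v + \<epsilon> * M) + \<epsilon>)) \<longlongrightarrow> gns_norm g c * (sqrt (Re v + 0 * M) + 0)) (at_right 0)"
    by (intro tendsto_intros)
  then have "cmod (F (\<lambda>x. g (cstar c * x))) \<le> gns_norm g c * (sqrt (Re v + 0 * M) + 0)"
  proof (rule tendsto_lowerbound)
    show "\<forall>\<^sub>F \<epsilon> in at_right 0. cmod (F (\<lambda>x. g (cstar c * x))) \<le> gns_norm g c * (sqrt (Re v + \<epsilon> * M) + \<epsilon>)"
      using small
    proof eventually_elim
      case (elim \<epsilon>)
      then obtain b where b: "cmod (F (\<lambda>x. g (cstar c * x)) - g (cstar c * b)) \<le> \<epsilon> * gns_norm g c"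
        "cmod (v - of_real ((gns_norm g b)\<^sup>2)) \<le> \<epsilon> * M" using approx by metis
      then have "(gns_norm g b)\<^sup>2 \<le> Re v + \<epsilon> * M"
        using abs_Re_le_cmod[of "v - of_real ((gns_norm g b)\<^sup>2)"] by simp
      then have "gns_norm g b \<le> sqrt (Re v + \<epsilon> * M)" by (rule real_le_rsqrt)
      then have "gns_norm g c * gns_norm g b \<le> gns_norm g c * sqrt (Re v + \<epsilon> * M)"
        using gns_norm_nonneg[OF g] by (rule mult_left_mono)
      moreover have "cmod (F (\<lambda>x. g (cstar c * x))) \<le> cmod (g (cstar c * b)) + \<epsilon> * gns_norm g c"
        using b(1) norm_triangle_sub[of "F (\<lambda>x. g (cstar c * x))" "g (cstar c * b)"] by linarith
      ultimately show ?case using pf_Cauchy_Schwarz[OF g, of c b] by (simp add: algebra_simps)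
    qed
  qed simp
  with Im Re show "(bd_star F \<star> F) g \<in> \<real>" "0 \<le> Re ((bd_star F \<star> F) g)"
    "cmod (F (\<lambda>x. g (cstar c * x))) \<le> gns_norm g c * sqrt (Re ((bd_star F \<star> F) g))"
    by (simp_all add: v_def complex_is_Real_iff)
qed

section \<open>The C*-identity and the involution of the bidual\<close>

lemma bd_star_norm_le:
  "F \<in> bidual_space \<Longrightarrow> bidual_norm (bd_star F) \<le> bidual_norm F"
  by (rule bidual_norm_le'[OF bd_star_bound bidual_norm_nonneg])

lemma bd_mult_norm_le:
  assumes "G \<in> bidual_space" "F \<in> bidual_space"
  shows "bidual_norm (G \<star> F) \<le> bidual_norm G * bidual_norm F"
  by (rule bidual_norm_le'[OF bd_mult_bound[OF assms] mult_nonneg_nonneg[OF bidual_norm_nonneg bidual_norm_nonneg]])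
    (use assms in auto)

text \<open>For the nontrivial inequality a functional \<open>f\<close> of the dual unit ball is
  nearly \<open>g (c* x)\<close> with \<open>c \<xi>\<close> of length nearly at most 1.
  Cauchy--Schwarz bounds \<open>|F f|\<close> by the root of \<open>(F* F) g\<close>, and
  \<open>g\<close> lies in the dual unit ball.\<close>

theorem bidual_cstar_identity:
  fixes F :: "'a::unital_cstar_algebra bidual"
  assumes F: "F \<in> bidual_space"
  shows "bidual_norm (bd_star F \<star> F) = (bidual_norm F)\<^sup>2"
proof (rule antisym)
  note Fs = bd_star_bidual_space[OF F]
  show "bidual_norm (bd_star F \<star> F) \<le> (bidual_norm F)\<^sup>2"
    using order_trans[OF bd_mult_norm_le[OF Fs F] mult_right_mono[OF bd_star_norm_le[OF F] bidual_norm_nonneg[OF F]]]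
    by (simp add: power2_eq_square)
  define N where "N = bidual_norm (bd_star F \<star> F)"
  note FF = bd_mult_bidual_space[OF Fs F]
  have N: "0 \<le> N" unfolding N_def by (rule bidual_norm_nonneg[OF FF])
  have "bidual_norm F \<le> sqrt N"
  proof (rule bidual_norm_le)
    fix f :: "'a \<Rightarrow> complex" assume f: "f \<in> dual_space" "dual_norm f \<le> 1"
    obtain g where g: "positive_functional g" "Re (g 1) \<le> 1"
      "\<And>\<epsilon>. 0 < \<epsilon> \<Longrightarrow> \<exists>c. dual_norm (\<lambda>a. f a - g (cstar c * a)) \<le> \<epsilon> \<and> gns_norm g c \<le> 1 + \<epsilon>"
      using dual_approx_by_positive[OF f] by metis
    note gd = pf_dual_space[OF g(1)]
    have "dual_norm g \<le> 1" using order_trans[OF dual_norm_le[OF pf_bound[OF g(1)]] g(2)] .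
    then have "cmod ((bd_star F \<star> F) g) \<le> N"
      using order_trans[OF bidual_norm_bound[OF FF gd] mult_left_mono[OF _ N[unfolded N_def]]]
      by (fastforce simp: N_def)
    then have gN: "Re ((bd_star F \<star> F) g) \<le> N" using complex_Re_le_cmod order_trans by blast
    have *: "cmod (F f) \<le> sqrt N + \<epsilon> * (bidual_norm F + sqrt N)" if \<epsilon>: "0 < \<epsilon>" for \<epsilon>
    proof -
      obtain c where c: "dual_norm (\<lambda>a. f a - g (cstar c * a)) \<le> \<epsilon>" "gns_norm g c \<le> 1 + \<epsilon>"
        using g(3)[OF \<epsilon>] by blast
      have cd: "(\<lambda>a. g (cstar c * a)) \<in> dual_space" by (rule dual_mult_left(1)[OF gd])
      have "cmod (F f - F (\<lambda>a. g (cstar c * a))) \<le> bidual_norm F * \<epsilon>"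
        using bidual_norm_bound_le[OF F dual_space_diff[OF f(1) cd] c(1)]
        by (simp add: bidual_diff[OF F f(1) cd])
      moreover have "cmod (F (\<lambda>a. g (cstar c * a))) \<le> (1 + \<epsilon>) * sqrt N"
      proof -
        have "gns_norm g c * sqrt (Re ((bd_star F \<star> F) g)) \<le> (1 + \<epsilon>) * sqrt N"
          using c(2) gN \<epsilon> bidual_gns_square(2)[OF g(1) F] by (intro mult_mono) auto
        then show ?thesis using bidual_gns_square(3)[OF g(1) F, of c] by linarith
      qed
      ultimately show ?thesis
        using norm_triangle_sub[of "F f" "F (\<lambda>a. g (cstar c * a))"] by (simp add: algebra_simps)
    qed
    have "0 \<le> bidual_norm F + sqrt N" using bidual_norm_nonneg[OF F] N by simp
    with * show "cmod (F f) \<le> sqrt N" by (rule le_if_le_add_epsilon_mult)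
  qed
  then have "(bidual_norm F)\<^sup>2 \<le> (sqrt N)\<^sup>2" using bidual_norm_nonneg[OF F] by (rule power_mono)
  then show "(bidual_norm F)\<^sup>2 \<le> bidual_norm (bd_star F \<star> F)" using N by (simp add: N_def)
qed

text \<open>The involution carries one Arens product to the other, so this rests on the agreement of
  the two.\<close>

lemma bd_star_mult:
  assumes G: "G \<in> bidual_space" and F: "F \<in> bidual_space"
  shows "bd_star (G \<star> F) = bd_star F \<star> bd_star G"
proof
  fix f
  show "bd_star (G \<star> F) f = (bd_star F \<star> bd_star G) f"
  proof (cases "f \<in> dual_space")
    case True
    note fs = dual_star_dual_space(1)[OF True]
    note Gf = bidual_act_dual_space(1)[OF bd_star_bidual_space[OF G] True]
    have step: "bd_star G (dual_act f (cstar a)) = cnj (G (\<lambda>b. dual_star f (b * a)))" for a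
      unfolding bd_star_def dual_act_def dual_star_def
      by (simp add: dual_mult_left(1)[OF True] cstar_mult)
    have "dual_star (bidual_act (bd_star G) f) = (\<lambda>a. G (\<lambda>b. dual_star f (b * a)))"
    proof
      fix a
      have "dual_star (bidual_act (bd_star G) f) a = cnj (bidual_act (bd_star G) f (cstar a))"
        by (simp add: dual_star_def)
      also have "\<dots> = G (\<lambda>b. dual_star f (b * a))"
        by (simp only: bidual_act_def step complex_cnj_cnj)
      finally show "dual_star (bidual_act (bd_star G) f) a = G (\<lambda>b. dual_star f (b * a))" .
    qed
    then have "(bd_star F \<star> bd_star G) f = cnj (F (\<lambda>a. G (\<lambda>b. dual_star f (b * a))))"
      using True Gf by (simp add: bd_mult_def bd_star_def[of F])
    also have "\<dots> = cnj (G (bidual_act F (dual_star f)))" by (simp add: arens_regular[OF G F fs])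
    finally show ?thesis using True fs by (simp add: bd_star_def bd_mult_def)
  qed (simp add: bd_star_def bd_mult_def)
qed

lemma bd_star_bd_star: "F \<in> bidual_space \<Longrightarrow> bd_star (bd_star F) = F"
  by (rule ext) (simp add: bd_star_def dual_star_dual_space dual_star_dual_star bidual_outside)

lemma bidual_space_lincomb:
  assumes F: "F \<in> bidual_space" and G: "G \<in> bidual_space"
  shows "(\<lambda>f. c * F f + d * G f) \<in> bidual_space"
proof (rule bidual_spaceI)
  show "cmod (c * F f + d * G f) \<le> (cmod c * bidual_norm F + cmod d * bidual_norm G) * dual_norm f"
    if f: "f \<in> dual_space" for f
  proof -
    have "cmod (c * F f + d * G f) \<le> cmod c * cmod (F f) + cmod d * cmod (G f)"
      using norm_triangle_ineq[of "c * F f" "d * G f"] by (simp add: norm_mult)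
    also have "\<dots> \<le> cmod c * (bidual_norm F * dual_norm f) + cmod d * (bidual_norm G * dual_norm f)"
      by (intro add_mono mult_left_mono bidual_norm_bound assms f) auto
    finally show ?thesis by (simp add: algebra_simps)
  qed
qed (simp_all add: bidual_add[OF F] bidual_add[OF G] bidual_scale[OF F] bidual_scale[OF G]
    bidual_outside[OF F] bidual_outside[OF G] algebra_simps)

lemma zero_bidual_space: "(\<lambda>_. 0) \<in> bidual_space"
  using bidual_space_lincomb[OF bd_embed_bidual_space bd_embed_bidual_space, of 0 0 0 0] by simp

subsection \<open>The bidual as a C*-algebra\<close>

text \<open>A separate type is needed to make the bidual an instance of the class, and thereby to
  apply the order and GNS results to it.\<close>

typedef (overloaded) 'a bd = "bidual_space :: 'a::unital_cstar_algebra bidual set"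
  morphisms bd_eval Abs_bd
  using bd_embed_bidual_space by blast

lemma bd_eval_bidual_space [simp]: "bd_eval x \<in> bidual_space"
  by (rule bd_eval)

lemma bd_eqI: "(\<And>f. f \<in> dual_space \<Longrightarrow> bd_eval x f = bd_eval y f) \<Longrightarrow> x = y"
  by (metis bd_eval_bidual_space bd_eval_inject bidual_outside ext)

definition bd_scale :: "complex \<Rightarrow> 'a::unital_cstar_algebra bd \<Rightarrow> 'a bd" where
  "bd_scale c x = Abs_bd (\<lambda>f. c * bd_eval x f)"

lemma eval_bd_scale: "bd_eval (bd_scale c x) f = c * bd_eval x f"
  using bidual_space_lincomb[OF bd_eval bd_eval, of c x 0 x] by (simp add: bd_scale_def Abs_bd_inverse)

instantiation bd :: (unital_cstar_algebra) real_normed_algebra_1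
begin

definition zero_bd :: "'a bd" where "0 = Abs_bd (\<lambda>_. 0)"
definition one_bd :: "'a bd" where "1 = Abs_bd (bd_embed 1)"
definition plus_bd :: "'a bd \<Rightarrow> 'a bd \<Rightarrow> 'a bd" where
  "x + y = Abs_bd (\<lambda>f. bd_eval x f + bd_eval y f)"
definition minus_bd :: "'a bd \<Rightarrow> 'a bd \<Rightarrow> 'a bd" where
  "x - y = Abs_bd (\<lambda>f. bd_eval x f - bd_eval y f)"
definition uminus_bd :: "'a bd \<Rightarrow> 'a bd" where "- x = Abs_bd (\<lambda>f. - bd_eval x f)"
definition times_bd :: "'a bd \<Rightarrow> 'a bd \<Rightarrow> 'a bd" where "x * y = Abs_bd (bd_eval x \<star> bd_eval y)"
definition scaleR_bd :: "real \<Rightarrow> 'a bd \<Rightarrow> 'a bd" where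
  "scaleR r x = bd_scale (of_real r) x"
definition norm_bd :: "'a bd \<Rightarrow> real" where "norm x = bidual_norm (bd_eval x)"
definition dist_bd :: "'a bd \<Rightarrow> 'a bd \<Rightarrow> real" where "dist_bd x y = norm (x - y)"
definition sgn_bd :: "'a bd \<Rightarrow> 'a bd" where "sgn_bd x = inverse (norm x) *\<^sub>R x"
definition uniformity_bd :: "('a bd \<times> 'a bd) filter" where
  "uniformity_bd = (INF e\<in>{0 <..}. principal {(x, y). dist x y < e})"
definition open_bd :: "'a bd set \<Rightarrow> bool" where
  "open_bd U = (\<forall>x\<in>U. eventually (\<lambda>(x', y). x' = x \<longrightarrow> y \<in> U) uniformity)"

lemma eval_zero: "bd_eval (0 :: 'a bd) f = 0"
  by (simp add: zero_bd_def Abs_bd_inverse zero_bidual_space)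
lemma eval_one: "f \<in> dual_space \<Longrightarrow> bd_eval (1 :: 'a bd) f = f 1"
  by (simp add: one_bd_def Abs_bd_inverse bd_embed_bidual_space) (simp add: bd_embed_def)
lemma eval_add: "bd_eval (x + y :: 'a bd) f = bd_eval x f + bd_eval y f"
  using bidual_space_lincomb[OF bd_eval bd_eval, of 1 x 1 y] by (simp add: plus_bd_def Abs_bd_inverse)
lemma eval_diff: "bd_eval (x - y :: 'a bd) f = bd_eval x f - bd_eval y f"
  using bidual_space_lincomb[OF bd_eval bd_eval, of 1 x "-1" y] by (simp add: minus_bd_def Abs_bd_inverse)
lemma eval_minus: "bd_eval (- x :: 'a bd) f = - bd_eval x f"
  using bidual_space_lincomb[OF bd_eval bd_eval, of "-1" x 0 x] by (simp add: uminus_bd_def Abs_bd_inverse)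
lemma eval_scaleR: "bd_eval (r *\<^sub>R x :: 'a bd) f = of_real r * bd_eval x f"
  by (simp add: scaleR_bd_def eval_bd_scale)
lemma eval_mult: "bd_eval (x * y :: 'a bd) = bd_eval x \<star> bd_eval y"
  by (simp add: times_bd_def Abs_bd_inverse bd_mult_bidual_space)

lemmas eval_simps = eval_zero eval_one eval_add eval_diff eval_minus eval_scaleR eval_bd_scale

lemma eval_mult_dual: "f \<in> dual_space \<Longrightarrow> bd_eval (x * y :: 'a bd) f = bd_eval x (bidual_act (bd_eval y) f)"
  by (simp add: eval_mult bd_mult_def)

lemma mult_bd_scale_right: "x * bd_scale c y = bd_scale c (x * y :: 'a bd)"
proof (rule bd_eqI)
  fix f :: "'a \<Rightarrow> complex" assume f: "f \<in> dual_space"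
  have "bidual_act (bd_eval (bd_scale c y)) f = (\<lambda>a. c * bidual_act (bd_eval y) f a)"
    by (simp add: bidual_act_def eval_bd_scale)
  then show "bd_eval (x * bd_scale c y) f = bd_eval (bd_scale c (x * y)) f"
    using f by (simp add: eval_mult_dual eval_bd_scale bidual_scale bidual_act_dual_space)
qed

lemma eval_bound: "f \<in> dual_space \<Longrightarrow> cmod (bd_eval (x :: 'a bd) f) \<le> norm x * dual_norm f"
  by (simp add: norm_bd_def bidual_norm_bound)

lemma norm_bd_le:
  "(\<And>f. f \<in> dual_space \<Longrightarrow> dual_norm f \<le> 1 \<Longrightarrow> cmod (bd_eval (x :: 'a bd) f) \<le> K) \<Longrightarrow> norm x \<le> K"
  unfolding norm_bd_def by (rule bidual_norm_le)

lemma norm_bd_nonneg: "0 \<le> norm (x :: 'a bd)"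
  by (simp add: norm_bd_def bidual_norm_nonneg)

lemma eval_bound_one: "f \<in> dual_space \<Longrightarrow> dual_norm f \<le> 1 \<Longrightarrow> cmod (bd_eval (x :: 'a bd) f) \<le> norm x"
  using eval_bound[of f x] mult_left_mono[of "dual_norm f" 1 "norm x"] norm_bd_nonneg[of x] by simp

lemma norm_bd_scale: "norm (bd_scale c x :: 'a bd) = cmod c * norm x"
proof -
  have le: "norm (bd_scale c x :: 'a bd) \<le> cmod c * norm x" for c x
    by (rule norm_bd_le) (simp add: eval_bd_scale norm_mult mult_left_mono eval_bound_one)
  show ?thesis
  proof (cases "c = 0")
    case True then show ?thesis using le[of 0 x] norm_bd_nonneg[of "bd_scale 0 x"] by simp
  next
    case False
    have "x = bd_scale (inverse c) (bd_scale c x)"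
      by (rule bd_eqI) (use False in \<open>simp add: eval_bd_scale\<close>)
    then have "norm x \<le> cmod (inverse c) * norm (bd_scale c x)" using le by metis
    then have "cmod c * norm x \<le> norm (bd_scale c x)" using False by (simp add: norm_divide field_simps)
    with le[of c x] show ?thesis by simp
  qed
qed

lemma norm_triangle_bd: "norm (x + y :: 'a bd) \<le> norm x + norm y"
  by (rule norm_bd_le)
    (auto simp: eval_add intro!: order_trans[OF norm_triangle_ineq] add_mono eval_bound_one)

lemma norm_bd_zero_iff: "norm (x :: 'a bd) = 0 \<longleftrightarrow> x = 0"
proof
  assume "norm x = 0"
  then show "x = 0" using eval_bound[of _ x] by (intro bd_eqI) (simp add: eval_zero)
next
  assume "x = 0"
  then have "norm x \<le> 0" by (intro norm_bd_le) (simp add: eval_zero)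
  then show "norm x = 0" using norm_bd_nonneg[of x] by simp
qed

instance
proof
  fix x y z :: "'a bd" and a b :: real and U :: "'a bd set"
  show "x + y + z = x + (y + z)" by (rule bd_eqI) (simp add: eval_simps)
  show "x + y = y + x" by (rule bd_eqI) (simp add: eval_simps)
  show "0 + x = x" by (rule bd_eqI) (simp add: eval_simps)
  show "- x + x = 0" by (rule bd_eqI) (simp add: eval_simps)
  show "x - y = x + - y" by (rule bd_eqI) (simp add: eval_simps)
  show "a *\<^sub>R (x + y) = a *\<^sub>R x + a *\<^sub>R y" by (rule bd_eqI) (simp add: eval_simps algebra_simps)
  show "(a + b) *\<^sub>R x = a *\<^sub>R x + b *\<^sub>R x" by (rule bd_eqI) (simp add: eval_simps algebra_simps)
  show "a *\<^sub>R b *\<^sub>R x = (a * b) *\<^sub>R x" by (rule bd_eqI) (simp add: eval_simps)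
  show "1 *\<^sub>R x = x" by (rule bd_eqI) (simp add: eval_simps)
  show "x * y * z = x * (y * z)"
    by (simp add: bd_eval_inject[symmetric] eval_mult bd_mult_assoc)
  show "(x + y) * z = x * z + y * z" by (rule bd_eqI) (simp add: eval_mult_dual eval_add)
  show "x * (y + z) = x * y + x * z"
  proof (rule bd_eqI)
    fix f :: "'a \<Rightarrow> complex" assume f: "f \<in> dual_space"
    have "bidual_act (bd_eval (y + z)) f = (\<lambda>a. bidual_act (bd_eval y) f a + bidual_act (bd_eval z) f a)"
      by (simp add: bidual_act_def eval_add)
    then show "bd_eval (x * (y + z)) f = bd_eval (x * y + x * z) f"
      using f by (simp add: eval_mult_dual eval_add bidual_add bidual_act_dual_space)
  qed
  show "a *\<^sub>R x * y = a *\<^sub>R (x * y)" by (rule bd_eqI) (simp add: eval_mult_dual eval_scaleR)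
  show "x * a *\<^sub>R y = a *\<^sub>R (x * y)"
    by (simp add: scaleR_bd_def mult_bd_scale_right)
  show "1 * x = x"
    by (rule bd_eqI) (simp add: eval_mult_dual eval_one bidual_act_dual_space, simp add: bidual_act_def dual_act_def)
  show "x * 1 = x"
    by (rule bd_eqI) (simp add: eval_mult_dual bidual_act_def[of "bd_eval 1"] eval_one dual_act_def dual_mult_left)
  obtain f0 :: "'a \<Rightarrow> complex" where f0: "clinear_functional f0" "\<And>a. cmod (f0 a) \<le> norm a" "f0 1 = 1"
    using norming_functional_one by metis
  have f0d: "f0 \<in> dual_space" "dual_norm f0 \<le> 1"
    using dual_spaceI[of f0 1] dual_norm_le[of f0 1] f0 by auto
  show "(0 :: 'a bd) \<noteq> 1"
  proof
    assume "(0 :: 'a bd) = 1"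
    then have "bd_eval (0 :: 'a bd) f0 = bd_eval 1 f0" by simp
    then show False using f0 f0d by (simp add: eval_zero eval_one)
  qed
  show "norm (1 :: 'a bd) = 1"
  proof (rule antisym)
    show "norm (1 :: 'a bd) \<le> 1"
    proof (rule norm_bd_le)
      fix f :: "'a \<Rightarrow> complex" assume "f \<in> dual_space" "dual_norm f \<le> 1"
      then show "cmod (bd_eval (1 :: 'a bd) f) \<le> 1" using dual_norm_bound[of f 1] by (simp add: eval_one)
    qed
    show "1 \<le> norm (1 :: 'a bd)" using eval_bound_one[OF f0d, of 1] f0 f0d by (simp add: eval_one)
  qed
  show "norm (x * y) \<le> norm x * norm y" by (simp add: norm_bd_def eval_mult bd_mult_norm_le)
  show "dist x y = norm (x - y)" by (rule dist_bd_def)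
  show "sgn x = inverse (norm x) *\<^sub>R x" by (rule sgn_bd_def)
  show "uniformity = (INF e\<in>{0 <..}. principal {(x, y). dist (x :: 'a bd) y < e})" by (rule uniformity_bd_def)
  show "open U = (\<forall>x\<in>U. \<forall>\<^sub>F (x', y) in uniformity. x' = x \<longrightarrow> y \<in> U)" by (rule open_bd_def)
  show "norm x = 0 \<longleftrightarrow> x = 0" by (rule norm_bd_zero_iff)
  show "norm (x + y) \<le> norm x + norm y" by (rule norm_triangle_bd)
  show "norm (a *\<^sub>R x) = \<bar>a\<bar> * norm x"
    using norm_bd_scale[of "of_real a" x] by (simp add: scaleR_bd_def)
qed

end

text \<open>Values at a fixed functional form a Cauchy sequence of complex numbers. The convergence
  is uniform relative to the dual norm, so the pointwise limit is bounded and is the limit in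
  norm.\<close>

lemma Cauchy_limit_bd:
  fixes X :: "nat \<Rightarrow> 'a::unital_cstar_algebra bd"
  assumes C: "\<And>e. 0 < e \<Longrightarrow> \<exists>N. \<forall>m\<ge>N. \<forall>n\<ge>N. norm (X m - X n) < e"
  obtains L where "\<And>e. 0 < e \<Longrightarrow> \<exists>N. \<forall>n\<ge>N. norm (X n - L) \<le> e"
proof -
  have close: "cmod (bd_eval (X m) f - bd_eval (X n) f) \<le> norm (X m - X n) * dual_norm f"
    if "f \<in> dual_space" for m n f using eval_bound[OF that, of "X m - X n"] by (simp add: eval_diff)
  have "Cauchy (\<lambda>n. bd_eval (X n) f)" if f: "f \<in> dual_space" for f
  proof (rule CauchyI)
    fix e :: real assume e: "0 < e"
    define d where "d = dual_norm f + 1"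
    have d: "0 < d" using dual_norm_nonneg[OF f] by (simp add: d_def)
    obtain N where N: "\<And>m n. m \<ge> N \<Longrightarrow> n \<ge> N \<Longrightarrow> norm (X m - X n) < e / d" using C[of "e / d"] e d by auto
    have "cmod (bd_eval (X m) f - bd_eval (X n) f) < e" if "m \<ge> N" "n \<ge> N" for m n
    proof -
      have "norm (X m - X n) * dual_norm f \<le> norm (X m - X n) * d"
        by (intro mult_left_mono) (auto simp: d_def)
      also have "\<dots> < e" using N[OF that] d by (simp add: field_simps)
      finally show ?thesis using close[OF f, of m n] by linarith
    qed
    then show "\<exists>M. \<forall>m\<ge>M. \<forall>n\<ge>M. norm (bd_eval (X m) f - bd_eval (X n) f) < e" by auto
  qed
  then have "\<exists>l. (\<lambda>n. bd_eval (X n) f) \<longlonglongrightarrow> l" for f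
    by (cases "f \<in> dual_space") (auto simp: bidual_outside Cauchy_convergent_iff convergent_def)
  then obtain l where l: "\<And>f. (\<lambda>n. bd_eval (X n) f) \<longlonglongrightarrow> l f" by metis
  have near: "\<exists>N. \<forall>n\<ge>N. \<forall>f\<in>dual_space. cmod (bd_eval (X n) f - l f) \<le> e * dual_norm f" if e: "0 < e" for e
  proof -
    obtain N where N: "\<And>m n. m \<ge> N \<Longrightarrow> n \<ge> N \<Longrightarrow> norm (X m - X n) < e" using C[OF e] by auto
    have "cmod (bd_eval (X n) f - l f) \<le> e * dual_norm f" if n: "n \<ge> N" and f: "f \<in> dual_space" for n f
    proof (rule tendsto_upperbound)
      show "(\<lambda>m. cmod (bd_eval (X n) f - bd_eval (X m) f)) \<longlonglongrightarrow> cmod (bd_eval (X n) f - l f)"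
        by (intro tendsto_intros l)
      have "cmod (bd_eval (X n) f - bd_eval (X m) f) \<le> e * dual_norm f" if "m \<ge> N" for m
        using close[OF f, of n m] mult_right_mono[OF less_imp_le[OF N[OF n that]] dual_norm_nonneg[OF f]]
        by linarith
      then show "\<forall>\<^sub>F m in sequentially. cmod (bd_eval (X n) f - bd_eval (X m) f) \<le> e * dual_norm f"
        by (auto simp: eventually_sequentially)
    qed simp
    then show ?thesis by blast
  qed
  obtain n0 where n0: "\<And>f. f \<in> dual_space \<Longrightarrow> cmod (bd_eval (X n0) f - l f) \<le> dual_norm f"
    using near[of 1] by auto
  have lB: "l \<in> bidual_space"
  proof (rule bidual_spaceI)
    show "l (\<lambda>a. f a + g a) = l f + l g" if "f \<in> dual_space" "g \<in> dual_space" for f g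
      using LIMSEQ_unique[OF l, of "\<lambda>a. f a + g a"] tendsto_add[OF l l, of f g] that by (simp add: bidual_add)
    show "l (\<lambda>a. c * f a) = c * l f" if "f \<in> dual_space" for c f
      using LIMSEQ_unique[OF l, of "\<lambda>a. c * f a"] tendsto_mult_left[OF l, of c f] that by (simp add: bidual_scale)
    show "cmod (l f) \<le> (norm (X n0) + 1) * dual_norm f" if "f \<in> dual_space" for f
      using n0[OF that] eval_bound[OF that, of "X n0"] norm_triangle_sub[of "l f" "bd_eval (X n0) f"]
      by (simp add: algebra_simps norm_minus_commute)
    show "l f = 0" if "f \<notin> dual_space" for f
      using LIMSEQ_unique[OF l, of f 0] that by (simp add: bidual_outside)
  qed
  show thesis
  proof (rule that[of "Abs_bd l"])
    fix e :: real assume e: "0 < e"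
    obtain N where N: "\<And>n f. n \<ge> N \<Longrightarrow> f \<in> dual_space \<Longrightarrow> cmod (bd_eval (X n) f - l f) \<le> e * dual_norm f"
      using near[OF e] by auto
    have "norm (X n - Abs_bd l) \<le> e" if "n \<ge> N" for n
    proof (rule norm_bd_le)
      fix f :: "'a \<Rightarrow> complex" assume f: "f \<in> dual_space" "dual_norm f \<le> 1"
      have "e * dual_norm f \<le> e" using f e by simp
      with N[OF that f(1)] show "cmod (bd_eval (X n - Abs_bd l) f) \<le> e"
        by (simp add: eval_diff Abs_bd_inverse[OF lB])
    qed
    then show "\<exists>N. \<forall>n\<ge>N. norm (X n - Abs_bd l) \<le> e" by blast
  qed
qed

instance bd :: (unital_cstar_algebra) banach
proof
  fix X :: "nat \<Rightarrow> 'a bd" assume "Cauchy X"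
  then have "\<exists>N. \<forall>m\<ge>N. \<forall>n\<ge>N. norm (X m - X n) < e" if "0 < e" for e
    using that by (auto simp: Cauchy_def dist_norm)
  then obtain L where L: "\<And>e. 0 < e \<Longrightarrow> \<exists>N. \<forall>n\<ge>N. norm (X n - L) \<le> e"
    using Cauchy_limit_bd[of X] by blast
  have "X \<longlonglongrightarrow> L"
  proof (rule LIMSEQ_I)
    fix e :: real assume e: "0 < e"
    then obtain N where N: "\<And>n. n \<ge> N \<Longrightarrow> norm (X n - L) \<le> e / 2" using L[of "e / 2"] by auto
    have "norm (X n - L) < e" if "n \<ge> N" for n using N[OF that] e by linarith
    then show "\<exists>N. \<forall>n\<ge>N. norm (X n - L) < e" by blast
  qed
  then show "convergent X" by (rule convergentI)
qed

instantiation bd :: (unital_cstar_algebra) unital_cstar_algebra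
begin

definition scaleC_bd :: "complex \<Rightarrow> 'a bd \<Rightarrow> 'a bd" where "scaleC c x = bd_scale c x"
definition cstar_bd :: "'a bd \<Rightarrow> 'a bd" where "cstar x = Abs_bd (bd_star (bd_eval x))"

lemma eval_scaleC: "bd_eval (scaleC c x :: 'a bd) f = c * bd_eval x f"
  by (simp add: scaleC_bd_def eval_bd_scale)
lemma eval_cstar: "bd_eval (cstar x :: 'a bd) = bd_star (bd_eval x)"
  by (simp add: cstar_bd_def Abs_bd_inverse bd_star_bidual_space)

instance
proof
  fix x y :: "'a bd" and a :: real and c d :: complex
  show "scaleC c (x + y) = scaleC c x + scaleC c y" by (rule bd_eqI) (simp add: eval_simps eval_scaleC algebra_simps)
  show "scaleC (c + d) x = scaleC c x + scaleC d x" by (rule bd_eqI) (simp add: eval_simps eval_scaleC algebra_simps)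
  show "scaleC c (scaleC d x) = scaleC (c * d) x" by (rule bd_eqI) (simp add: eval_scaleC)
  show "scaleC (complex_of_real a) x = a *\<^sub>R x" by (simp add: scaleC_bd_def scaleR_bd_def)
  show "norm (scaleC c x) = cmod c * norm x" by (simp add: scaleC_bd_def norm_bd_scale)
  show "scaleC c x * y = scaleC c (x * y)" by (rule bd_eqI) (simp add: eval_mult_dual eval_scaleC)
  show "x * scaleC c y = scaleC c (x * y)" by (simp add: scaleC_bd_def mult_bd_scale_right)
  show "cstar (cstar x) = x" by (simp add: bd_eval_inject[symmetric] eval_cstar bd_star_bd_star)
  show "cstar (x + y) = cstar x + cstar y"
    by (rule bd_eqI) (simp add: eval_cstar eval_add bd_star_def)
  show "cstar (x * y) = cstar y * cstar x"
    by (simp add: bd_eval_inject[symmetric] eval_cstar eval_mult bd_star_mult)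
  show "cstar (scaleC c x) = scaleC (cnj c) (cstar x)"
    by (rule bd_eqI) (simp add: eval_cstar eval_scaleC bd_star_def)
  show "norm (cstar x * x) = (norm x)\<^sup>2"
    by (simp add: norm_bd_def eval_cstar eval_mult bidual_cstar_identity)
qed

end

subsection \<open>Weak-* limits in the bidual\<close>

definition bd_of :: "'a::unital_cstar_algebra \<Rightarrow> 'a bd" where
  "bd_of a = Abs_bd (bd_embed a)"

lemma eval_bd_of: "bd_eval (bd_of a) = bd_embed a"
  by (simp add: bd_of_def Abs_bd_inverse bd_embed_bidual_space)

lemma eval_bd_of_dual: "f \<in> dual_space \<Longrightarrow> bd_eval (bd_of a) f = f a"
  by (simp add: eval_bd_of bd_embed_def)

lemma bd_of_one [simp]: "bd_of 1 = 1"
  by (simp add: bd_of_def one_bd_def)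

lemma bd_of_add: "bd_of (a + b) = bd_of a + bd_of b"
  and bd_of_diff: "bd_of (a - b) = bd_of a - bd_of b"
  by (rule bd_eqI; simp add: eval_bd_of_dual eval_simps eval_scaleC clf_simps[OF dual_spaceD])+

lemma bd_of_mult: "bd_of (a * b) = bd_of a * bd_of b"
  by (rule bd_eqI)
    (simp add: eval_bd_of_dual eval_mult_dual bidual_act_dual_space,
      simp add: bidual_act_def dual_act_def eval_bd_of_dual dual_mult_left)

lemma bd_of_cstar: "bd_of (cstar a) = cstar (bd_of a)"
  by (rule bd_eqI)
    (simp add: eval_bd_of_dual eval_cstar bd_star_def dual_star_dual_space, simp add: dual_star_def)

lemma norm_bd_of_le: "norm (bd_of a) \<le> norm a"
proof (rule norm_bd_le)
  fix f :: "'a \<Rightarrow> complex" assume f: "f \<in> dual_space" "dual_norm f \<le> 1"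
  show "cmod (bd_eval (bd_of a) f) \<le> norm a"
    using dual_norm_bound[OF f(1), of a] mult_right_mono[OF f(2), of "norm a"]
    by (simp add: eval_bd_of_dual f(1))
qed

text \<open>Arens regularity in the form needed for limits: for fixed \<open>x\<close> the product
  is \<open>y\<close> evaluated at a functional that does not depend on \<open>y\<close>. Hence
  multiplication from the left is weak-* continuous.\<close>

lemma eval_mult_right:
  assumes "f \<in> dual_space"
  shows "bd_eval (x * y) f = bd_eval y (\<lambda>a. bd_eval x (\<lambda>b. f (b * a)))"
  using arens_regular[OF bd_eval bd_eval assms] assms by (simp add: eval_mult_dual)

text \<open>Both one-sided multiplications act on the dual space, so a two-sided compression of an
  extended functional is again an extended functional. The compressed state of the main proof is
  obtained in this way.\<close>

lemma bd_compress:
  assumes f: "f \<in> dual_space"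
  obtains f' where "f' \<in> dual_space" "\<And>y. bd_eval (u * y * v) f = bd_eval y f'"
proof
  define f1 where "f1 = (\<lambda>a. bd_eval u (\<lambda>b. f (b * a)))"
  have f1: "f1 \<in> dual_space" unfolding f1_def by (rule right_act_dual_space(1)[OF bd_eval f])
  show "bidual_act (bd_eval v) f1 \<in> dual_space" by (rule bidual_act_dual_space(1)[OF bd_eval f1])
  show "bd_eval (u * y * v) f = bd_eval y (bidual_act (bd_eval v) f1)" for y
    using eval_mult_right[OF f, of u "y * v"] eval_mult_dual[OF f1, of y v]
    by (simp add: mult.assoc f1_def)
qed

lemma positive_functional_ext:
  assumes "positive_functional f" shows "positive_functional (\<lambda>x. bd_eval x f)"
  using bidual_gns_square[OF assms bd_eval]
  by (simp add: positive_functional_def clinear_functional_def eval_add eval_scaleC eval_mult eval_cstar)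

definition weak_star_lim :: "'a::unital_cstar_algebra bd filter \<Rightarrow> 'a bd \<Rightarrow> bool" where
  "weak_star_lim \<F> q \<longleftrightarrow> \<F> \<noteq> bot \<and> (\<forall>f\<in>dual_space. ((\<lambda>x. bd_eval x f) \<longlongrightarrow> bd_eval q f) \<F>)"

lemma weak_star_limD:
  "weak_star_lim \<F> q \<Longrightarrow> f \<in> dual_space \<Longrightarrow> ((\<lambda>x. bd_eval x f) \<longlongrightarrow> bd_eval q f) \<F>"
  by (simp add: weak_star_lim_def)

lemma weak_star_lim_mult:
  assumes "weak_star_lim \<F> q" "f \<in> dual_space"
  shows "((\<lambda>x. bd_eval (y * x) f) \<longlongrightarrow> bd_eval (y * q) f) \<F>"
  using weak_star_limD[OF assms(1) right_act_dual_space(1)[OF bd_eval assms(2)]]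
  by (simp add: eval_mult_right[OF assms(2)])

text \<open>Banach--Alaoglu for filters: Tychonoff's theorem gives a cluster point among all complex
  functions on functionals, and linearity passes to it.\<close>

lemma weak_star_compact:
  fixes \<F> :: "'a::unital_cstar_algebra bd filter"
  assumes nb: "\<F> \<noteq> bot" and bounded: "\<forall>\<^sub>F x in \<F>. norm x \<le> 1"
  obtains \<G> q where "\<G> \<le> \<F>" "weak_star_lim \<G> q"
proof -
  \<comment> \<open>Radius 0 outside the dual space forces the cluster point to vanish there, as the
    encoding of the bidual demands.\<close>
  define R where "R f = (if f \<in> dual_space then dual_norm f else 0)" for f :: "'a \<Rightarrow> complex"
  define T where "T = (PiE UNIV (\<lambda>f. cball 0 (R f)) :: (('a \<Rightarrow> complex) \<Rightarrow> complex) set)"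
  have "compact T" unfolding T_def compactin_euclidean_iff[symmetric] euclidean_product_topology[symmetric]
    by (auto simp: compactin_PiE)
  moreover have "filtermap bd_eval \<F> \<noteq> bot" using nb by (simp add: filtermap_bot_iff)
  moreover have "eventually (\<lambda>h. h \<in> T) (filtermap bd_eval \<F>)"
    unfolding eventually_filtermap using bounded
  proof eventually_elim
    case (elim x)
    have "cmod (bd_eval x f) \<le> R f" for f
    proof (cases "f \<in> dual_space")
      case True
      from eval_bound[OF this, of x] mult_right_mono[OF elim dual_norm_nonneg[OF True]] True
      show ?thesis by (simp add: R_def)
    qed (simp add: R_def bidual_outside)
    then show ?case by (auto simp: T_def)
  qed
  ultimately obtain h where h: "h \<in> T" "inf (nhds h) (filtermap bd_eval \<F>) \<noteq> bot"
    unfolding compact_filter by blast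
  \<comment> \<open>Refining by preimages of neighbourhoods turns the cluster point into a limit.
    Preimages are taken because \<open>h\<close> is not yet known to be the evaluation of an
    element.\<close>
  define \<G> where "\<G> = inf \<F> (filtercomap bd_eval (nhds h))"
  have G_nb: "\<G> \<noteq> bot"
  proof
    assume "\<G> = bot"
    then have "eventually (\<lambda>_. False) \<G>" by simp
    then obtain P Q where PQ: "eventually P \<F>" "eventually Q (filtercomap bd_eval (nhds h))" "\<And>x. P x \<Longrightarrow> Q x \<Longrightarrow> False"
      unfolding \<G>_def eventually_inf by blast
    then obtain Q' where Q': "eventually Q' (nhds h)" "\<And>x. Q' (bd_eval x) \<Longrightarrow> Q x"
      unfolding eventually_filtercomap by blast
    have "eventually (\<lambda>y. \<not> Q' y) (filtermap bd_eval \<F>)"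
      unfolding eventually_filtermap using PQ(1) by eventually_elim (use PQ(3) Q'(2) in blast)
    with Q'(1) have "eventually (\<lambda>_. False) (inf (nhds h) (filtermap bd_eval \<F>))"
      unfolding eventually_inf by blast
    with h(2) show False by (simp add: trivial_limit_def)
  qed
  have "filterlim bd_eval (nhds h) \<G>"
    unfolding \<G>_def by (rule filterlim_mono[OF filterlim_filtercomap order_refl inf_le2])
  then have lim: "((\<lambda>x. bd_eval x f) \<longlongrightarrow> h f) \<G>" for f
    using continuous_on_tendsto_compose[OF continuous_on_product_coordinates[of f]] by simp
  have uniq: "a = b" if "((\<lambda>x. t x) \<longlongrightarrow> a) \<G>" "((\<lambda>x. t x) \<longlongrightarrow> b) \<G>" for t and a b :: complex
    using tendsto_unique[OF G_nb] that by blast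
  have hB: "h \<in> bidual_space"
  proof (rule bidual_spaceI[where K = 1])
    show "h (\<lambda>a. f a + g a) = h f + h g" if "f \<in> dual_space" "g \<in> dual_space" for f g
      using uniq[OF lim, of "\<lambda>a. f a + g a"] tendsto_add[OF lim lim, of f g] that by (simp add: bidual_add)
    show "h (\<lambda>a. c * f a) = c * h f" if "f \<in> dual_space" for c f
      using uniq[OF lim, of "\<lambda>a. c * f a"] tendsto_mult_left[OF lim, of c f] that by (simp add: bidual_scale)
    have hR: "cmod (h f) \<le> R f" for f using h(1) by (auto simp: T_def PiE_def Pi_def)
    show "cmod (h f) \<le> 1 * dual_norm f" if "f \<in> dual_space" for f
      using hR[of f] that by (simp add: R_def)
    show "h f = 0" if "f \<notin> dual_space" for f
      using hR[of f] that by (simp add: R_def)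
  qed
  have "weak_star_lim \<G> (Abs_bd h)"
    using G_nb lim by (simp add: weak_star_lim_def Abs_bd_inverse[OF hB])
  moreover have "\<G> \<le> \<F>" by (simp add: \<G>_def)
  ultimately show thesis by (intro that)
qed

subsection \<open>Left kernels and support projections\<close>

definition left_kernel :: "('a::unital_cstar_algebra \<Rightarrow> complex) \<Rightarrow> 'a set" where
  "left_kernel g = {x. g (cstar x * x) = 0}"

lemma left_kernel_iff_gns_norm:
  "positive_functional g \<Longrightarrow> x \<in> left_kernel g \<longleftrightarrow> gns_norm g x = 0"
  by (simp add: left_kernel_def pf_square)

lemma left_kernel_mult_eq_0:
  assumes "positive_functional g" "x \<in> left_kernel g" shows "g (y * x) = 0"
  using pf_Cauchy_Schwarz[OF assms(1), of "cstar y" x] assms by (simp add: left_kernel_iff_gns_norm cstar_cstar)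

lemma left_kernel_mult:
  assumes "positive_functional g" "x \<in> left_kernel g" shows "y * x \<in> left_kernel g"
  using gns_norm_mult_le[OF assms(1), of y x] assms gns_norm_nonneg[OF assms(1), of "y * x"]
  by (simp add: left_kernel_iff_gns_norm)

lemma left_kernel_add:
  assumes "positive_functional g" "x \<in> left_kernel g" "y \<in> left_kernel g"
  shows "x + y \<in> left_kernel g"
  using left_kernel_mult_eq_0[OF assms(1,2), of "cstar (x + y)"] left_kernel_mult_eq_0[OF assms(1,3), of "cstar (x + y)"]
  by (simp add: left_kernel_def distrib_left clf_add[OF pf_clf[OF assms(1)]])

lemma left_kernel_sum:
  assumes "positive_functional g" "\<And>x. x \<in> X \<Longrightarrow> h x \<in> left_kernel g"
  shows "sum h X \<in> left_kernel g"
  using assms(2)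
proof (induction X rule: infinite_finite_induct)
  case (insert x X)
  then show ?case using left_kernel_add[OF assms(1)] by simp
qed (simp_all add: left_kernel_def clf_zero[OF pf_clf[OF assms(1)]])

lemma left_kernel_scaleR:
  assumes "positive_functional g" "x \<in> left_kernel g" shows "r *\<^sub>R x \<in> left_kernel g"
  using left_kernel_mult[OF assms, of "of_real r"] by (simp add: of_real_def)

text \<open>With \<open>h = n \<Sum> x* x\<close> and \<open>r = (1 + h)^-1\<close> the unit is
  \<open>1 - r = r h\<close>, which stays in the left ideal. Since \<open>n x* x \<le> h\<close>,
  the square \<open>(x r)* (x r)\<close> is at most \<open>r h r / n\<close>, hence at most
  \<open>1/n\<close>.\<close>

lemma left_kernel_approx_unit:
  fixes g :: "'a::unital_cstar_algebra \<Rightarrow> complex"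
  assumes g: "positive_functional g" and X: "finite X" "X \<subseteq> left_kernel g" and \<epsilon>: "0 < \<epsilon>"
  obtains e where "e \<in> left_kernel g" "self_adjoint e" "norm e \<le> 1" "\<And>x. x \<in> X \<Longrightarrow> norm (x - x * e) \<le> \<epsilon>"
proof -
  \<comment> \<open>Chosen so that the bound \<open>1/n\<close> on the squared norm of
    \<open>x r\<close> is the square of \<open>\<epsilon>\<close>.\<close>
  define n where "n = 1 / \<epsilon>\<^sup>2"
  have n: "0 < n" using \<epsilon> by (simp add: n_def)
  define h where "h = n *\<^sub>R (\<Sum>x\<in>X. cstar x * x)"
  have ph: "positive_elem h" unfolding h_def
    using n by (intro positive_elem_scaleR positive_elem_sum positive_elem_cstar_mult) auto
  have hN: "h \<in> left_kernel g" unfolding h_def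
    using X by (intro left_kernel_scaleR[OF g] left_kernel_sum[OF g] left_kernel_mult[OF g]) auto
  obtain r where r: "self_adjoint r" "r * h = 1 - r" "norm (1 - r) \<le> 1" "positive_elem (1 - r * h * r)"
    using resolvent_exists[OF ph] by metis
  have cr: "cstar r = r" using r(1) by (simp add: self_adjoint_def)
  show thesis
  proof (rule that[of "1 - r"])
    show "1 - r \<in> left_kernel g" using left_kernel_mult[OF g hN, of r] r(2) by simp
    show "self_adjoint (1 - r)" by (simp add: self_adjoint_def cstar_diff cr)
    show "norm (1 - r) \<le> 1" by (rule r(3))
    fix x assume x: "x \<in> X"
    have split: "h - n *\<^sub>R (cstar x * x) = n *\<^sub>R (\<Sum>y\<in>X - {x}. cstar y * y)"
      unfolding h_def using x X(1) by (simp add: sum_diff1 scaleR_right_diff_distrib)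
    have "positive_elem (h - n *\<^sub>R (cstar x * x))"
      unfolding split using n by (intro positive_elem_scaleR positive_elem_sum positive_elem_cstar_mult) auto
    from positive_elem_conjugate[OF this, of r]
    have 1: "positive_elem (r * h * r - n *\<^sub>R (cstar (x * r) * (x * r)))"
      by (simp add: cr cstar_mult algebra_simps)
    have "positive_elem (1 - n *\<^sub>R (cstar (x * r) * (x * r)))"
      using positive_elem_add[OF r(4) 1] by simp
    then have "norm (n *\<^sub>R (cstar (x * r) * (x * r))) \<le> 1"
      using n by (intro norm_le_of_positive_elem positive_elem_scaleR positive_elem_cstar_mult) auto
    then have "n * (norm (x * r))\<^sup>2 \<le> 1" using n by (simp add: cstar_identity)
    then have "(norm (x * r))\<^sup>2 \<le> \<epsilon>\<^sup>2" using \<epsilon> by (simp add: n_def field_simps)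
    then have "norm (x * r) \<le> \<epsilon>" by (rule power2_le_imp_le) (use \<epsilon> in simp)
    moreover have "x - x * (1 - r) = x * r" by (simp add: algebra_simps)
    ultimately show "norm (x - x * (1 - r)) \<le> \<epsilon>" by simp
  qed
qed

text \<open>The approximate units are taken for the extension of \<open>f\<close>, in its left
  kernel inside the bidual. A weak-* cluster point therefore absorbs every element of that kernel,
  including those outside the original algebra.\<close>

lemma left_kernel_unit_exists:
  fixes f :: "'a::unital_cstar_algebra \<Rightarrow> complex"
  assumes f: "positive_functional f"
  obtains q where "self_adjoint q" "q \<in> left_kernel (\<lambda>x. bd_eval x f)"
    "\<And>x. x \<in> left_kernel (\<lambda>x. bd_eval x f) \<Longrightarrow> x * q = x"
proof -
  define g where "g = (\<lambda>x. bd_eval x f)"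
  have g: "positive_functional g" unfolding g_def by (rule positive_functional_ext[OF f])
  define I where "I = {(X, \<epsilon>::real). finite X \<and> X \<subseteq> left_kernel g \<and> 0 < \<epsilon>}"
  define E where "E = (\<lambda>(X, \<epsilon>). {e \<in> left_kernel g. self_adjoint e \<and> norm e \<le> 1 \<and> (\<forall>x\<in>X. norm (x - x * e) \<le> \<epsilon>)})"
  \<comment> \<open>The filter takes the place of a net indexed by growing finite sets and shrinking
    tolerances.\<close>
  define \<F> where "\<F> = (INF i\<in>I. principal (E i))"
  have ev: "eventually P \<F> \<longleftrightarrow> (\<exists>i\<in>I. eventually P (principal (E i)))" for P
    unfolding \<F>_def
  proof (rule eventually_INF_base)
    have "({}, 1) \<in> I" by (simp add: I_def)
    then show "I \<noteq> {}" by blast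
    fix i j assume "i \<in> I" "j \<in> I"
    moreover obtain X \<epsilon> Y \<delta> where "i = (X, \<epsilon>)" "j = (Y, \<delta>)" by (cases i, cases j)
    ultimately show "\<exists>k\<in>I. principal (E k) \<le> inf (principal (E i)) (principal (E j))"
      by (intro bexI[of _ "(X \<union> Y, min \<epsilon> \<delta>)"]) (auto simp: I_def E_def)
  qed
  have Fnb: "\<F> \<noteq> bot"
  proof
    assume "\<F> = bot"
    then have "eventually (\<lambda>_. False) \<F>" by simp
    then obtain X \<epsilon> where I: "(X, \<epsilon>) \<in> I" "E (X, \<epsilon>) = {}" unfolding ev eventually_principal by auto
    then have X: "finite X" "X \<subseteq> left_kernel g" "0 < \<epsilon>" by (simp_all add: I_def)
    obtain e where "e \<in> left_kernel g" "self_adjoint e" "norm e \<le> 1" "\<forall>x\<in>X. norm (x - x * e) \<le> \<epsilon>"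
      using left_kernel_approx_unit[OF g X] by metis
    then have "e \<in> E (X, \<epsilon>)" by (simp add: E_def)
    with I(2) show False by simp
  qed
  have base: "\<forall>\<^sub>F e in \<F>. e \<in> left_kernel g \<and> self_adjoint e \<and> norm e \<le> 1"
    unfolding ev by (rule bexI[of _ "({}, 1)"]) (auto simp: eventually_principal I_def E_def)
  then have "\<forall>\<^sub>F e in \<F>. norm e \<le> 1" by eventually_elim simp
  then obtain \<G> q where G: "\<G> \<le> \<F>" "weak_star_lim \<G> q" using weak_star_compact[OF Fnb] by metis
  have nb: "\<G> \<noteq> bot" using G(2) by (simp add: weak_star_lim_def)
  have baseG: "\<forall>\<^sub>F e in \<G>. e \<in> left_kernel g \<and> self_adjoint e \<and> norm e \<le> 1"
    using filter_leD[OF G(1) base] .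
  have "cstar q = q"
  proof (rule bd_eqI)
    fix k :: "'a \<Rightarrow> complex" assume k: "k \<in> dual_space"
    have "((\<lambda>e. cnj (bd_eval e (dual_star k))) \<longlongrightarrow> cnj (bd_eval q (dual_star k))) \<G>"
      by (intro tendsto_cnj weak_star_limD[OF G(2)] dual_star_dual_space k)
    moreover have "\<forall>\<^sub>F e in \<G>. cnj (bd_eval e (dual_star k)) = bd_eval e k"
      using baseG
    proof eventually_elim
      case (elim e)
      have "bd_eval (cstar e) k = cnj (bd_eval e (dual_star k))" using k by (simp add: eval_cstar bd_star_def)
      then show ?case using elim by (simp add: self_adjoint_def)
    qed
    ultimately have "((\<lambda>e. bd_eval e k) \<longlongrightarrow> cnj (bd_eval q (dual_star k))) \<G>"
      by (rule Lim_transform_eventually)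
    from tendsto_unique[OF nb this weak_star_limD[OF G(2) k]]
    show "bd_eval (cstar q) k = bd_eval q k" using k by (simp add: eval_cstar bd_star_def)
  qed
  moreover have "q \<in> left_kernel g"
  proof -
    have fd: "f \<in> dual_space" by (rule pf_dual_space[OF f])
    \<comment> \<open>The product is handled as weak-* continuous in one factor at a time, so
      \<open>q*\<close> is held fixed while \<open>e\<close> tends to \<open>q\<close>.\<close>
    have "\<forall>\<^sub>F e in \<G>. bd_eval (cstar q * e) f = 0"
      using baseG by eventually_elim (use left_kernel_mult_eq_0[OF g] in \<open>simp add: g_def\<close>)
    then have "((\<lambda>e. bd_eval (cstar q * e) f) \<longlongrightarrow> 0) \<G>" by (rule tendsto_eventually)
    from tendsto_unique[OF nb this weak_star_lim_mult[OF G(2) fd]]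
    show ?thesis by (simp add: left_kernel_def g_def)
  qed
  moreover have "x * q = x" if x: "x \<in> left_kernel g" for x
  proof (rule bd_eqI)
    fix k :: "'a \<Rightarrow> complex" assume k: "k \<in> dual_space"
    have "((\<lambda>e. bd_eval (x * e) k) \<longlongrightarrow> bd_eval x k) \<G>"
    proof (rule tendstoI)
      fix \<epsilon> :: real assume \<epsilon>: "0 < \<epsilon>"
      define d where "d = dual_norm k + 1"
      have d: "0 < d" using dual_norm_nonneg[OF k] by (simp add: d_def)
      have "\<forall>\<^sub>F e in \<F>. norm (x - x * e) \<le> \<epsilon> / d"
        unfolding ev using x \<epsilon> d
        by (intro bexI[of _ "({x}, \<epsilon> / d)"]) (auto simp: eventually_principal I_def E_def)
      then have "\<forall>\<^sub>F e in \<G>. norm (x - x * e) \<le> \<epsilon> / d" by (rule filter_leD[OF G(1)])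
      then show "\<forall>\<^sub>F e in \<G>. dist (bd_eval (x * e) k) (bd_eval x k) < \<epsilon>"
      proof eventually_elim
        case (elim e)
        have "dist (bd_eval (x * e) k) (bd_eval x k) = cmod (bd_eval (x - x * e) k)"
          by (simp add: dist_norm eval_diff norm_minus_commute)
        also have "\<dots> \<le> \<epsilon> / d * dual_norm k"
          using order_trans[OF eval_bound[OF k] mult_right_mono[OF elim dual_norm_nonneg[OF k]]] .
        also have "\<dots> < \<epsilon>" using \<epsilon> dual_norm_nonneg[OF k] by (simp add: d_def field_simps)
        finally show ?case .
      qed
    qed
    from tendsto_unique[OF nb weak_star_lim_mult[OF G(2) k] this]
    show "bd_eval (x * q) k = bd_eval x k" .
  qed
  ultimately show thesis unfolding g_def using that[of q] by (simp add: self_adjoint_def)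
qed

text \<open>Discharges the definite description. Existence is \<open>p = 1 - q\<close> with
  \<open>q\<close> a right unit of the left kernel; uniqueness holds because two projections
  generating the same left ideal absorb each other, and taking adjoints makes them equal.\<close>

theorem support_proj_exists:
  fixes f :: "'a::unital_cstar_algebra \<Rightarrow> complex"
  assumes f: "positive_functional f"
  obtains p where "support_proj f = bd_eval p" "self_adjoint p" "p * p = p"
    "\<And>x. x \<in> left_kernel (\<lambda>x. bd_eval x f) \<longleftrightarrow> x * p = 0"
proof -
  define N where "N = left_kernel (\<lambda>x. bd_eval x f)"
  note g = positive_functional_ext[OF f]
  obtain q where q: "self_adjoint q" "q \<in> N" "\<And>x. x \<in> N \<Longrightarrow> x * q = x"
    using left_kernel_unit_exists[OF f] unfolding N_def by metis
  have cq: "cstar q = q" using q(1) by (simp add: self_adjoint_def)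
  have NI: "y * q \<in> N" for y using left_kernel_mult[OF g q(2)[unfolded N_def]] by (simp add: N_def)
  have qq: "q * q = q" using q(3)[OF q(2)] .
  have one_minus: "(\<lambda>k. bd_embed 1 k - bd_eval r k) = bd_eval (1 - r)" for r :: "'a bd"
    by (rule ext) (simp add: eval_diff flip: eval_bd_of)
  have LHS: "{x \<in> bidual_space. state_ext f (bd_star x \<star> x) = 0} = bd_eval ` N"
  proof (intro set_eqI iffI)
    fix x assume "x \<in> {x \<in> bidual_space. state_ext f (bd_star x \<star> x) = 0}"
    then have "x = bd_eval (Abs_bd x)" "Abs_bd x \<in> N"
      by (auto simp: Abs_bd_inverse N_def left_kernel_def eval_mult eval_cstar state_ext_def)
    then show "x \<in> bd_eval ` N" by blast
  qed (auto simp: N_def left_kernel_def eval_mult eval_cstar state_ext_def)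
  have RHS: "{y \<star> (\<lambda>k. bd_embed 1 k - bd_eval r k) | y. y \<in> bidual_space} = bd_eval ` {y * (1 - r) | y. True}" for r :: "'a bd"
    unfolding one_minus
  proof (intro set_eqI iffI)
    fix x assume "x \<in> {y \<star> bd_eval (1 - r) | y. y \<in> bidual_space}"
    then obtain y where "y \<in> bidual_space" "x = y \<star> bd_eval (1 - r)" by blast
    then have "x = bd_eval (Abs_bd y * (1 - r))" by (simp add: eval_mult Abs_bd_inverse)
    then show "x \<in> bd_eval ` {y * (1 - r) | y. True}" by blast
  qed (auto simp: eval_mult)
  have inj: "bd_eval ` A = bd_eval ` B \<longleftrightarrow> A = B" for A B :: "'a bd set"
    by (rule inj_image_eq_iff) (simp add: inj_def bd_eval_inject)
  define p where "p = 1 - q"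
  have "support_proj f = bd_eval p"
    unfolding support_proj_def
  proof (rule the_equality)
    have "N = {y * (1 - p) | y. True}"
    proof (intro set_eqI iffI)
      fix x assume "x \<in> N"
      then have "x = x * (1 - p)" using q(3) by (simp add: p_def)
      then show "x \<in> {y * (1 - p) | y. True}" by blast
    qed (use NI in \<open>auto simp: p_def\<close>)
    moreover have "bd_projection (bd_eval p)"
      unfolding bd_projection_def eval_mult[symmetric] eval_cstar[symmetric]
      by (simp add: p_def cstar_diff cq algebra_simps qq)
    ultimately show "bd_projection (bd_eval p) \<and> {x \<in> bidual_space. state_ext f (bd_star x \<star> x) = 0}
      = {y \<star> (\<lambda>k. bd_embed 1 k - bd_eval p k) | y. y \<in> bidual_space}"
      unfolding LHS RHS inj by blast
  next
    fix p' assume p': "bd_projection p' \<and> {x \<in> bidual_space. state_ext f (bd_star x \<star> x) = 0}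
      = {y \<star> (\<lambda>k. bd_embed 1 k - p' k) | y. y \<in> bidual_space}"
    then obtain r where r: "p' = bd_eval r" by (metis Abs_bd_inverse bd_projection_def)
    have cr: "cstar r = r" and rr: "r * r = r"
      using p' unfolding r bd_projection_def by (simp_all add: bd_eval_inject flip: eval_mult eval_cstar)
    have Nr: "N = {y * (1 - r) | y. True}" using p' unfolding r LHS RHS inj by blast
    have "1 - r = 1 * (1 - r)" by simp
    then have "1 - r \<in> N" unfolding Nr by blast
    then have 1: "(1 - r) * q = 1 - r" by (rule q(3))
    obtain y where y: "q = y * (1 - r)" using q(2) unfolding Nr by auto
    have "(1 - r) * (1 - r) = 1 - r" by (simp add: algebra_simps rr)
    then have "q * (1 - r) = q" using y by (metis mult.assoc)
    then have "cstar (q * (1 - r)) = q" by (simp add: cq)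
    then have "(1 - r) * q = q" by (simp add: cstar_simps cq cr)
    with 1 have "r = p" by (simp add: p_def algebra_simps)
    then show "p' = bd_eval p" by (simp add: r)
  qed
  moreover have "self_adjoint p" "p * p = p"
    by (simp_all add: p_def self_adjoint_def cstar_diff cq algebra_simps qq)
  moreover have "x \<in> N \<longleftrightarrow> x * p = 0" for x
  proof
    assume "x \<in> N" then show "x * p = 0" using q(3) by (simp add: p_def algebra_simps)
  next
    assume "x * p = 0" then have "x = x * q" by (simp add: p_def algebra_simps)
    then show "x \<in> N" using NI[of x] by simp
  qed
  ultimately show thesis unfolding N_def by (rule that)
qed

subsection \<open>Pure states\<close>

text \<open>With \<open>c = G 1\<close> strictly between 0 and 1, \<open>\<omega>\<close> is a
  convex combination of \<open>G / c\<close> and \<open>(\<omega> - G) / (1 - c)\<close>, so purity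
  applies. At the end points \<open>G\<close> or \<open>\<omega> - G\<close> vanishes at 1 and hence
  everywhere.\<close>

lemma pure_state_dominated:
  fixes \<omega> G :: "'a::unital_cstar_algebra \<Rightarrow> complex"
  assumes \<omega>: "pure_state \<omega>" and G: "positive_functional G"
    and dom: "positive_functional (\<lambda>a. \<omega> a - G a)"
  shows "\<exists>c. \<forall>a. G a = c * \<omega> a"
proof -
  have s: "state \<omega>" using \<omega> by (simp add: pure_state_def)
  define c where "c = Re (G 1)"
  have G1: "G 1 = of_real c" unfolding c_def
    by (rule pf_self_adjoint[OF G]) (simp add: self_adjoint_def)
  have w1: "\<omega> 1 = 1" using s by (simp add: state_iff)
  have c0: "0 \<le> c" using pf_bound[OF G, of 1] order_trans[OF norm_ge_zero] by (fastforce simp: c_def)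
  have c1: "c \<le> 1" using order_trans[OF norm_ge_zero pf_bound[OF dom, of 1]] by (simp add: w1 c_def)
  consider "c = 0" | "c = 1" | "0 < c" "c < 1" using c0 c1 by linarith
  then show ?thesis
  proof cases
    case 1
    then have "G a = 0" for a using pf_bound[OF G, of a] by (simp add: c_def)
    then show ?thesis by (intro exI[of _ 0]) simp
  next
    case 2
    then have "\<omega> a - G a = 0" for a using pf_bound[OF dom, of a] by (simp add: w1 c_def)
    then show ?thesis by (intro exI[of _ 1]) simp
  next
    case 3
    have scale: "positive_functional (\<lambda>a. of_real t * k a)" if "positive_functional k" "0 \<le> t" for k :: "'a \<Rightarrow> complex" and t
      using that by (auto simp: positive_functional_def clinear_functional_def algebra_simps)
    define f where "f a = of_real (1 / c) * G a" for a
    define g where "g a = of_real (1 / (1 - c)) * (\<omega> a - G a)" for a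
    have "positive_functional f" unfolding f_def by (rule scale[OF G]) (use 3 in simp)
    then have f: "state f" using 3 by (simp add: state_iff f_def G1)
    have "positive_functional g" unfolding g_def by (rule scale[OF dom]) (use 3 in simp)
    moreover have cancel: "complex_of_real (1 - c) * of_real (1 / (1 - c)) = 1"
      unfolding of_real_mult[symmetric] using 3 by simp
    have "g 1 = 1" unfolding g_def G1 w1 using cancel by (simp add: mult.commute)
    ultimately have g: "state g" by (simp add: state_iff)
    have "\<omega> = (\<lambda>a. of_real c * f a + of_real (1 - c) * g a)"
    proof
      fix a
      have "of_real c * f a = G a" using 3 by (simp add: f_def)
      moreover have "of_real (1 - c) * g a = \<omega> a - G a"
        unfolding g_def mult.assoc[symmetric] cancel by simp
      ultimately show "\<omega> a = of_real c * f a + of_real (1 - c) * g a" by simp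
    qed
    with \<omega> f g 3 have "f = \<omega>" by (auto simp: pure_state_def)
    moreover have "G a = of_real c * f a" for a using 3 by (simp add: f_def)
    ultimately have "G a = of_real c * \<omega> a" for a by simp
    then show ?thesis by blast
  qed
qed

text \<open>By duality, \<open>inf {\<omega> y | y \<ge> 0, y \<ge> x}\<close> is the maximum of \<open>g x\<close> over the positive
  functionals \<open>g \<le> \<omega>\<close>, which are multiples of \<open>\<omega>\<close>.\<close>

lemma pure_state_majorant:
  fixes \<omega> :: "'a::unital_cstar_algebra \<Rightarrow> complex"
  assumes \<omega>: "pure_state \<omega>" and x: "self_adjoint x" and wx: "\<omega> x = 0" and \<epsilon>: "0 < \<epsilon>"
  obtains y where "positive_elem y" "positive_elem (y - x)" "Re (\<omega> y) < \<epsilon>"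
proof -
  have w: "positive_functional \<omega>" using \<omega> by (simp add: pure_state_def state_iff)
  note lin = clf_simps[OF pf_clf[OF w]]
  \<comment> \<open>The Hahn--Banach theorem is stated for a whole real vector space, so the order
    condition is imposed on the self-adjoint part of an arbitrary element.\<close>
  define re where "re a = (1/2) *\<^sub>R (a + cstar a)" for a :: 'a
  have re_sa: "re a = a" if "self_adjoint a" for a
    using that by (simp add: re_def self_adjoint_def scaleR_2[symmetric])
  have sa_re: "self_adjoint (re a)" for a by (simp add: re_def self_adjoint_def cstar_simps add.commute)
  have re_add: "re (a + b) = re a + re b" for a b
    by (simp add: re_def cstar_add scaleR_add_right algebra_simps)
  have re_scale: "re (r *\<^sub>R a) = r *\<^sub>R re a" for r a
    by (simp add: re_def cstar_scaleR scaleR_add_right mult.commute)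
  define V where "V a = {Re (\<omega> y) | y. positive_elem y \<and> positive_elem (y - re a)}" for a
  define r where "r a = Inf (V a)" for a
  have VI: "Re (\<omega> y) \<in> V a" if "positive_elem y" "positive_elem (y - re a)" for y a
    using that unfolding V_def by blast
  have ne: "V a \<noteq> {}" for a
    using VI[OF positive_elem_of_real positive_elem_norm_minus[OF sa_re order_refl], of a] by auto
  have bdd: "bdd_below (V a)" for a
    by (rule bdd_belowI[of _ 0]) (auto simp: V_def pf_positive_elem[OF w])
  have rl: "r a \<le> v" if "v \<in> V a" for a v unfolding r_def using that bdd by (rule cInf_lower)
  have lr: "k \<le> r a" if "\<And>v. v \<in> V a \<Longrightarrow> k \<le> v" for a k
    unfolding r_def using ne that by (rule cInf_greatest)
  have "sublinear r"
  proof (rule sublinearI)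
    fix a b
    have "r (a + b) - v \<le> u" if vu: "v \<in> V a" "u \<in> V b" for u v
    proof -
      obtain y z where yz: "v = Re (\<omega> y)" "positive_elem y" "positive_elem (y - re a)"
        "u = Re (\<omega> z)" "positive_elem z" "positive_elem (z - re b)" using vu unfolding V_def by blast
      have "positive_elem ((y + z) - re (a + b))"
        using positive_elem_add[OF yz(3,6)] by (simp add: re_add algebra_simps)
      with yz have "r (a + b) \<le> Re (\<omega> (y + z))" by (intro rl VI positive_elem_add) auto
      then show ?thesis using yz by (simp add: lin)
    qed
    then have "r (a + b) - v \<le> r b" if "v \<in> V a" for v using that lr by blast
    then have "r (a + b) - r b \<le> r a" by (intro lr) (simp add: algebra_simps)
    then show "r (a + b) \<le> r a + r b" by simp
  next
    fix t :: real and a assume t: "0 < t"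
    have "(1/t) * r (t *\<^sub>R a) \<le> r a"
    proof (rule lr)
      fix v assume "v \<in> V a"
      then obtain y where y: "v = Re (\<omega> y)" "positive_elem y" "positive_elem (y - re a)"
        unfolding V_def by blast
      have "positive_elem (t *\<^sub>R y - re (t *\<^sub>R a))"
        using positive_elem_scaleR[OF y(3), of t] t by (simp add: re_scale scaleR_right_diff_distrib)
      with y t have "r (t *\<^sub>R a) \<le> Re (\<omega> (t *\<^sub>R y))" by (intro rl VI positive_elem_scaleR) auto
      then show "(1/t) * r (t *\<^sub>R a) \<le> v" using y t by (simp add: lin field_simps)
    qed
    then show "r (t *\<^sub>R a) \<le> t * r a" using t by (simp add: field_simps)
  qed
  then obtain g where g: "linear g" "\<And>a. g a \<le> r a" "g x = r x"
    using hahn_banach_sublinear by metis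
  have gpos: "0 \<le> g a" if a: "positive_elem a" for a
  proof -
    have "re (- a) = - a" using positive_elem_self_adjoint[OF a] by (intro re_sa) (simp add: self_adjoint_def)
    then have "r (- a) \<le> Re (\<omega> 0)" using a by (intro rl VI) auto
    then show ?thesis using g(2)[of "- a"] by (simp add: lin linear_neg[OF g(1)])
  qed
  have gle: "g a \<le> Re (\<omega> a)" if a: "positive_elem a" for a
    using order_trans[OF g(2) rl[OF VI[OF a]], of a] re_sa[OF positive_elem_self_adjoint[OF a]] by simp
  obtain G where G: "clinear_functional G" "\<And>a. self_adjoint a \<Longrightarrow> G a = of_real (g a)"
    using complexify_functional[OF g(1)] by metis
  have sq: "self_adjoint (cstar a * a)" for a :: 'a by (simp add: self_adjoint_def cstar_simps)
  have pG: "positive_functional G"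
    using G gpos[OF positive_elem_cstar_mult] by (simp add: positive_functional_def G(2)[OF sq])
  have "clinear_functional (\<lambda>a. \<omega> a - G a)"
    using clf_lincomb[OF pf_clf[OF w] G(1), of 1 "-1"] by simp
  moreover have "\<omega> (cstar a * a) - G (cstar a * a) = of_real (Re (\<omega> (cstar a * a)) - g (cstar a * a))" for a
    using pf_self_adjoint[OF w sq[of a]] by (simp add: G(2)[OF sq])
  ultimately have "positive_functional (\<lambda>a. \<omega> a - G a)"
    using gle[OF positive_elem_cstar_mult] by (simp add: positive_functional_def)
  \<comment> \<open>The functional attains \<open>r x\<close> at \<open>x\<close> and is a multiple
    of \<open>\<omega>\<close>, which vanishes there; so the infimum of the values
    \<open>\<omega> y\<close> is 0.\<close>
  from pure_state_dominated[OF \<omega> pG this] have "G x = 0" using wx by auto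
  then have "r x = 0" using G(2)[OF x] g(3) by simp
  then obtain v where "v \<in> V x" "v < \<epsilon>" using cInf_lessD[OF ne, of x \<epsilon>] \<epsilon> by (auto simp: r_def)
  then show thesis using re_sa[OF x] unfolding V_def by (auto intro: that)
qed

text \<open>The cut-offs control \<open>\<phi> (e x e)\<close>, and it remains to make
  \<open>\<phi> (1 - e)\<close> small. Only \<open>\<omega> (1 - e)\<close> is estimated directly.
  The information is carried over in the bidual: a weak-* cluster point of the elements
  \<open>1 - e\<close> lies in the left kernel of \<open>\<omega>\<close>, hence in that of
  \<open>\<phi>\<close>. The bound \<open>norm (1 - e) \<le> 1\<close> supplies compactness, and
  \<open>(1 - e)(1 - e) \<le> 1 - e\<close> turns values into GNS seminorms.\<close>

lemma pure_state_support_le_zero: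
  fixes \<omega> \<phi> :: "'a::unital_cstar_algebra \<Rightarrow> complex"
  assumes \<omega>: "pure_state \<omega>" and \<phi>: "state \<phi>"
    and ker: "left_kernel (\<lambda>x. bd_eval x \<omega>) \<subseteq> left_kernel (\<lambda>x. bd_eval x \<phi>)"
    and x: "self_adjoint x" and wx: "\<omega> x = 0"
  shows "Re (\<phi> x) \<le> 0"
proof -
  have w: "positive_functional \<omega>" using \<omega> by (simp add: pure_state_def state_iff)
  have f: "positive_functional \<phi>" "\<phi> 1 = 1" using \<phi> by (simp_all add: state_iff)
  note wd = pf_dual_space[OF w] and fd = pf_dual_space[OF f(1)]
  note W = positive_functional_ext[OF w]
  note linf = clf_simps[OF pf_clf[OF f(1)]] and linw = clf_simps[OF pf_clf[OF w]]
  define P where "P n e \<longleftrightarrow> self_adjoint e \<and> norm e \<le> 1 \<and> norm (1 - e) \<le> 1 \<and> Re (\<omega> (1 - e)) \<le> 1 / real (Suc n)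
      \<and> Re (\<phi> (e * x * e)) \<le> 1 / real (Suc n)
      \<and> positive_elem ((1 - e) - (1 - e) * (1 - e))" for n e
  have cut: "\<exists>e. P n e" for n
  proof -
    \<comment> \<open>The majorant is taken with \<open>\<omega> y\<close> below
      \<open>1 / k^2\<close> because the resolvent is formed from \<open>k y\<close>, which costs
      one factor \<open>k\<close>.\<close>
    define k where "k = real (Suc n)"
    have k: "0 < k" by (simp add: k_def)
    obtain y where y: "positive_elem y" "positive_elem (y - x)" "Re (\<omega> y) < 1 / k\<^sup>2"
      using pure_state_majorant[OF \<omega> x wx, of "1 / k\<^sup>2"] k by auto
    have ph: "positive_elem (k *\<^sub>R y)" using y k by (intro positive_elem_scaleR) auto
    obtain e where e: "self_adjoint e" "norm e \<le> 1" "norm (1 - e) \<le> 1"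
      "positive_elem (k *\<^sub>R y - (1 - e))" "positive_elem ((1 - e) - (1 - e) * (1 - e))"
      "positive_elem (1 - e * (k *\<^sub>R y) * e)"
      using resolvent_exists[OF ph] by metis
    have ce: "cstar e = e" using e(1) by (simp add: self_adjoint_def)
    have "Re (\<omega> (1 - e)) \<le> k * Re (\<omega> y)" using pf_positive_elem[OF w e(4)] by (simp add: linw)
    also have "\<dots> \<le> k * (1 / k\<^sup>2)" using y(3) k by (intro mult_left_mono) auto
    also have "\<dots> = 1 / k" using k by (simp add: power2_eq_square)
    finally have 1: "Re (\<omega> (1 - e)) \<le> 1 / k" .
    have "0 \<le> Re (\<phi> (cstar e * (y - x) * e))"
      by (rule pf_positive_elem[OF f(1) positive_elem_conjugate[OF y(2)]])
    then have "Re (\<phi> (e * x * e)) \<le> Re (\<phi> (e * y * e))" by (simp add: ce algebra_simps linf)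
    moreover have "k * Re (\<phi> (e * y * e)) \<le> 1"
      using pf_positive_elem[OF f(1) e(6)] by (simp add: linf f(2))
    then have "Re (\<phi> (e * y * e)) \<le> 1 / k" using k by (simp add: field_simps)
    ultimately show ?thesis using 1 e unfolding P_def k_def by (intro exI[of _ e]) auto
  qed
  obtain e where e: "\<And>n. P n (e n)" using cut by metis
  have gns_cut: "(gns_norm k (1 - e n))\<^sup>2 \<le> Re (k (1 - e n))" if k: "positive_functional k" for k n
  proof -
    have pe: "self_adjoint (e n)" "positive_elem ((1 - e n) - (1 - e n) * (1 - e n))"
      using e[of n] by (auto simp: P_def)
    have "cstar (1 - e n) = 1 - e n" using pe(1) by (simp add: self_adjoint_def cstar_diff)
    then show ?thesis
      using pf_positive_elem[OF k pe(2)] by (simp add: gns_norm_square[OF k] clf_diff[OF pf_clf[OF k]])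
  qed
  define D where "D n = bd_of (1 - e n)" for n
  have Fnb: "filtermap D sequentially \<noteq> bot" by (simp add: filtermap_bot_iff)
  have "norm (D n) \<le> 1" for n
    using e[of n] norm_bd_of_le[of "1 - e n"] by (simp add: D_def P_def)
  then have "\<forall>\<^sub>F z in filtermap D sequentially. norm z \<le> 1" by (simp add: eventually_filtermap)
  then obtain \<G> d where G: "\<G> \<le> filtermap D sequentially" "weak_star_lim \<G> d"
    using weak_star_compact[OF Fnb] by metis
  have nb: "\<G> \<noteq> bot" using G(2) by (simp add: weak_star_lim_def)
  have gns_D: "gns_norm (\<lambda>x. bd_eval x \<omega>) (D n) = gns_norm \<omega> (1 - e n)" for n
    by (simp add: gns_norm_def D_def eval_bd_of_dual[OF wd] flip: bd_of_cstar bd_of_mult)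
  have "d \<in> left_kernel (\<lambda>x. bd_eval x \<omega>)"
  proof -
    define M where "M = gns_norm (\<lambda>x. bd_eval x \<omega>) d"
    have "(\<lambda>n. M * sqrt (1 / real (Suc n))) \<longlonglongrightarrow> M * sqrt 0"
      by (intro tendsto_intros LIMSEQ_Suc[OF lim_1_over_n])
    then have lim0: "(\<lambda>n. M * sqrt (1 / real (Suc n))) \<longlonglongrightarrow> 0" by simp
    have "cmod (bd_eval (cstar d * D n) \<omega>) \<le> M * sqrt (1 / real (Suc n))" for n
    proof -
      have "(gns_norm \<omega> (1 - e n))\<^sup>2 \<le> 1 / real (Suc n)"
        using gns_cut[OF w, of n] e[of n] by (simp add: P_def)
      then have "gns_norm \<omega> (1 - e n) \<le> sqrt (1 / real (Suc n))" by (rule real_le_rsqrt)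
      with pf_Cauchy_Schwarz[OF W, of d "D n"] gns_norm_nonneg[OF W, of d] show ?thesis
        unfolding M_def gns_D by (meson mult_left_mono order_trans)
    qed
    then have "(\<lambda>n. bd_eval (cstar d * D n) \<omega>) \<longlonglongrightarrow> 0"
      by (intro Lim_null_comparison[OF always_eventually lim0]) blast
    then have "((\<lambda>z. bd_eval (cstar d * z) \<omega>) \<longlongrightarrow> 0) (filtermap D sequentially)"
      by (simp add: filterlim_filtermap)
    then have "((\<lambda>z. bd_eval (cstar d * z) \<omega>) \<longlongrightarrow> 0) \<G>" by (rule tendsto_mono[OF G(1)])
    from tendsto_unique[OF nb this weak_star_lim_mult[OF G(2) wd]] show ?thesis
      by (simp add: left_kernel_def)
  qed
  then have "d \<in> left_kernel (\<lambda>x. bd_eval x \<phi>)" using ker by blast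
  from left_kernel_mult_eq_0[OF positive_functional_ext[OF f(1)] this, of 1]
  have lim: "((\<lambda>z. bd_eval z \<phi>) \<longlongrightarrow> 0) \<G>" using weak_star_limD[OF G(2) fd] by simp
  have bound: "Re (\<phi> x) \<le> \<delta>\<^sup>2 + 2 * \<delta> * norm x" if \<delta>: "0 < \<delta>" for \<delta>
  proof -
    obtain n0 where n0: "1 / real (Suc n0) < \<delta>\<^sup>2" using nat_approx_posE[of "\<delta>\<^sup>2"] \<delta> by auto
    have "\<forall>\<^sub>F z in filtermap D sequentially. \<exists>n\<ge>n0. z = D n"
      unfolding eventually_filtermap using eventually_ge_at_top[of n0] by eventually_elim blast
    then have "\<forall>\<^sub>F z in \<G>. \<exists>n\<ge>n0. z = D n" by (rule filter_leD[OF G(1)])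
    moreover have "\<forall>\<^sub>F z in \<G>. cmod (bd_eval z \<phi>) < \<delta>\<^sup>2"
      using tendstoD[OF lim, of "\<delta>\<^sup>2"] \<delta> by simp
    ultimately have "\<forall>\<^sub>F z in \<G>. (\<exists>n\<ge>n0. z = D n) \<and> cmod (bd_eval z \<phi>) < \<delta>\<^sup>2" by (rule eventually_conj)
    \<comment> \<open>One late index is enough; the whole sequence need not converge, since only a
      cluster point is available.\<close>
    from eventually_happens'[OF nb this] obtain n where n: "n \<ge> n0" "cmod (bd_eval (D n) \<phi>) < \<delta>\<^sup>2" by auto
    have "Re (\<phi> (1 - e n)) < \<delta>\<^sup>2"
      using n(2) complex_Re_le_cmod[of "\<phi> (1 - e n)"] by (simp add: D_def eval_bd_of_dual[OF fd])
    then have "(gns_norm \<phi> (1 - e n))\<^sup>2 \<le> \<delta>\<^sup>2" using gns_cut[OF f(1), of n] by simp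
    then have gd: "gns_norm \<phi> (1 - e n) \<le> \<delta>" by (rule power2_le_imp_le) (use \<delta> in simp)
    have en: "self_adjoint (e n)" "norm (e n) \<le> 1" "Re (\<phi> (e n * x * e n)) \<le> 1 / real (Suc n)"
      using e[of n] by (auto simp: P_def)
    have ce: "cstar (e n) = e n" and cx: "cstar x = x" using en(1) x by (simp_all add: self_adjoint_def)
    have gx: "gns_norm \<phi> z \<le> norm z" for z
      using gns_norm_le[OF f(1), of z] by (simp add: gns_norm_def f(2))
    have "cmod (\<phi> ((1 - e n) * x)) \<le> gns_norm \<phi> (1 - e n) * gns_norm \<phi> x"
      using pf_Cauchy_Schwarz[OF f(1), of "1 - e n" x] by (simp add: cstar_diff ce)
    also have "\<dots> \<le> \<delta> * norm x"
      using gd gx[of x] \<delta> gns_norm_nonneg[OF f(1)] by (intro mult_mono) auto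
    finally have 1: "cmod (\<phi> ((1 - e n) * x)) \<le> \<delta> * norm x" .
    have "cmod (\<phi> (e n * x * (1 - e n))) \<le> gns_norm \<phi> (x * e n) * gns_norm \<phi> (1 - e n)"
      using pf_Cauchy_Schwarz[OF f(1), of "x * e n" "1 - e n"] by (simp add: cstar_mult ce cx)
    also have "\<dots> \<le> norm x * \<delta>"
    proof (rule mult_mono[OF _ gd])
      have "norm x * norm (e n) \<le> norm x * 1" using en(2) by (intro mult_left_mono) auto
      then show "gns_norm \<phi> (x * e n) \<le> norm x"
        using gx[of "x * e n"] norm_mult_ineq[of x "e n"] by simp
    qed (use gns_norm_nonneg[OF f(1)] in auto)
    finally have 2: "cmod (\<phi> (e n * x * (1 - e n))) \<le> \<delta> * norm x" by (simp add: mult.commute)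
    have "1 / real (Suc n) \<le> 1 / real (Suc n0)" using n(1) by (simp add: frac_le)
    then have 3: "Re (\<phi> (e n * x * e n)) \<le> \<delta>\<^sup>2" using en(3) n0 by linarith
    \<comment> \<open>The last two terms contain a factor \<open>1 - e\<close> at an outer end,
      where Cauchy--Schwarz makes them at most \<open>\<delta> * norm x\<close>.\<close>
    have "x = e n * x * e n + (1 - e n) * x + e n * x * (1 - e n)" by (simp add: algebra_simps)
    then have "\<phi> x = \<phi> (e n * x * e n) + \<phi> ((1 - e n) * x) + \<phi> (e n * x * (1 - e n))"
      by (metis clf_add[OF pf_clf[OF f(1)]])
    then have "Re (\<phi> x) = Re (\<phi> (e n * x * e n)) + Re (\<phi> ((1 - e n) * x)) + Re (\<phi> (e n * x * (1 - e n)))"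
      by simp
    with 1 2 3 complex_Re_le_cmod[of "\<phi> ((1 - e n) * x)"] complex_Re_le_cmod[of "\<phi> (e n * x * (1 - e n))"]
    show ?thesis by simp
  qed
  have "((\<lambda>\<delta>. \<delta>\<^sup>2 + 2 * \<delta> * norm x) \<longlongrightarrow> 0\<^sup>2 + 2 * 0 * norm x) (at_right 0)" by (intro tendsto_intros)
  then have "Re (\<phi> x) \<le> 0\<^sup>2 + 2 * 0 * norm x"
  proof (rule tendsto_lowerbound)
    show "\<forall>\<^sub>F \<delta> in at_right 0. Re (\<phi> x) \<le> \<delta>\<^sup>2 + 2 * \<delta> * norm x"
      using bound by (auto simp: eventually_at_right_field intro: exI[of _ 1])
  qed simp
  then show ?thesis by simp
qed

text \<open>Subtracting \<open>\<omega> x\<close> from a self-adjoint \<open>x\<close> puts both the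
  difference and its negative under the one-sided estimate. Real and imaginary parts give the
  general element.\<close>

theorem pure_state_eq_if_supported:
  fixes \<omega> \<phi> :: "'a::unital_cstar_algebra \<Rightarrow> complex"
  assumes \<omega>: "pure_state \<omega>" and \<phi>: "state \<phi>"
    and ker: "left_kernel (\<lambda>x. bd_eval x \<omega>) \<subseteq> left_kernel (\<lambda>x. bd_eval x \<phi>)"
  shows "\<phi> = \<omega>"
proof
  fix a :: 'a
  have w: "positive_functional \<omega>" "\<omega> 1 = 1" using \<omega> by (simp_all add: pure_state_def state_iff)
  have f: "positive_functional \<phi>" "\<phi> 1 = 1" using \<phi> by (simp_all add: state_iff)
  note linf = clf_simps[OF pf_clf[OF f(1)]] and linw = clf_simps[OF pf_clf[OF w(1)]]
  have sa: "\<phi> x = \<omega> x" if x: "self_adjoint x" for x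
  proof -
    define c where "c = Re (\<omega> x)"
    have wc: "\<omega> x = of_real c" unfolding c_def by (rule pf_self_adjoint[OF w(1) x])
    define z where "z = x - c *\<^sub>R 1"
    have z: "self_adjoint z" "\<omega> z = 0" "self_adjoint (- z)" "\<omega> (- z) = 0"
      using x by (simp_all add: z_def self_adjoint_def cstar_simps linw w(2) wc)
    have "Re (\<phi> z) \<le> 0" "Re (\<phi> (- z)) \<le> 0"
      using pure_state_support_le_zero[OF \<omega> \<phi> ker] z by blast+
    then have "Re (\<phi> z) = 0" by (simp add: linf)
    then have "\<phi> z = 0" using pf_self_adjoint[OF f(1) z(1)] by simp
    then show ?thesis by (simp add: z_def linf f(2) wc)
  qed
  define u where "u = a + cstar a"
  define v where "v = scaleC \<i> (cstar a - a)"
  have u: "self_adjoint u" by (simp add: u_def self_adjoint_def cstar_simps add.commute)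
  have v: "self_adjoint v"
    by (simp add: v_def self_adjoint_def cstar_simps scaleC_minus_left flip: scaleC_minus_right)
  have "2 *\<^sub>R a = u + scaleC \<i> v" by (simp add: u_def v_def scaleR_2)
  then have "\<phi> (2 *\<^sub>R a) = \<omega> (2 *\<^sub>R a)" using sa[OF u] sa[OF v] by (simp add: linf linw)
  then show "\<phi> a = \<omega> a" by (simp add: linf linw)
qed

theorem theorem3p4:
  fixes S :: "'a::unital_cstar_algebra set" and s :: 'a
    and \<omega> :: "'a \<Rightarrow> complex"
  assumes "operator_system S" and "s \<in> S" and "self_adjoint s" and "norm s = 1"
    and "pure_state \<omega>"
  shows "S_peaking_state S s \<omega> \<longleftrightarrow> S_peaking_proj S s (support_proj \<omega>)"
proof -
  have cs: "cstar s = s" using assms(3) by (simp add: self_adjoint_def)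
  have \<omega>: "state \<omega>" "positive_functional \<omega>" "\<omega> 1 = 1"
    using assms(5) by (simp_all add: pure_state_def state_iff)
  note wd = pf_dual_space[OF \<omega>(2)]
  obtain p where p: "support_proj \<omega> = bd_eval p" "self_adjoint p" "p * p = p"
    "\<And>x. x \<in> left_kernel (\<lambda>x. bd_eval x \<omega>) \<longleftrightarrow> x * p = 0"
    using support_proj_exists[OF \<omega>(2)] by metis
  have cp: "cstar p = p" using p(2) by (simp add: self_adjoint_def)
  have prod_zero: "bd_eval x \<star> bd_eval y = (\<lambda>_. 0) \<longleftrightarrow> x * y = 0" for x y :: "'a bd"
    by (metis bd_eqI eval_mult eval_zero ext)
  define q where "q = 1 - p"
  have cq: "cstar q = q" and qq: "q * q = q" and pq: "p * q = 0" and qp: "q * p = 0"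
    by (simp_all add: q_def cstar_diff cp algebra_simps p(3))
  have sp_iff: "bd_embed s \<star> bd_eval p = bd_eval p \<longleftrightarrow> bd_of s * p = p"
    by (simp add: bd_eval_inject flip: eval_bd_of eval_mult)
  have one_minus: "bd_of (1 - s) * p = 0 \<longleftrightarrow> bd_of s * p = p"
    by (auto simp: bd_of_diff algebra_simps)
  have proj: "bd_projection (bd_eval p)"
    by (simp add: bd_projection_def cp p(3) flip: eval_mult eval_cstar)
  \<comment> \<open>The root \<open>w\<close> of \<open>1 - t\<close> has
    \<open>f (w* w) = 0\<close>, so \<open>w\<close> and then \<open>w w\<close> lie in the left
    kernel. It is applied to \<open>s\<close> and to \<open>- s\<close>.\<close>
  have norm_attain: "bd_of (1 - t) \<in> left_kernel (\<lambda>x. bd_eval x f)"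
    if t: "self_adjoint t" "norm t \<le> 1" and f: "state f" "f t = 1" for t and f :: "'a \<Rightarrow> complex"
  proof -
    have pf: "positive_functional f" "f 1 = 1" using f by (simp_all add: state_iff)
    note fd = pf_dual_space[OF pf(1)]
    have "positive_elem (1 - t)" using positive_elem_norm_minus[of t 1] t by simp
    then obtain w where w: "self_adjoint w" "w * w = 1 - t" using positive_elem_sqrt by metis
    have "f (cstar w * w) = 0" using w f(2) pf by (simp add: self_adjoint_def clf_diff[OF pf_clf[OF pf(1)]])
    then have "bd_of w \<in> left_kernel (\<lambda>x. bd_eval x f)"
      by (simp add: left_kernel_def eval_bd_of_dual[OF fd] flip: bd_of_cstar bd_of_mult)
    from left_kernel_mult[OF positive_functional_ext[OF pf(1)] this, of "bd_of w"]
    show ?thesis by (simp add: w(2) flip: bd_of_mult)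
  qed
  show ?thesis
  proof
    assume peak: "S_peaking_state S s \<omega>"
    then have "bd_of (1 - s) \<in> left_kernel (\<lambda>x. bd_eval x \<omega>)"
      using assms(3,4) \<omega>(1) by (intro norm_attain) (auto simp: S_peaking_state_def)
    then have sp: "bd_of s * p = p" unfolding p(4) one_minus .
    have "cmod (\<phi> s) < 1" if \<phi>: "state \<phi>" "support_proj \<phi> \<star> bd_eval p = (\<lambda>_. 0)" for \<phi>
    proof -
      have "\<phi> \<noteq> \<omega>"
      proof
        assume "\<phi> = \<omega>"
        then have "p = 0" using \<phi>(2) prod_zero[of p p] p(1,3) by simp
        then have "1 \<in> left_kernel (\<lambda>x. bd_eval x \<omega>)" unfolding p(4) by simp
        then show False using \<omega>(3) wd by (simp add: left_kernel_def eval_one)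
      qed
      then show ?thesis using peak \<phi>(1) by (simp add: S_peaking_state_def)
    qed
    then show "S_peaking_proj S s (support_proj \<omega>)"
      unfolding S_peaking_proj_def p(1) using assms(2-4) proj sp by (auto simp: sp_iff)
  next
    assume "S_peaking_proj S s (support_proj \<omega>)"
    then have sp: "bd_of s * p = p"
      and peak: "\<And>\<phi>. state \<phi> \<Longrightarrow> support_proj \<phi> \<star> bd_eval p = (\<lambda>_. 0) \<Longrightarrow> cmod (\<phi> s) < 1"
      unfolding S_peaking_proj_def p(1) sp_iff by auto
    have "cstar (bd_of s * p) = p" by (simp add: sp cp)
    then have ps: "p * bd_of s = p" by (simp add: cstar_mult cp cs flip: bd_of_cstar)
    have "q \<in> left_kernel (\<lambda>x. bd_eval x \<omega>)" unfolding p(4) by (rule qp)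
    from left_kernel_mult_eq_0[OF positive_functional_ext[OF \<omega>(2)] this]
    have wq: "bd_eval (y * q) \<omega> = 0" for y by simp
    have ws: "\<omega> s = 1"
    proof -
      \<comment> \<open>The part of \<open>s - 1\<close> on \<open>p\<close> is 0 since
        \<open>s p = p\<close>, and \<open>\<omega>\<close> does not see the part on
        \<open>q\<close>.\<close>
      have "bd_eval (bd_of (s - 1)) \<omega> = bd_eval (bd_of (s - 1) * p) \<omega> + bd_eval (bd_of (s - 1) * q) \<omega>"
        by (simp add: q_def right_diff_distrib flip: eval_add)
      also have "\<dots> = 0" using wq[of "bd_of (s - 1)"] by (simp add: bd_of_diff left_diff_distrib sp eval_zero)
      finally show ?thesis by (simp add: eval_bd_of_dual[OF wd] clf_diff[OF pf_clf[OF \<omega>(2)]] \<omega>(3))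
    qed
    have lt: "cmod (\<phi> s) < 1" if \<phi>: "state \<phi>" "\<phi> \<noteq> \<omega>" for \<phi>
    proof (rule ccontr)
      assume nlt: "\<not> cmod (\<phi> s) < 1"
      have f: "positive_functional \<phi>" "\<phi> 1 = 1" using \<phi> by (simp_all add: state_iff)
      note fd = pf_dual_space[OF f(1)] and F = positive_functional_ext[OF f(1)]
      have fs: "\<phi> s = of_real (Re (\<phi> s))" by (rule pf_self_adjoint[OF f(1) assms(3)])
      have "cmod (\<phi> s) \<le> 1" using pf_bound[OF f(1), of s] f(2) assms(4) by simp
      with nlt have "cmod (\<phi> s) = 1" by simp
      then have "\<bar>Re (\<phi> s)\<bar> = 1" using fs by (metis norm_of_real)
      then consider "\<phi> s = - 1" | "\<phi> s = 1" using fs by (cases "Re (\<phi> s) \<ge> 0") auto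
      then show False
      proof cases
        case 1
        obtain r where r: "support_proj \<phi> = bd_eval r" "self_adjoint r"
          "\<And>x. x \<in> left_kernel (\<lambda>x. bd_eval x \<phi>) \<longleftrightarrow> x * r = 0"
          using support_proj_exists[OF f(1)] by metis
        have cr: "cstar r = r" using r(2) by (simp add: self_adjoint_def)
        have "bd_of (1 - (- s)) \<in> left_kernel (\<lambda>x. bd_eval x \<phi>)"
          using assms(4) cs 1 \<phi>(1) by (intro norm_attain) (auto simp: self_adjoint_def clf_minus[OF pf_clf[OF f(1)]])
        then have "bd_of (1 + s) * r = 0" unfolding r(3) by simp
        then have "cstar (bd_of (1 + s) * r) = 0" by simp
        then have "r * bd_of (1 + s) = 0" by (simp add: cstar_mult cr cs cstar_add flip: bd_of_cstar)
        \<comment> \<open>On the right \<open>s\<close> acts on \<open>p\<close> as 1, so the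
          product is twice \<open>r p\<close>.\<close>
        then have "r * bd_of (1 + s) * p = 0" by simp
        then have "r * p + r * p = 0" by (simp add: bd_of_add algebra_simps sp)
        then have "2 *\<^sub>R (r * p) = 0" by (simp add: scaleR_2)
        then have "support_proj \<phi> \<star> bd_eval p = (\<lambda>_. 0)" unfolding r(1) prod_zero by simp
        with peak[OF \<phi>(1)] nlt show False by blast
      next
        case 2
        \<comment> \<open>This is \<open>\<phi> q\<close>, the mass of \<open>\<phi>\<close> off
          \<open>p\<close>. If it were 0, the left kernel of \<open>\<omega>\<close>, whose elements
          are of the form \<open>x q\<close>, would lie in that of \<open>\<phi>\<close>.\<close>
        define c where "c = (gns_norm (\<lambda>x. bd_eval x \<phi>) q)\<^sup>2"
        have c: "bd_eval q \<phi> = of_real c"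
          using pf_square[OF F, of q] by (simp add: c_def cq qq)
        have "c \<noteq> 0"
        proof
          assume "c = 0"
          then have qk: "q \<in> left_kernel (\<lambda>x. bd_eval x \<phi>)" by (simp add: left_kernel_def cq qq c)
          have "left_kernel (\<lambda>x. bd_eval x \<omega>) \<subseteq> left_kernel (\<lambda>x. bd_eval x \<phi>)"
          proof
            fix x assume "x \<in> left_kernel (\<lambda>x. bd_eval x \<omega>)"
            then have "x = x * q" unfolding p(4) by (simp add: q_def right_diff_distrib)
            then show "x \<in> left_kernel (\<lambda>x. bd_eval x \<phi>)" using left_kernel_mult[OF F qk, of x] by simp
          qed
          then show False using pure_state_eq_if_supported[OF assms(5) \<phi>(1)] \<phi>(2) by blast
        qed
        then have c0: "0 < c" by (simp add: c_def)
        obtain f' where f': "f' \<in> dual_space" "\<And>y. bd_eval (q * y * q) \<phi> = bd_eval y f'"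
          using bd_compress[OF fd, of q q] by metis
        define \<psi> where "\<psi> a = of_real (1 / c) * f' a" for a
        have \<psi>_eval: "bd_eval y \<psi> = of_real (1 / c) * bd_eval (q * y * q) \<phi>" for y
          unfolding \<psi>_def f'(2) by (rule bidual_scale[OF bd_eval f'(1)])
        have \<psi>d: "\<psi> \<in> dual_space" unfolding \<psi>_def by (rule dual_space_scale[OF f'(1)])
        have \<psi>_of: "\<psi> a = of_real (1 / c) * bd_eval (q * bd_of a * q) \<phi>" for a
          using \<psi>_eval[of "bd_of a"] by (simp add: eval_bd_of_dual[OF \<psi>d])
        have "positive_functional \<psi>"
          unfolding positive_functional_def
        proof (intro conjI allI)
          show "clinear_functional \<psi>" by (rule dual_spaceD[OF \<psi>d])
          fix a
          have "q * bd_of (cstar a * a) * q = cstar (bd_of a * q) * (bd_of a * q)"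
            by (simp add: cstar_mult cq bd_of_mult bd_of_cstar mult.assoc)
          then have "\<psi> (cstar a * a) = of_real ((1 / c) * (gns_norm (\<lambda>x. bd_eval x \<phi>) (bd_of a * q))\<^sup>2)"
            using pf_square[OF F, of "bd_of a * q"] by (simp add: \<psi>_of)
          then show "\<psi> (cstar a * a) \<in> \<real>" "0 \<le> Re (\<psi> (cstar a * a))" using c0 by simp_all
        qed
        moreover have "\<psi> 1 = 1" using c0 by (simp add: \<psi>_of qq c)
        ultimately have \<psi>: "state \<psi>" "positive_functional \<psi>" by (simp_all add: state_iff)
        obtain r where r: "support_proj \<psi> = bd_eval r" "self_adjoint r"
          "\<And>x. x \<in> left_kernel (\<lambda>x. bd_eval x \<psi>) \<longleftrightarrow> x * r = 0"
          using support_proj_exists[OF \<psi>(2)] by metis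
        \<comment> \<open>Since \<open>q p = 0\<close>, the compression annihilates
          \<open>p\<close>, so \<open>p r = 0\<close>; the adjoint puts the support on the
          left.\<close>
        have "p \<in> left_kernel (\<lambda>x. bd_eval x \<psi>)"
          by (simp add: left_kernel_def \<psi>_eval cp p(3) qp eval_zero)
        then have "cstar (p * r) = 0" unfolding r(3) by simp
        then have "r * p = 0" using r(2) by (simp add: cstar_mult cp self_adjoint_def)
        then have "support_proj \<psi> \<star> bd_eval p = (\<lambda>_. 0)" unfolding r(1) prod_zero .
        then have "cmod (\<psi> s) < 1" by (rule peak[OF \<psi>(1)])
        moreover have "\<psi> s = 1"
        proof -
          \<comment> \<open>From \<open>s p = p = p s\<close>. As \<open>\<phi> s = 1\<close>, the
            compressed value is \<open>1 - \<phi> p = \<phi> q = c\<close>, which the normalisation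
            turns into 1.\<close>
          have "q * bd_of s * q = bd_of s - p"
            by (simp add: q_def algebra_simps sp ps p(3))
          then have "bd_eval (q * bd_of s * q) \<phi> = bd_eval (1 - p) \<phi>"
            using 2 f(2) by (simp add: eval_diff eval_bd_of_dual[OF fd] eval_one[OF fd])
          then show ?thesis using c0 by (simp add: \<psi>_of c flip: q_def)
        qed
        ultimately show False by simp
      qed
    qed
    show "S_peaking_state S s \<omega>"
      unfolding S_peaking_state_def using assms(2-4) \<omega>(1) ws lt by blast
  qed
qed

end
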